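(* The following deadlock detection problem for disjunctive systems is decidable in NEXPTIME: given disjunctive process templates $A$ and $B$, decide whether the counter system $M$ of $A$ and $B$ has a deadlocked run, i.e., a finite maximal path starting in an initial state.
   Context: Let $Q_A,Q_B$ be disjoint finite sets, $Q=Q_A\cup Q_B$. A (disjunctive) process template is $U=(Q_U,\mathit{init}_U,\mathcal G_U,\delta_U)$, $U\in\{A,B\}$, with $\mathit{init}_U\in Q_U$, guards $\mathcal G_U\subseteq\mathcal P(Q)$, total transition relation $\delta_U\subseteq Q_U\times\mathcal G_U\times Q_U$. Write $Q_B=\{q_0,\dots,q_{|B|-1}\}$, $\vec u_i$ unit vectors. The counter system $M=(S,S_0,\Delta)$ (representing the systems consisting of one $A$-process and $n$ $B$-processes, for all $n$) has $S=Q_A\times\mathbb N_0^{|B|}$, $S_0=\{(\mathit{init}_A,\vec c)\mid\vec c(q)=0\text{ for }q\ne\mathit{init}_B\}$, and $((q_A,\vec c),(q'_A,\vec c'))\in\Delta$ iff (1) $\vec c'=\vec c$ and some $(q_A,g,q'_A)\in\delta_A$ has some $q_i\in g\cap Q_B$ with $\vec c(i)\ge1$; or (2) $q'_A=q_A$ and some $(q_i,g,q_j)\in\delta_B$ has $\vec c(i)\ge1$, $\vec c'=\vec c-\vec u_i+\vec u_j$, and ($q_A\in g$, or some $q_l\in g\cap Q_B$, $l\ne i$, with $\vec c(l)\ge1$, or $q_i\in g$ and $\vec c(i)\ge2$). A path is a finite or infinite sequence of states with consecutive states related by $\Delta$; a maximal path is one that cannot be extended; a run is a maximal path starting in $S_0$;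 a run is deadlocked if it is finite. *)

theory Defs
  imports "HOL-Computational_Algebra.Polynomial"
begin

section \<open>Disjunctive process templates and their counter system\<close>

record 'q template =
  states :: "'q set"
  init :: 'q
  guards :: "'q set set"
  delta :: "('q \<times> 'q set \<times> 'q) set"

definition disjunctive_template :: "'q set \<Rightarrow> 'q template \<Rightarrow> bool" where
  "disjunctive_template Q U \<longleftrightarrow>
     finite (states U) \<and> init U \<in> states U \<and> guards U \<subseteq> Pow Q \<and>
     delta U \<subseteq> states U \<times> guards U \<times> states U \<and>
     (\<forall>q\<in>states U. \<exists>g q'. (q, g, q') \<in> delta U)"

definition disjunctive_templates :: "'q template \<Rightarrow> 'q template \<Rightarrow> bool" where
  "disjunctive_templates A B \<longleftrightarrow>
     states A \<inter> states B = {} \<and>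
     disjunctive_template (states A \<union> states B) A \<and>
     disjunctive_template (states A \<union> states B) B"

text \<open>A vector of counters indexed by the states of B is a function that vanishes
  outside those states.\<close>

type_synonym 'q cstate = "'q \<times> ('q \<Rightarrow> nat)"

definition cs_states :: "'q template \<Rightarrow> 'q template \<Rightarrow> 'q cstate set" where
  "cs_states A B = {(qA, c). qA \<in> states A \<and> (\<forall>q. q \<notin> states B \<longrightarrow> c q = 0)}"

definition cs_init :: "'q template \<Rightarrow> 'q template \<Rightarrow> 'q cstate set" where
  "cs_init A B = {(qA, c) \<in> cs_states A B. qA = init A \<and> (\<forall>q. q \<noteq> init B \<longrightarrow> c q = 0)}"

definition unit_vec :: "'q \<Rightarrow> 'q \<Rightarrow> nat" where
  "unit_vec i = (\<lambda>q. if q = i then 1 else 0)"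

definition cs_trans :: "'q template \<Rightarrow> 'q template \<Rightarrow> ('q cstate \<times> 'q cstate) set" where
  "cs_trans A B = {((qA, c), (qA', c')).
     (qA, c) \<in> cs_states A B \<and> (qA', c') \<in> cs_states A B \<and>
     (c' = c \<and> (\<exists>g. (qA, g, qA') \<in> delta A \<and> (\<exists>i \<in> g \<inter> states B. c i \<ge> 1)) \<or>
      qA' = qA \<and> (\<exists>i g j. (i, g, j) \<in> delta B \<and> c i \<ge> 1 \<and>
        c' = (\<lambda>q. c q - unit_vec i q + unit_vec j q) \<and>
        (qA \<in> g \<or> (\<exists>l \<in> g \<inter> states B. l \<noteq> i \<and> c l \<ge> 1) \<or> i \<in> g \<and> c i \<ge> 2)))}"

datatype 's path = Finite_Path "'s list" | Infinite_Path "nat \<Rightarrow> 's"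

fun is_path :: "'s set \<Rightarrow> ('s \<times> 's) set \<Rightarrow> 's path \<Rightarrow> bool" where
  "is_path S R (Finite_Path xs) \<longleftrightarrow>
     xs \<noteq> [] \<and> set xs \<subseteq> S \<and> (\<forall>i. Suc i < length xs \<longrightarrow> (xs ! i, xs ! Suc i) \<in> R)"
| "is_path S R (Infinite_Path f) \<longleftrightarrow> range f \<subseteq> S \<and> (\<forall>i. (f i, f (Suc i)) \<in> R)"

fun path_start :: "'s path \<Rightarrow> 's" where
  "path_start (Finite_Path xs) = hd xs"
| "path_start (Infinite_Path f) = f 0"

fun finite_path :: "'s path \<Rightarrow> bool" where
  "finite_path (Finite_Path xs) \<longleftrightarrow> True"
| "finite_path (Infinite_Path f) \<longleftrightarrow> False"

fun extendable :: "'s set \<Rightarrow> ('s \<times> 's) set \<Rightarrow> 's path \<Rightarrow> bool" where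
  "extendable S R (Finite_Path xs) \<longleftrightarrow> (\<exists>s. is_path S R (Finite_Path (xs @ [s])))"
| "extendable S R (Infinite_Path f) \<longleftrightarrow> False"

definition is_run :: "'q template \<Rightarrow> 'q template \<Rightarrow> 'q cstate path \<Rightarrow> bool" where
  "is_run A B \<pi> \<longleftrightarrow>
     is_path (cs_states A B) (cs_trans A B) \<pi> \<and>
     \<not> extendable (cs_states A B) (cs_trans A B) \<pi> \<and>
     path_start \<pi> \<in> cs_init A B"

definition deadlocked_run :: "'q template \<Rightarrow> 'q template \<Rightarrow> 'q cstate path \<Rightarrow> bool" where
  "deadlocked_run A B \<pi> \<longleftrightarrow> is_run A B \<pi> \<and> finite_path \<pi>"

definition has_deadlocked_run :: "'q template \<Rightarrow> 'q template \<Rightarrow> bool" where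
  "has_deadlocked_run A B \<longleftrightarrow> (\<exists>\<pi>. deadlocked_run A B \<pi>)"

text \<open>The initial states include the one without any B-process, and that state has no
  successor.  The following variant asks for a deadlocked run of a system with
  at least one B-process.\<close>

definition has_deadlocked_run_pos :: "'q template \<Rightarrow> 'q template \<Rightarrow> bool" where
  "has_deadlocked_run_pos A B \<longleftrightarrow>
     (\<exists>\<pi>. deadlocked_run A B \<pi> \<and> snd (path_start \<pi>) (init B) \<ge> 1)"

section \<open>Binary encoding of pairs of templates\<close>

text \<open>States are the numbers below the total number of states, those of A first; they are
  written in unary, and guards are written as characteristic vectors.  As the transition
  relations are total, every state is the source of a listed transition, so writing the
  state names in binary would change the length of an encoding at most polynomially.\<close>

definition enc_nat :: "nat \<Rightarrow> bool list" where
  "enc_nat n = replicate n True @ [False]"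

definition enc_list :: "('a \<Rightarrow> bool list) \<Rightarrow> 'a list \<Rightarrow> bool list" where
  "enc_list f xs = concat (map (\<lambda>x. True # f x) xs) @ [False]"

definition enc_set :: "nat \<Rightarrow> nat set \<Rightarrow> bool list" where
  "enc_set n g = map (\<lambda>q. q \<in> g) [0..<n]"

definition enc_edge :: "nat \<times> nat \<Rightarrow> bool list" where
  "enc_edge = (\<lambda>(p, q). enc_nat p @ enc_nat q)"

text \<open>The guards and transitions of a template are given by a list of guards, each with
  the list of the edges that carry it (possibly none).  The order of the lists is arbitrary
  and repetitions are allowed.\<close>

type_synonym listing = "(nat set \<times> (nat \<times> nat) list) list"

definition lists_template :: "listing \<Rightarrow> nat template \<Rightarrow> bool" where
  "lists_template bs U \<longleftrightarrow>
     guards U = fst ` set bs \<and>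
     delta U = {(p, g, q). \<exists>es. (g, es) \<in> set bs \<and> (p, q) \<in> set es}"

definition enc_template :: "nat \<Rightarrow> nat \<Rightarrow> listing \<Rightarrow> bool list" where
  "enc_template n i bs =
     enc_nat i @ enc_list (\<lambda>(g, es). enc_set n g @ enc_list enc_edge es) bs"

definition encodes :: "bool list \<Rightarrow> nat template \<Rightarrow> nat template \<Rightarrow> bool" where
  "encodes w A B \<longleftrightarrow> (\<exists>a b bsA bsB.
     states A = {0..<a} \<and> states B = {a..<a + b} \<and>
     lists_template bsA A \<and> lists_template bsB B \<and>
     w = enc_nat a @ enc_nat b @
         enc_template (a + b) (init A) bsA @ enc_template (a + b) (init B) bsB)"

definition template_problem :: "(nat template \<Rightarrow> nat template \<Rightarrow> bool) \<Rightarrow> bool list set" where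
  "template_problem P = {w. \<exists>A B. disjunctive_templates A B \<and> encodes w A B \<and> P A B}"

section \<open>Nondeterministic multi-tape Turing machines and NEXPTIME\<close>

datatype dir = Move_Left | Stay | Move_Right

text \<open>States and tape symbols are natural numbers.  The symbol 0 is the blank; 1 and 2 stand
  for the input letters False and True.\<close>

record ntm =
  num_tapes :: nat
  ntm_states :: "nat set"
  alphabet :: "nat set"
  start_state :: nat
  accept_state :: nat
  transitions :: "(nat \<times> nat list \<times> nat \<times> (nat \<times> dir) list) set"

definition is_ntm :: "ntm \<Rightarrow> bool" where
  "is_ntm M \<longleftrightarrow>
     num_tapes M \<ge> 1 \<and> finite (ntm_states M) \<and> finite (alphabet M) \<and>
     {0, 1, 2} \<subseteq> alphabet M \<and>
     start_state M \<in> ntm_states M \<and> accept_state M \<in> ntm_states M \<and>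
     (\<forall>(q, rs, q', ws) \<in> transitions M.
        q \<in> ntm_states M - {accept_state M} \<and> q' \<in> ntm_states M \<and>
        length rs = num_tapes M \<and> set rs \<subseteq> alphabet M \<and>
        length ws = num_tapes M \<and> fst ` set ws \<subseteq> alphabet M)"

text \<open>A tape is infinite in both directions and comes with its head position.\<close>

type_synonym tape = "(int \<Rightarrow> nat) \<times> int"

type_synonym config = "nat \<times> tape list"

fun read_tape :: "tape \<Rightarrow> nat" where
  "read_tape (t, h) = t h"

fun move :: "dir \<Rightarrow> int \<Rightarrow> int" where
  "move Move_Left h = h - 1"
| "move Stay h = h"
| "move Move_Right h = h + 1"

fun act_tape :: "nat \<times> dir \<Rightarrow> tape \<Rightarrow> tape" where
  "act_tape (s, d) (t, h) = (t(h := s), move d h)"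

definition ntm_step :: "ntm \<Rightarrow> (config \<times> config) set" where
  "ntm_step M = {((q, ts), (q', ts')).
     \<exists>ws. (q, map read_tape ts, q', ws) \<in> transitions M \<and> ts' = map2 act_tape ws ts}"

definition input_tape :: "bool list \<Rightarrow> tape" where
  "input_tape w =
     ((\<lambda>i. if 0 \<le> i \<and> i < int (length w) then (if w ! nat i then 2 else 1) else 0), 0)"

definition start_config :: "ntm \<Rightarrow> bool list \<Rightarrow> config" where
  "start_config M w =
     (start_state M, input_tape w # replicate (num_tapes M - 1) ((\<lambda>_. 0), 0))"

definition ntm_accepts :: "ntm \<Rightarrow> bool list \<Rightarrow> bool" where
  "ntm_accepts M w \<longleftrightarrow>
     (\<exists>c. (start_config M w, c) \<in> (ntm_step M)\<^sup>* \<and> fst c = accept_state M)"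

text \<open>The time bound applies to every computation, on every input, accepting or not.\<close>

definition ntm_time_bound :: "ntm \<Rightarrow> (nat \<Rightarrow> nat) \<Rightarrow> bool" where
  "ntm_time_bound M T \<longleftrightarrow>
     (\<forall>w m c. (start_config M w, c) \<in> ntm_step M ^^ m \<longrightarrow> m \<le> T (length w))"

definition NTIME :: "(nat \<Rightarrow> nat) \<Rightarrow> bool list set set" where
  "NTIME T = {L. \<exists>M. is_ntm M \<and> ntm_time_bound M T \<and> L = {w. ntm_accepts M w}}"

definition NEXPTIME :: "bool list set set" where
  "NEXPTIME = (\<Union>p :: nat poly. NTIME (\<lambda>n. 2 ^ poly p n))"

end

theory Submission imports Defs begin

text \<open>Membership in NEXPTIME of the first problem is a check of the encoding, since a deadlock is
  always reached from the initial state without B-processes.  For the second problem, the counter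
  system with \<open>n\<close> B-processes is replaced by a set of individual processes.  If \<open>H\<close> is the number of
  states, \<open>H\<^sup>2\<close> B-processes suffice for a deadlock: processes that end in a state that finally holds
  few processes are kept, and the others are replaced by one lingering process per state, which
  stays in the state for as long as a guard may need it.  A configuration of so many processes is a
  set of polynomially bounded numbers, and whether two such sets are consecutive is described by a
  bounded formula over the input.  A nondeterministic machine guesses the sequence of these sets;
  repetitions can be cut out, so exponentially many sets suffice.\<close>

section \<open>Structured nondeterministic programs on tapes\<close>

text \<open>The time bound concerns every computation, also the failing ones, so a program comes
  with its exact set of final stores and a bound on all its computations; a wrong guess is one
  without a final store. Numbers are head positions, hence unary, and running times are tracked only
  as a fixed power of any \<open>N\<close> that bounds the data. Such bounds compose, and the same
  calculus serves the outer loop, with \<open>N\<close> exponential in the input. As success means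
  that some computation ends, checks cannot be negated mechanically; formulas are built from
  positive forms, and universal and existential readings of the input are defined separately. The
  constants: at most H - 1 processes are kept for each of the H states and at most one lingers per
  state, and H * (H - 1) + H = H * H. With n the input length, H \<le> n and process numbers are at
  most n * n, so the codes p * n + q + 1 lie below P = n * n * n + n + 2. A relation on subsets of
  {..<P} has at most 2 ^ P * 2 ^ P = 4 ^ P pairs, which bounds the number of steps to be
  simulated.\<close>

datatype com =
    Skip
  | Act nat "nat \<Rightarrow> nat set" dir
  | Seq com com (infixr \<open>;;\<close> 60)
  | Choice com com
  | Cond nat "nat set" com com
  | Loop nat "nat set" com

type_synonym store = "nat \<Rightarrow> tape"
type_synonym action = "(nat \<times> nat \<times> dir) option"

text \<open>Control steps carry the action \<open>None\<close> and leave all tapes alone, so one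
  step touches at most one tape. An \<open>Act\<close> with an empty set of symbols has no successor
  and thus fails. The condition \<open>s < 3\<close> confines writing to the alphabet of the
  machine.\<close>

fun succs :: "com \<Rightarrow> (nat \<Rightarrow> nat) \<Rightarrow> (com \<times> action) set" where
  "succs Skip rs = {}"
| "succs (Act i f d) rs = {(Skip, Some (i, s, d)) | s. s \<in> f (rs i) \<and> s < 3}"
| "succs (Seq a b) rs =
     (if a = Skip then {(b, None)} else (\<lambda>(a', x). (Seq a' b, x)) ` succs a rs)"
| "succs (Choice a b) rs = {(a, None), (b, None)}"
| "succs (Cond i A a b) rs = {(if rs i \<in> A then a else b, None)}"
| "succs (Loop i A c) rs = {(if rs i \<in> A then Seq c (Loop i A c) else Skip, None)}"

fun update :: "action \<Rightarrow> store \<Rightarrow> store" where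
  "update None \<sigma> = \<sigma>"
| "update (Some (i, s, d)) \<sigma> = \<sigma>(i := act_tape (s, d) (\<sigma> i))"

definition reads :: "store \<Rightarrow> nat \<Rightarrow> nat" where
  "reads \<sigma> i = read_tape (\<sigma> i)"

text \<open>Every computation has at most \<open>t\<close> steps, and \<open>R\<close> is exactly the set of final stores.\<close>

inductive exec :: "com \<Rightarrow> store \<Rightarrow> nat \<Rightarrow> store set \<Rightarrow> bool" where
  Done: "exec Skip \<sigma> t {\<sigma>}"
| Step: "c \<noteq> Skip \<Longrightarrow>
    (\<And>c' x. (c', x) \<in> succs c (reads \<sigma>) \<Longrightarrow> exec c' (update x \<sigma>) t (R c' x)) \<Longrightarrow>
    Y = (\<Union>(c', x)\<in>succs c (reads \<sigma>). R c' x) \<Longrightarrow> exec c \<sigma> (Suc t) Y"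

lemma exec_mono: "exec c \<sigma> t R \<Longrightarrow> t \<le> t' \<Longrightarrow> exec c \<sigma> t' R"
proof (induction arbitrary: t' rule: exec.induct)
  case (Done \<sigma> t)
  show ?case by (rule exec.Done)
next
  case (Step c \<sigma> t R Y)
  then obtain t'' where t'': "t' = Suc t''" "t \<le> t''" by (cases t') auto
  show ?case unfolding t''(1)
    by (rule exec.Step[where R = R]) (use Step t'' in auto)
qed

lemma exec_Seq:
  assumes "exec a \<sigma> t R" "\<And>\<tau>. \<tau> \<in> R \<Longrightarrow> exec b \<tau> u (Z \<tau>)"
  shows "exec (a ;; b) \<sigma> (Suc (t + u)) (\<Union>\<tau>\<in>R. Z \<tau>)"
  using assms
proof (induction rule: exec.induct)
  case (Done \<sigma> t)
  show ?case
  proof (rule exec.Step[where R = "\<lambda>_ _. Z \<sigma>"])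
    fix c' x assume "(c', x) \<in> succs (Skip ;; b) (reads \<sigma>)"
    then show "exec c' (update x \<sigma>) (t + u) (Z \<sigma>)"
      using exec_mono[OF Done[of \<sigma>], of "t + u"] by simp
  qed auto
next
  case (Step c \<sigma> t R Y)
  show ?case
  \<comment> \<open>Every successor of \<open>c ;; b\<close> has the form \<open>a' ;; b\<close>;
    the \<open>case\<close> recovers \<open>a'\<close>, for which the final stores are
    known.\<close>
  proof (rule exec.Step[where R = "\<lambda>c' x. \<Union>\<tau>\<in>R (case c' of Seq a' _ \<Rightarrow> a' | _ \<Rightarrow> Skip) x. Z \<tau>"])
    fix c' x assume "(c', x) \<in> succs (c ;; b) (reads \<sigma>)"
    then obtain a' where a': "c' = a' ;; b" "(a', x) \<in> succs c (reads \<sigma>)"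
      using Step.hyps(1) by auto
    have "exec (a' ;; b) (update x \<sigma>) (Suc (t + u)) (\<Union>\<tau>\<in>R a' x. Z \<tau>)"
      by (rule Step.IH[OF a'(2)]) (use Step.prems Step.hyps a' in blast)
    then show "exec c' (update x \<sigma>) (Suc t + u)
        (\<Union>\<tau>\<in>R (case c' of Seq a' _ \<Rightarrow> a' | _ \<Rightarrow> Skip) x. Z \<tau>)"
      using a' by simp
  next
    show "(\<Union>\<tau>\<in>Y. Z \<tau>) = (\<Union>(c', x)\<in>succs (c ;; b) (reads \<sigma>).
        \<Union>\<tau>\<in>R (case c' of Seq a' _ \<Rightarrow> a' | _ \<Rightarrow> Skip) x. Z \<tau>)"
      using Step.hyps by (auto simp: split_beta)
  qed auto
qed

text \<open>Sets of stores on both sides: the final stores of a nondeterministic program are the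
  initial stores of the next one, with one time bound for all of them.\<close>

definition runs :: "com \<Rightarrow> store set \<Rightarrow> nat \<Rightarrow> store set \<Rightarrow> bool" where
  "runs c X t Y \<longleftrightarrow> (\<exists>R. (\<forall>\<sigma>\<in>X. exec c \<sigma> t (R \<sigma>)) \<and> Y = (\<Union>\<sigma>\<in>X. R \<sigma>))"

lemma runs_mono: "runs c X t Y \<Longrightarrow> t \<le> t' \<Longrightarrow> runs c X t' Y"
  unfolding runs_def using exec_mono by blast

lemma runs_empty: "runs c {} t {}"
  unfolding runs_def by auto

text \<open>A derivation explores all successors, so the set of final stores depends on the program
  and the store alone. Final sets obtained in different ways therefore agree.\<close>

lemma exec_unique: "exec c \<sigma> t R \<Longrightarrow> exec c \<sigma> t' R' \<Longrightarrow> R = R'"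
proof (induction arbitrary: t' R' rule: exec.induct)
  case (Done \<sigma> t)
  then show ?case by (auto elim: exec.cases)
next
  case (Step c \<sigma> t R Y)
  from Step.prems Step.hyps(1) obtain u R2 where
    R2: "\<And>c' x. (c', x) \<in> succs c (reads \<sigma>) \<Longrightarrow> exec c' (update x \<sigma>) u (R2 c' x)"
    "R' = (\<Union>(c', x)\<in>succs c (reads \<sigma>). R2 c' x)"
    by cases blast+
  then show ?case unfolding Step.hyps(3) R2(2) using Step.IH by fastforce
qed

lemma runs_UN:
  assumes "\<And>j. j \<in> J \<Longrightarrow> runs c (X j) t (Y j)"
  shows "runs c (\<Union>j\<in>J. X j) t (\<Union>j\<in>J. Y j)"
proof -
  obtain R where R: "\<And>j \<sigma>. j \<in> J \<Longrightarrow> \<sigma> \<in> X j \<Longrightarrow> exec c \<sigma> t (R j \<sigma>)"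
    "\<And>j. j \<in> J \<Longrightarrow> Y j = (\<Union>\<sigma>\<in>X j. R j \<sigma>)"
    using assms unfolding runs_def by metis
  \<comment> \<open>A store may lie in several of the sets \<open>X j\<close>; one of them is
    picked, and \<open>exec_unique\<close> shows that the pick does not matter.\<close>
  define R' where "R' \<sigma> = R (SOME j. j \<in> J \<and> \<sigma> \<in> X j) \<sigma>" for \<sigma>
  have R': "R' \<sigma> = R j \<sigma>" if "j \<in> J" "\<sigma> \<in> X j" for j \<sigma>
  proof -
    have "(SOME j. j \<in> J \<and> \<sigma> \<in> X j) \<in> J \<and> \<sigma> \<in> X (SOME j. j \<in> J \<and> \<sigma> \<in> X j)"
      by (rule someI) (use that in blast)
    then show ?thesis unfolding R'_def using exec_unique R that by metis
  qed
  show ?thesis unfolding runs_def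
    by (intro exI[of _ R']) (use R R' in auto)
qed

lemma runs_Skip: "runs Skip X t X"
  unfolding runs_def by (intro exI[of _ "\<lambda>\<sigma>. {\<sigma>}"]) (auto intro: Done)

lemma runs_Act:
  "runs (Act i f d) {\<sigma>} (Suc 0)
     ((\<lambda>s. \<sigma>(i := act_tape (s, d) (\<sigma> i))) ` {s \<in> f (reads \<sigma> i). s < 3})"
proof -
  have "exec (Act i f d) \<sigma> (Suc 0)
     ((\<lambda>s. \<sigma>(i := act_tape (s, d) (\<sigma> i))) ` {s \<in> f (reads \<sigma> i). s < 3})"
  proof (rule exec.Step[where R = "\<lambda>c' x. {update x \<sigma>}"])
    fix c' x assume "(c', x) \<in> succs (Act i f d) (reads \<sigma>)"
    then have "c' = Skip" by auto
    then show "exec c' (update x \<sigma>) 0 {update x \<sigma>}" by (simp add: Done)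
  qed auto
  then show ?thesis unfolding runs_def by auto
qed

lemma runs_Seq:
  assumes "runs a X t Y" "runs b Y u Z"
  shows "runs (a ;; b) X (Suc (t + u)) Z"
proof -
  obtain R1 where R1: "\<And>\<sigma>. \<sigma> \<in> X \<Longrightarrow> exec a \<sigma> t (R1 \<sigma>)" "Y = (\<Union>\<sigma>\<in>X. R1 \<sigma>)"
    using assms(1) unfolding runs_def by blast
  obtain R2 where R2: "\<And>\<sigma>. \<sigma> \<in> Y \<Longrightarrow> exec b \<sigma> u (R2 \<sigma>)" "Z = (\<Union>\<sigma>\<in>Y. R2 \<sigma>)"
    using assms(2) unfolding runs_def by blast
  have "exec (a ;; b) \<sigma> (Suc (t + u)) (\<Union>\<tau>\<in>R1 \<sigma>. R2 \<tau>)" if "\<sigma> \<in> X" for \<sigma>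
    by (rule exec_Seq[OF R1(1)[OF that]]) (use R1 R2 that in auto)
  then show ?thesis unfolding runs_def
    by (intro exI[of _ "\<lambda>\<sigma>. \<Union>\<tau>\<in>R1 \<sigma>. R2 \<tau>"]) (use R1 R2 in auto)
qed

lemma runs_Choice:
  assumes "runs a X t Y" "runs b X u Z"
  shows "runs (Choice a b) X (Suc (t + u)) (Y \<union> Z)"
proof -
  obtain R1 where R1: "\<And>\<sigma>. \<sigma> \<in> X \<Longrightarrow> exec a \<sigma> t (R1 \<sigma>)" "Y = (\<Union>\<sigma>\<in>X. R1 \<sigma>)"
    using assms(1) unfolding runs_def by blast
  obtain R2 where R2: "\<And>\<sigma>. \<sigma> \<in> X \<Longrightarrow> exec b \<sigma> u (R2 \<sigma>)" "Z = (\<Union>\<sigma>\<in>X. R2 \<sigma>)"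
    using assms(2) unfolding runs_def by blast
  have "exec (Choice a b) \<sigma> (Suc (t + u)) (R1 \<sigma> \<union> R2 \<sigma>)" if "\<sigma> \<in> X" for \<sigma>
  \<comment> \<open>For \<open>a = b\<close> the two successors coincide, and a family that tells
    them apart by the residual program would not be well defined.\<close>
  proof (cases "a = b")
    case True
    have "R1 \<sigma> = R2 \<sigma>" using exec_unique R1(1)[OF that] R2(1)[OF that] True by blast
    then show ?thesis
      by (intro exec.Step[where R = "\<lambda>_ _. R1 \<sigma>"])
        (use True exec_mono[OF R1(1)[OF that], of "t + u"] in auto)
  next
    case False
    then show ?thesis
    proof (intro exec.Step[where R = "\<lambda>c' _. if c' = a then R1 \<sigma> else R2 \<sigma>"])
      show "exec c' (update x \<sigma>) (t + u) (if c' = a then R1 \<sigma> else R2 \<sigma>)"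
        if "(c', x) \<in> succs (Choice a b) (reads \<sigma>)" for c' x
        using that False exec_mono[OF R1(1)[OF \<open>\<sigma> \<in> X\<close>], of "t + u"]
          exec_mono[OF R2(1)[OF \<open>\<sigma> \<in> X\<close>], of "t + u"] by auto
    qed auto
  qed
  then show ?thesis unfolding runs_def
    by (intro exI[of _ "\<lambda>\<sigma>. R1 \<sigma> \<union> R2 \<sigma>"]) (use R1 R2 in auto)
qed

lemma runs_det:
  assumes c: "c \<noteq> Skip" and s: "\<And>\<sigma>. \<sigma> \<in> X \<Longrightarrow> succs c (reads \<sigma>) = {(c', None)}"
    and r: "runs c' X t Y"
  shows "runs c X (Suc t) Y"
proof -
  obtain R where R: "\<And>\<sigma>. \<sigma> \<in> X \<Longrightarrow> exec c' \<sigma> t (R \<sigma>)" "Y = (\<Union>\<sigma>\<in>X. R \<sigma>)"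
    using r unfolding runs_def by blast
  have "exec c \<sigma> (Suc t) (R \<sigma>)" if "\<sigma> \<in> X" for \<sigma>
    by (rule exec.Step[where R = "\<lambda>_ _. R \<sigma>"]) (use c s R that in auto)
  then show ?thesis unfolding runs_def using R by blast
qed

lemma runs_Cond:
  assumes "runs a {\<sigma> \<in> X. reads \<sigma> i \<in> A} t Y" "runs b {\<sigma> \<in> X. reads \<sigma> i \<notin> A} u Z"
  shows "runs (Cond i A a b) X (Suc (t + u)) (Y \<union> Z)"
proof -
  have 1: "runs (Cond i A a b) {\<sigma> \<in> X. reads \<sigma> i \<in> A} (Suc (t + u)) Y"
    by (rule runs_mono[OF runs_det[OF _ _ assms(1)]]) auto
  have 2: "runs (Cond i A a b) {\<sigma> \<in> X. reads \<sigma> i \<notin> A} (Suc (t + u)) Z"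
    by (rule runs_mono[OF runs_det[OF _ _ assms(2)]]) auto
  have X: "X = (\<Union>j. if j then {\<sigma> \<in> X. reads \<sigma> i \<in> A} else {\<sigma> \<in> X. reads \<sigma> i \<notin> A})"
    by (auto split: if_splits)
  have Y: "Y \<union> Z = (\<Union>j. if j then Y else Z)" by (auto split: if_splits)
  show ?thesis unfolding Y by (subst X, rule runs_UN) (use 1 2 in auto)
qed

lemma runs_Loop_exit:
  "(\<And>\<sigma>. \<sigma> \<in> X \<Longrightarrow> reads \<sigma> i \<notin> A) \<Longrightarrow> runs (Loop i A c) X (Suc 0) X"
  by (rule runs_det[OF _ _ runs_Skip]) auto

lemma runs_Loop_enter:
  assumes "\<And>\<sigma>. \<sigma> \<in> X \<Longrightarrow> reads \<sigma> i \<in> A" "runs c X t Y" "runs (Loop i A c) Y u Z"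
  shows "runs (Loop i A c) X (Suc (Suc (t + u))) Z"
  by (rule runs_det[OF _ _ runs_Seq[OF assms(2,3)]]) (use assms(1) in auto)

section \<open>Programs as Turing machines\<close>

text \<open>The control states of the machine are the residual programs.\<close>

fun resid :: "com \<Rightarrow> com set" where
  "resid Skip = {Skip}"
| "resid (Act i f d) = {Act i f d, Skip}"
| "resid (Seq a b) = (\<lambda>a'. Seq a' b) ` resid a \<union> resid b"
| "resid (Choice a b) = {Choice a b} \<union> resid a \<union> resid b"
| "resid (Cond i A a b) = {Cond i A a b} \<union> resid a \<union> resid b"
| "resid (Loop i A c) = {Loop i A c, Skip} \<union> (\<lambda>a. Seq a (Loop i A c)) ` resid c"

fun uses :: "com \<Rightarrow> nat set" where
  "uses Skip = {}"
| "uses (Act i f d) = {i}"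
| "uses (Seq a b) = uses a \<union> uses b"
| "uses (Choice a b) = uses a \<union> uses b"
| "uses (Cond i A a b) = {i} \<union> uses a \<union> uses b"
| "uses (Loop i A c) = {i} \<union> uses c"

lemma finite_resid: "finite (resid c)"
  by (induction c) auto

lemma finite_uses: "finite (uses c)"
  by (induction c) auto

lemma resid_self: "c \<in> resid c"
  by (induction c) auto

lemma Skip_resid: "Skip \<in> resid c"
  by (induction c) auto

lemma resid_closed: "c' \<in> resid c \<Longrightarrow> (c'', x) \<in> succs c' rs \<Longrightarrow> c'' \<in> resid c"
  by (induction c arbitrary: c' c'')
    (auto simp: resid_self Skip_resid split: if_splits)

lemma uses_resid: "c' \<in> resid c \<Longrightarrow> uses c' \<subseteq> uses c"
  by (induction c arbitrary: c') (auto, blast+)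

lemma succs_cong: "(\<And>i. i \<in> uses c \<Longrightarrow> rs i = rs' i) \<Longrightarrow> succs c rs = succs c rs'"
  by (induction c) auto

lemma succs_Some: "(c', Some (i, s, d)) \<in> succs c rs \<Longrightarrow> i \<in> uses c \<and> s < 3"
  by (induction c arbitrary: c') (auto split: if_splits)

text \<open>A transition acts on all tapes at once; a tape that is not addressed gets back the
  symbol read there and keeps its head.\<close>

fun writes :: "action \<Rightarrow> nat list \<Rightarrow> (nat \<times> dir) list" where
  "writes None rs = map (\<lambda>s. (s, Stay)) rs"
| "writes (Some (i, s, d)) rs = (map (\<lambda>s. (s, Stay)) rs)[i := (s, d)]"

definition machine :: "nat \<Rightarrow> (com \<Rightarrow> nat) \<Rightarrow> com \<Rightarrow> ntm" where
  "machine k f c = \<lparr>num_tapes = k, ntm_states = f ` resid c, alphabet = {0, 1, 2},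
     start_state = f c, accept_state = f Skip,
     transitions = {(f c1, rs, f c2, writes x rs) | c1 c2 rs x. c1 \<in> resid c \<and>
       length rs = k \<and> set rs \<subseteq> {0, 1, 2} \<and> (c2, x) \<in> succs c1 (\<lambda>i. rs ! i)}\<rparr>"

lemma act_tape_Stay: "act_tape (read_tape \<tau>, Stay) \<tau> = \<tau>"
  by (cases \<tau>) auto

lemma map2_writes:
  assumes "\<And>i s d. x = Some (i, s, d) \<Longrightarrow> i < k"
  shows "map2 act_tape (writes x (map read_tape (map \<sigma> [0..<k]))) (map \<sigma> [0..<k])
       = map (update x \<sigma>) [0..<k]"
proof (cases x)
  case None
  then show ?thesis by (auto simp: act_tape_Stay intro!: nth_equalityI)
next
  case (Some a)
  obtain i s d where a: "a = (i, s, d)" by (cases a)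
  show ?thesis unfolding Some a
    by (rule nth_equalityI) (auto simp: act_tape_Stay nth_list_update)
qed

text \<open>Induction on \<open>exec\<close>: as \<open>f\<close> is injective on the residual
  programs, the machine steps from \<open>c1\<close> are exactly the images of \<open>succs\<close>.
  \<open>Skip\<close> has no successor, so \<open>f Skip\<close> halts, and acceptance amounts to a
  nonempty set of final stores. The time bound covers all computations, whether they reach
  \<open>Skip\<close> or get stuck.\<close>

lemma machine_simulates:
  assumes e: "exec c1 \<sigma> t R" and c1: "c1 \<in> resid c" and inj: "inj_on f (resid c)"
    and good: "\<And>i p. fst (\<sigma> i) p < 3" and k: "\<And>i. i \<in> uses c \<Longrightarrow> i < k"
  shows "(\<forall>m y. ((f c1, map \<sigma> [0..<k]), y) \<in> ntm_step (machine k f c) ^^ m \<longrightarrow> m \<le> t) \<and>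
    ((\<exists>y. ((f c1, map \<sigma> [0..<k]), y) \<in> (ntm_step (machine k f c))\<^sup>* \<and> fst y = f Skip)
       \<longleftrightarrow> R \<noteq> {})"
  using e c1 good
proof (induction rule: exec.induct)
  case (Done \<sigma> t)
  have "((f Skip, ts), y) \<notin> ntm_step (machine k f c)" for ts y
    using inj Skip_resid[of c] by (auto simp: ntm_step_def machine_def inj_on_eq_iff)
  then have "((f Skip, ts), y) \<in> ntm_step (machine k f c) ^^ m \<Longrightarrow> m = 0" for ts y m
    by (metis not0_implies_Suc relpow_Suc_D2)
  then show ?case by fastforce
next
  case (Step c1 \<sigma> t R Y)
  let ?S = "ntm_step (machine k f c)"
  let ?cf = "\<lambda>c \<sigma>. (f c, map \<sigma> [0..<k])"
  have reads: "succs c1 (\<lambda>i. map read_tape (map \<sigma> [0..<k]) ! i) = succs c1 (reads \<sigma>)"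
    by (rule succs_cong) (use k uses_resid[OF Step.prems(1)] in \<open>auto simp: reads_def\<close>)
  have lt3: "read_tape \<tau> \<in> {0, 1, 2}" if "\<And>p. fst \<tau> p < 3" for \<tau>
  proof (cases \<tau>)
    case (Pair t h)
    have "t h < 3" using that[of h] Pair by simp
    then show ?thesis using Pair by auto
  qed
  have upd: "map2 act_tape (writes x (map read_tape (map \<sigma> [0..<k]))) (map \<sigma> [0..<k])
       = map (update x \<sigma>) [0..<k]" if "(c2, x) \<in> succs c1 (reads \<sigma>)" for c2 x
    by (rule map2_writes) (use that succs_Some uses_resid[OF Step.prems(1)] k in blast)
  have step: "(?cf c1 \<sigma>, y) \<in> ?S \<longleftrightarrow>
      (\<exists>c2 x. (c2, x) \<in> succs c1 (reads \<sigma>) \<and> y = ?cf c2 (update x \<sigma>))" (is "?l = ?r") for y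
  proof
    assume ?l
    then obtain c1' c2 x where *: "f c1 = f c1'" "c1' \<in> resid c"
      "(c2, x) \<in> succs c1' (\<lambda>i. map read_tape (map \<sigma> [0..<k]) ! i)"
      "y = (f c2, map2 act_tape (writes x (map read_tape (map \<sigma> [0..<k]))) (map \<sigma> [0..<k]))"
      unfolding ntm_step_def machine_def by auto
    have "c1' = c1" using * inj Step.prems(1) by (auto dest: inj_onD)
    then show ?r using * reads upd by auto
  next
    assume ?r
    then obtain c2 x where *: "(c2, x) \<in> succs c1 (reads \<sigma>)" "y = ?cf c2 (update x \<sigma>)" by blast
    have rs: "set (map read_tape (map \<sigma> [0..<k])) \<subseteq> {0, 1, 2}"
      unfolding set_map image_image by (intro image_subsetI lt3 Step.prems(2))
    have "(f c1, map read_tape (map \<sigma> [0..<k]), f c2, writes x (map read_tape (map \<sigma> [0..<k])))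
        \<in> transitions (machine k f c)"
      unfolding machine_def ntm.simps
      by (rule CollectI, rule exI[of _ c1], rule exI[of _ c2],
          rule exI[of _ "map read_tape (map \<sigma> [0..<k])"], rule exI[of _ x])
        (intro conjI refl Step.prems(1) rs *(1)[folded reads]; simp)
    then show ?l unfolding ntm_step_def using *(2) upd[OF *(1)] by auto
  qed
  have IH: "(\<forall>m y. (?cf c2 (update x \<sigma>), y) \<in> ?S ^^ m \<longrightarrow> m \<le> t) \<and>
      ((\<exists>y. (?cf c2 (update x \<sigma>), y) \<in> ?S\<^sup>* \<and> fst y = f Skip) \<longleftrightarrow> R c2 x \<noteq> {})"
    if "(c2, x) \<in> succs c1 (reads \<sigma>)" for c2 x
  proof (rule Step.IH[OF that])
    show "c2 \<in> resid c" using resid_closed[OF Step.prems(1) that] .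
    show "fst (update x \<sigma> i) p < 3" for i p
    proof (cases x)
      case (Some a)
      obtain j s d where "a = (j, s, d)" by (cases a)
      with that Some succs_Some have "s < 3" by blast
      with \<open>a = _\<close> Some Step.prems(2) show ?thesis by (cases "\<sigma> j") (auto, metis fst_conv)
    qed (use Step.prems in auto)
  qed
  have "f c1 \<noteq> f Skip"
    using inj Step.prems(1) Step.hyps(1) Skip_resid[of c] by (auto dest: inj_onD)
  \<comment> \<open>Since \<open>c1\<close> is not \<open>Skip\<close>, an accepting computation has
    a first step, to which the induction hypothesis applies.\<close>
  have acc: "(\<exists>y. (?cf c1 \<sigma>, y) \<in> ?S\<^sup>* \<and> fst y = f Skip) \<longleftrightarrow>
      (\<exists>z y. (?cf c1 \<sigma>, z) \<in> ?S \<and> (z, y) \<in> ?S\<^sup>* \<and> fst y = f Skip)" (is "?l \<longleftrightarrow> ?r")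
  proof
    assume ?l
    then obtain y where y: "(?cf c1 \<sigma>, y) \<in> ?S\<^sup>*" "fst y = f Skip" by blast
    then have "?cf c1 \<sigma> \<noteq> y" using \<open>f c1 \<noteq> f Skip\<close> by auto
    then show ?r using y by (meson converse_rtranclE)
  next
    assume ?r
    then show ?l by (meson converse_rtrancl_into_rtrancl)
  qed
  have "m \<le> Suc t" if "(?cf c1 \<sigma>, y) \<in> ?S ^^ m" for m y
  proof (cases m)
    case (Suc m')
    with that obtain z where z: "(?cf c1 \<sigma>, z) \<in> ?S" "(z, y) \<in> ?S ^^ m'"
      by (meson relpow_Suc_D2)
    from z(1)[unfolded step] obtain c2 x where
      x: "(c2, x) \<in> succs c1 (reads \<sigma>)" "z = ?cf c2 (update x \<sigma>)" by blast
    have "m' \<le> t" using IH[OF x(1)] z(2)[unfolded x(2)] by blast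
    then show ?thesis using Suc by simp
  qed auto
  moreover have "(\<exists>y. (?cf c1 \<sigma>, y) \<in> ?S\<^sup>* \<and> fst y = f Skip) \<longleftrightarrow> Y \<noteq> {}"
  proof -
    have "(\<exists>z y. (?cf c1 \<sigma>, z) \<in> ?S \<and> (z, y) \<in> ?S\<^sup>* \<and> fst y = f Skip) \<longleftrightarrow>
      (\<exists>c2 x. (c2, x) \<in> succs c1 (reads \<sigma>) \<and>
        (\<exists>y. (?cf c2 (update x \<sigma>), y) \<in> ?S\<^sup>* \<and> fst y = f Skip))"
      unfolding step by blast
    also have "\<dots> \<longleftrightarrow> (\<exists>c2 x. (c2, x) \<in> succs c1 (reads \<sigma>) \<and> R c2 x \<noteq> {})"
      using IH by blast
    also have "\<dots> \<longleftrightarrow> Y \<noteq> {}" unfolding Step.hyps(3) by blast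
    finally show ?thesis unfolding acc .
  qed
  ultimately show ?case by blast
qed

text \<open>The tapes from \<open>k\<close> on are not used, and their initial contents are arbitrary.\<close>

lemma NTIME_I:
  assumes k: "uses c \<subseteq> {..<k}" "0 < k"
    and init: "\<And>w i. i < k \<Longrightarrow> \<sigma> w i = (if i = 0 then input_tape w else (\<lambda>_. 0, 0))"
    and good: "\<And>w i p. fst (\<sigma> w i) p < 3"
    and runs: "\<And>w. runs c {\<sigma> w} (T (length w)) (Y w)"
  shows "{w. Y w \<noteq> {}} \<in> NTIME T"
proof -
  obtain f :: "com \<Rightarrow> nat" where inj: "inj_on f (resid c)"
    using finite_imp_inj_to_nat_seg[OF finite_resid[of c]] by blast
  let ?M = "machine k f c"
  have start: "start_config ?M w = (f c, map (\<sigma> w) [0..<k])" for w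
    unfolding start_config_def machine_def using k(2)
    by (auto simp: init nth_Cons' intro!: nth_equalityI)
  have sim: "(\<forall>m y. (start_config ?M w, y) \<in> ntm_step ?M ^^ m \<longrightarrow> m \<le> T (length w)) \<and>
    ((\<exists>y. (start_config ?M w, y) \<in> (ntm_step ?M)\<^sup>* \<and> fst y = f Skip) \<longleftrightarrow> Y w \<noteq> {})" for w
    unfolding start
  proof (rule machine_simulates)
    show "exec c (\<sigma> w) (T (length w)) (Y w)"
      using runs[of w] unfolding runs_def by auto
  qed (use resid_self inj k good in auto)
  have "is_ntm ?M" unfolding is_ntm_def
  proof (intro conjI ballI)
    show "num_tapes ?M \<ge> 1" "{0, 1, 2} \<subseteq> alphabet ?M" "finite (alphabet ?M)"
      using k(2) by (auto simp: machine_def)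
    show "finite (ntm_states ?M)" by (simp add: machine_def finite_resid)
    show "start_state ?M \<in> ntm_states ?M" "accept_state ?M \<in> ntm_states ?M"
      by (auto simp: machine_def resid_self Skip_resid)
  next
    fix \<theta> assume "\<theta> \<in> transitions ?M"
    then obtain c1 c2 rs x where \<theta>: "\<theta> = (f c1, rs, f c2, writes x rs)" and
      c1: "c1 \<in> resid c" "length rs = k" "set rs \<subseteq> {0, 1, 2}" "(c2, x) \<in> succs c1 (\<lambda>i. rs ! i)"
      unfolding machine_def by auto
    have "c1 \<noteq> Skip" using c1 by auto
    then have "f c1 \<noteq> f Skip" using inj c1(1) Skip_resid[of c] by (auto dest: inj_onD)
    moreover have "length (writes x rs) = k \<and> fst ` set (writes x rs) \<subseteq> {0, 1, 2}"
    proof (cases x)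
      case None
      then show ?thesis using c1 by auto
    next
      case (Some a)
      obtain i s d where a: "a = (i, s, d)" by (cases a)
      have "s < 3" using c1(4) Some a succs_Some by blast
      then have "s \<in> {0, 1, 2}" by auto
      then show ?thesis using Some a c1 set_update_subset_insert[of "map (\<lambda>s. (s, Stay)) rs" i "(s,d)"]
        by fastforce
    qed
    ultimately show "case \<theta> of (q, rs, q', ws) \<Rightarrow>
        q \<in> ntm_states ?M - {accept_state ?M} \<and> q' \<in> ntm_states ?M \<and>
        length rs = num_tapes ?M \<and> set rs \<subseteq> alphabet ?M \<and>
        length ws = num_tapes ?M \<and> fst ` set ws \<subseteq> alphabet ?M"
      unfolding \<theta> using c1 resid_closed[OF c1(1,4)] by (auto simp: machine_def)
  qed
  moreover have "ntm_time_bound ?M T" unfolding ntm_time_bound_def using sim by blast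
  moreover have "{w. Y w \<noteq> {}} = {w. ntm_accepts ?M w}"
    unfolding ntm_accepts_def using sim by (simp add: machine_def)
  ultimately show ?thesis unfolding NTIME_def by blast
qed

section \<open>Counters\<close>

text \<open>Tapes 0, 1, 2 hold data; every other tape is a counter, whose value is the position of
  the head relative to a mark.\<close>

definition counter_tape :: "nat \<Rightarrow> tape" where
  "counter_tape v = ((\<lambda>_. 0)(0 := 1), int v)"

type_synonym state = "(nat \<Rightarrow> int \<Rightarrow> nat) \<times> (nat \<Rightarrow> int) \<times> (nat \<Rightarrow> nat)"

fun store_of :: "state \<Rightarrow> store" where
  "store_of (D, h, e) = (\<lambda>i. if i < 3 then (D i, h i) else counter_tape (e (i - 3)))"

abbreviation Incr :: "nat \<Rightarrow> com" where
  "Incr k \<equiv> Act (k + 3) (\<lambda>s. {s}) Move_Right"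

abbreviation Decr :: "nat \<Rightarrow> com" where
  "Decr k \<equiv> Act (k + 3) (\<lambda>s. {s}) Move_Left"

text \<open>The symbol 0 means that the head is off the mark, i.e. that the counter is positive. The
  counter is lowered before the body, which sees the values from one below the start down to
  0.\<close>

abbreviation For :: "nat \<Rightarrow> com \<Rightarrow> com" where
  "For k c \<equiv> Loop (k + 3) {0} (Decr k ;; c)"

abbreviation Fail :: com where
  "Fail \<equiv> Act 0 (\<lambda>_. {}) Stay"

lemma reads_counter: "reads (store_of (D, h, e)) (k + 3) = (if e k = 0 then 1 else 0)"
  by (simp add: reads_def counter_tape_def)

lemma reads_data: "i < 3 \<Longrightarrow> reads (store_of (D, h, e)) i = D i (h i)"
  by (simp add: reads_def)

lemma runs_Incr: "runs (Incr k) {store_of (D, h, e)} (Suc 0) {store_of (D, h, e(k := Suc (e k)))}"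
proof -
  have "(store_of (D, h, e))(k + 3 := act_tape (if e k = 0 then 1 else 0, Move_Right)
      (store_of (D, h, e) (k + 3))) = store_of (D, h, e(k := Suc (e k)))"
    by (rule ext) (auto simp: counter_tape_def fun_eq_iff)
  then show ?thesis
    using runs_Act[of "k + 3" "\<lambda>s. {s}" Move_Right "store_of (D, h, e)"]
    by (simp add: reads_counter Collect_conv_if del: store_of.simps split: if_splits)
qed

lemma runs_Decr:
  assumes "e k = Suc v"
  shows "runs (Decr k) {store_of (D, h, e)} (Suc 0) {store_of (D, h, e(k := v))}"
proof -
  have "(store_of (D, h, e))(k + 3 := act_tape (0, Move_Left)
      (store_of (D, h, e) (k + 3))) = store_of (D, h, e(k := v))"
    by (rule ext) (auto simp: counter_tape_def fun_eq_iff assms)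
  then show ?thesis
    using runs_Act[of "k + 3" "\<lambda>s. {s}" Move_Left "store_of (D, h, e)"] assms
    by (simp add: reads_counter Collect_conv_if del: store_of.simps split: if_splits)
qed

lemma runs_data:
  assumes "i < 3"
  shows "runs (Act i f d) {store_of (D, h, e)} (Suc 0)
    ((\<lambda>s. store_of (D(i := (D i)(h i := s)), h(i := move d (h i)), e)) ` {s \<in> f (D i (h i)). s < 3})"
proof -
  have "(store_of (D, h, e))(i := act_tape (s, d) (store_of (D, h, e) i))
      = store_of (D(i := (D i)(h i := s)), h(i := move d (h i)), e)" for s
    by (rule ext) (use assms in auto)
  then show ?thesis
    using runs_Act[of i f d "store_of (D, h, e)"] assms
    by (simp add: reads_data del: store_of.simps)
qed

declare store_of.simps [simp del]

lemma runs_Fail: "runs Fail X (Suc 0) {}"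
proof -
  have "runs Fail (\<Union>\<sigma>\<in>X. {\<sigma>}) (Suc 0) (\<Union>\<sigma>\<in>X. {})"
    by (rule runs_UN) (use runs_Act[of 0 "\<lambda>_. {}" Stay] in simp)
  then show ?thesis by simp
qed

definition set_counter :: "nat \<Rightarrow> nat \<Rightarrow> state \<Rightarrow> state" where
  "set_counter k v = (\<lambda>(D, h, e). (D, h, e(k := v)))"

definition counter :: "nat \<Rightarrow> state \<Rightarrow> nat" where
  "counter k = (\<lambda>(D, h, e). e k)"

lemma reads_counter_store: "reads (store_of s) (k + 3) = (if counter k s = 0 then 1 else 0)"
proof (cases s)
  case (fields D h e)
  show ?thesis unfolding fields reads_counter by (simp add: counter_def)
qed

lemma runs_For:
  assumes k: "\<And>v s. v \<le> n \<Longrightarrow> s \<in> A v \<Longrightarrow> counter k s = v"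
    and body: "\<And>v. v < n \<Longrightarrow> runs c (store_of ` set_counter k v ` A (Suc v)) t (store_of ` A v)"
  shows "runs (For k c) (store_of ` A n) (n * (t + 4) + 1) (store_of ` A 0)"
  using assms
proof (induction n)
  case 0
  have "runs (For k c) (store_of ` A 0) (Suc 0) (store_of ` A 0)"
    by (rule runs_Loop_exit) (use 0 in \<open>auto simp: reads_counter_store\<close>)
  then show ?case by simp
next
  case (Suc n)
  have "runs (Decr k) (\<Union>s\<in>A (Suc n). {store_of s}) (Suc 0)
      (\<Union>s\<in>A (Suc n). {store_of (set_counter k n s)})"
  proof (rule runs_UN)
    fix s assume "s \<in> A (Suc n)"
    then have "counter k s = Suc n" using Suc.prems by blast
    then show "runs (Decr k) {store_of s} (Suc 0) {store_of (set_counter k n s)}"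
      unfolding counter_def set_counter_def by (cases s) (auto intro: runs_Decr)
  qed
  then have dec: "runs (Decr k) (store_of ` A (Suc n)) (Suc 0) (store_of ` set_counter k n ` A (Suc n))"
    by (simp add: UNION_singleton_eq_range image_image)
  have IH: "runs (For k c) (store_of ` A n) (n * (t + 4) + 1) (store_of ` A 0)"
    by (rule Suc.IH) (use Suc.prems in auto)
  have "runs (For k c) (store_of ` A (Suc n)) (Suc (Suc (Suc (Suc 0 + t) + (n * (t + 4) + 1))))
      (store_of ` A 0)"
  proof (rule runs_Loop_enter[OF _ runs_Seq[OF dec Suc.prems(2)] IH])
    show "reads \<sigma> (k + 3) \<in> {0}" if "\<sigma> \<in> store_of ` A (Suc n)" for \<sigma>
      using that Suc.prems(1)[of "Suc n"] by (auto simp: reads_counter_store)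
  qed auto
  then show ?case by (rule runs_mono) simp
qed

section \<open>Programs with polynomial running time\<close>

text \<open>A program is run on a family of sets of stores, and \<open>M a N\<close> says that the size of
  the index \<open>a\<close> is at most \<open>N\<close>.\<close>

definition prog :: "com \<Rightarrow> ('a \<Rightarrow> nat \<Rightarrow> bool) \<Rightarrow> ('a \<Rightarrow> store set) \<Rightarrow> ('a \<Rightarrow> store set) \<Rightarrow> bool" where
  "prog c M X Y \<longleftrightarrow> (\<exists>n. \<forall>a N. 2 \<le> N \<longrightarrow> M a N \<longrightarrow> runs c (X a) (N ^ n) (Y a))"

lemma pow_add_le:
  fixes N :: nat
  assumes "2 \<le> N" shows "N ^ a + N ^ b \<le> N ^ (a + b + 1)"
proof -
  have "N ^ a + N ^ b \<le> N ^ (a + b) + N ^ (a + b)"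
    by (intro add_mono power_increasing) (use assms in auto)
  also have "\<dots> \<le> N * N ^ (a + b)" using mult_le_mono1[OF assms, of "N ^ (a + b)"] by linarith
  finally show ?thesis by simp
qed

lemma pow_Suc_le:
  fixes N :: nat
  assumes "2 \<le> N" shows "Suc (N ^ a) \<le> N ^ (a + 1)"
  using pow_add_le[OF assms, of a 0] by simp

lemma pow_mono: "2 \<le> (N :: nat) \<Longrightarrow> a \<le> b \<Longrightarrow> N ^ a \<le> N ^ b"
  by (rule power_increasing) auto

lemma two_le_pow: "2 \<le> (N :: nat) \<Longrightarrow> 2 \<le> N ^ Suc b"
  using pow_mono[of N 1 "Suc b"] by (simp del: power_Suc)

lemma le_pow_add:
  fixes N :: nat
  assumes "2 \<le> N" "x \<le> N ^ a" "y \<le> N ^ b" shows "x + y \<le> N ^ (a + b + 1)"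
  using pow_add_le[OF assms(1), of a b] assms by linarith

lemma le_pow_mult:
  fixes N :: nat
  shows "x \<le> N ^ a \<Longrightarrow> y \<le> N ^ b \<Longrightarrow> x * y \<le> N ^ (a + b)"
  by (simp add: power_add mult_le_mono)

lemma progI_const:
  assumes "\<And>a N. 2 \<le> N \<Longrightarrow> M a N \<Longrightarrow> runs c (X a) t (Y a)"
  shows "prog c M X Y"
  unfolding prog_def
proof (intro exI[of _ t] allI impI)
  fix a N assume "2 \<le> (N :: nat)" "M a N"
  moreover have "t \<le> N ^ t" using \<open>2 \<le> N\<close> power_gt_expt[of N t] by simp
  ultimately show "runs c (X a) (N ^ t) (Y a)" using assms runs_mono by blast
qed

lemma prog_conseq:
  assumes "prog c M X Y" "\<And>a N. 2 \<le> N \<Longrightarrow> M' a N \<Longrightarrow> M a N \<and> X a = X' a \<and> Y a = Y' a"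
  shows "prog c M' X' Y'"
  using assms unfolding prog_def by metis

lemma prog_Skip: "prog Skip M X X"
  by (rule progI_const, rule runs_Skip)

lemma prog_Fail: "prog Fail M X (\<lambda>_. {})"
  by (rule progI_const, rule runs_Fail)

lemma prog_Seq:
  assumes "prog a M X Y" "prog b M Y Z" shows "prog (a ;; b) M X Z"
proof -
  obtain n where n: "\<And>a' N. 2 \<le> N \<Longrightarrow> M a' N \<Longrightarrow> runs a (X a') (N ^ n) (Y a')"
    using assms(1) unfolding prog_def by blast
  obtain m where m: "\<And>a' N. 2 \<le> N \<Longrightarrow> M a' N \<Longrightarrow> runs b (Y a') (N ^ m) (Z a')"
    using assms(2) unfolding prog_def by blast
  note r = runs_Seq[OF n m]
  show ?thesis unfolding prog_def
  proof (intro exI allI impI)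
    fix a' N assume *: "2 \<le> (N :: nat)" "M a' N"
    show "runs (a ;; b) (X a') (N ^ (n + m + 1 + 1)) (Z a')"
      by (rule runs_mono[OF r[OF * *]])
        (use pow_add_le[OF *(1), of n m] pow_Suc_le[OF *(1), of "n + m + 1"] in linarith)
  qed
qed

lemma prog_Choice:
  assumes "prog a M X Y" "prog b M X Z" shows "prog (Choice a b) M X (\<lambda>i. Y i \<union> Z i)"
proof -
  obtain n where n: "\<And>a' N. 2 \<le> N \<Longrightarrow> M a' N \<Longrightarrow> runs a (X a') (N ^ n) (Y a')"
    using assms(1) unfolding prog_def by blast
  obtain m where m: "\<And>a' N. 2 \<le> N \<Longrightarrow> M a' N \<Longrightarrow> runs b (X a') (N ^ m) (Z a')"
    using assms(2) unfolding prog_def by blast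
  note r = runs_Choice[OF n m]
  show ?thesis unfolding prog_def
  proof (intro exI allI impI)
    fix a' N assume *: "2 \<le> (N :: nat)" "M a' N"
    show "runs (Choice a b) (X a') (N ^ (n + m + 1 + 1)) (Y a' \<union> Z a')"
      by (rule runs_mono[OF r[OF * *]])
        (use pow_add_le[OF *(1), of n m] pow_Suc_le[OF *(1), of "n + m + 1"] in linarith)
  qed
qed

lemma prog_Cond:
  assumes "prog a M (\<lambda>i. {\<sigma> \<in> X i. reads \<sigma> k \<in> A}) Y" "prog b M (\<lambda>i. {\<sigma> \<in> X i. reads \<sigma> k \<notin> A}) Z"
  shows "prog (Cond k A a b) M X (\<lambda>i. Y i \<union> Z i)"
proof -
  obtain n where n: "\<And>a' N. 2 \<le> N \<Longrightarrow> M a' N \<Longrightarrow> runs a {\<sigma> \<in> X a'. reads \<sigma> k \<in> A} (N ^ n) (Y a')"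
    using assms(1) unfolding prog_def by blast
  obtain m where m: "\<And>a' N. 2 \<le> N \<Longrightarrow> M a' N \<Longrightarrow> runs b {\<sigma> \<in> X a'. reads \<sigma> k \<notin> A} (N ^ m) (Z a')"
    using assms(2) unfolding prog_def by blast
  note r = runs_Cond[OF n m]
  show ?thesis unfolding prog_def
  proof (intro exI allI impI)
    fix a' N assume *: "2 \<le> (N :: nat)" "M a' N"
    show "runs (Cond k A a b) (X a') (N ^ (n + m + 1 + 1)) (Y a' \<union> Z a')"
      by (rule runs_mono[OF r[OF * *]])
        (use pow_add_le[OF *(1), of n m] pow_Suc_le[OF *(1), of "n + m + 1"] in linarith)
  qed
qed

text \<open>The size of the new index may be a power of the old one, because a power of
  \<open>N ^ Suc b\<close> is again a power of \<open>N\<close>. The exponent is a successor so that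
  the new bound is at least 2 as well.\<close>

lemma prog_UN:
  assumes p: "prog c M' X Y"
    and M: "\<And>a N j. 2 \<le> N \<Longrightarrow> M a N \<Longrightarrow> j \<in> J a \<Longrightarrow> M' (f a j) (N ^ Suc b)"
  shows "prog c M (\<lambda>a. \<Union>j\<in>J a. X (f a j)) (\<lambda>a. \<Union>j\<in>J a. Y (f a j))"
proof -
  obtain n where n: "\<And>a N. 2 \<le> N \<Longrightarrow> M' a N \<Longrightarrow> runs c (X a) (N ^ n) (Y a)"
    using p unfolding prog_def by blast
  show ?thesis unfolding prog_def
  proof (intro exI allI impI runs_UN)
    fix a N j assume *: "2 \<le> (N :: nat)" "M a N" "j \<in> J a"
    show "runs c (X (f a j)) (N ^ (Suc b * n)) (Y (f a j))"
      unfolding power_mult by (rule n) (use * M two_le_pow in auto)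
  qed
qed

lemma prog_For:
  assumes k: "\<And>a N v s. M a N \<Longrightarrow> v \<le> n a \<Longrightarrow> s \<in> A a v \<Longrightarrow> counter k s = v"
    and n: "\<And>a N. 2 \<le> N \<Longrightarrow> M a N \<Longrightarrow> n a \<le> N ^ b"
    and body: "prog c (\<lambda>(a, v) N. M a N \<and> v < n a)
      (\<lambda>(a, v). store_of ` set_counter k v ` A a (Suc v)) (\<lambda>(a, v). store_of ` A a v)"
  shows "prog (For k c) M (\<lambda>a. store_of ` A a (n a)) (\<lambda>a. store_of ` A a 0)"
proof -
  obtain m where m: "\<And>a v N. 2 \<le> N \<Longrightarrow> M a N \<Longrightarrow> v < n a \<Longrightarrow>
      runs c (store_of ` set_counter k v ` A a (Suc v)) (N ^ m) (store_of ` A a v)"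
    using body unfolding prog_def by force
  show ?thesis unfolding prog_def
  proof (intro exI allI impI)
    fix a N assume *: "2 \<le> (N :: nat)" "M a N"
    have "4 \<le> N ^ 2" using power_mono[OF *(1), of 2] by simp
    then have "n a * (N ^ m + 4) \<le> N ^ (b + (m + 2 + 1))"
      by (intro le_pow_mult n[OF *] le_pow_add[OF *(1)]) auto
    then have "n a * (N ^ m + 4) + 1 \<le> N ^ (b + (m + 2 + 1) + 1)"
      using pow_Suc_le[OF *(1), of "b + (m + 2 + 1)"] by simp
    then show "runs (For k c) (store_of ` A a (n a)) (N ^ (b + (m + 2 + 1) + 1)) (store_of ` A a 0)"
      by (rule runs_mono[rotated]) (rule runs_For; use k m * in blast)
  qed
qed

section \<open>Instances\<close>

text \<open>The contents of the three data tapes together with the range of the bounded quantifiers.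
  \<open>now\<close> is the current set on a path and \<open>later\<close> the guess for the next
  one.\<close>

record inst =
  word :: "bool list"
  bound :: nat
  now :: "nat set"
  later :: "nat set"

text \<open>Absence is the blank, so the empty set is an empty tape, and tapes 1 and 2 need no
  preparation.\<close>

definition set_tape :: "nat set \<Rightarrow> int \<Rightarrow> nat" where
  "set_tape S i = (if 0 \<le> i \<and> nat i \<in> S then 2 else 0)"

definition data :: "inst \<Rightarrow> nat \<Rightarrow> int \<Rightarrow> nat" where
  "data I i = (if i = 0 then fst (input_tape (word I)) else if i = 1 then set_tape (now I)
     else if i = 2 then set_tape (later I) else (\<lambda>_. 0))"

definition inst_state :: "inst \<Rightarrow> (nat \<Rightarrow> nat) \<Rightarrow> state" where
  "inst_state I e = (data I, \<lambda>_. 0, e)"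

definition inst_store :: "inst \<Rightarrow> (nat \<Rightarrow> nat) \<Rightarrow> store" where
  "inst_store I e = store_of (inst_state I e)"

lemma data_less: "data I i p < 3"
  by (simp add: data_def set_tape_def input_tape_def)

lemma reads_inst_counter: "reads (inst_store I e) (k + 3) = (if e k = 0 then 1 else 0)"
  unfolding inst_store_def inst_state_def by (rule reads_counter)

text \<open>The data tapes are the same before and after, with their heads back at 0; only the
  counters change.\<close>

definition transforms ::
  "com \<Rightarrow> ('a \<Rightarrow> nat \<Rightarrow> bool) \<Rightarrow> ('a \<Rightarrow> inst) \<Rightarrow> ('a \<Rightarrow> (nat \<Rightarrow> nat) set) \<Rightarrow> ('a \<Rightarrow> (nat \<Rightarrow> nat) set) \<Rightarrow> bool"
  where
  "transforms c M I E F \<longleftrightarrow> prog c M (\<lambda>a. inst_store (I a) ` E a) (\<lambda>a. inst_store (I a) ` F a)"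

lemma transforms_conseq:
  assumes "transforms c M I E F"
    and "\<And>a N. 2 \<le> N \<Longrightarrow> M' a N \<Longrightarrow> M a N" "\<And>a N. 2 \<le> N \<Longrightarrow> M' a N \<Longrightarrow> E a = E' a"
    and "\<And>a N. 2 \<le> N \<Longrightarrow> M' a N \<Longrightarrow> F a = F' a"
  shows "transforms c M' I E' F'"
  using assms(1) unfolding transforms_def by (rule prog_conseq) (use assms(2-) in auto)

lemma transforms_Skip: "transforms Skip M I E E"
  unfolding transforms_def by (rule prog_Skip)

lemma transforms_Fail: "transforms Fail M I E (\<lambda>_. {})"
  unfolding transforms_def image_empty by (rule prog_Fail)

lemma transforms_Seq: "transforms a M I E F \<Longrightarrow> transforms b M I F G \<Longrightarrow> transforms (a ;; b) M I E G"
  unfolding transforms_def by (rule prog_Seq)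

lemma transforms_Choice:
  "transforms a M I E F \<Longrightarrow> transforms b M I E G \<Longrightarrow> transforms (Choice a b) M I E (\<lambda>x. F x \<union> G x)"
  unfolding transforms_def image_Un by (rule prog_Choice)

lemma transforms_Incr: "transforms (Incr k) M I E (\<lambda>a. (\<lambda>e. e(k := Suc (e k))) ` E a)"
  unfolding transforms_def
proof (rule progI_const)
  fix a
  have "runs (Incr k) (\<Union>e\<in>E a. {inst_store (I a) e}) (Suc 0)
      (\<Union>e\<in>E a. {inst_store (I a) (e(k := Suc (e k)))})"
    by (rule runs_UN) (unfold inst_store_def inst_state_def, rule runs_Incr)
  then show "runs (Incr k) (inst_store (I a) ` E a) (Suc 0)
      (inst_store (I a) ` (\<lambda>e. e(k := Suc (e k))) ` E a)"
    by (simp add: UNION_singleton_eq_range image_image)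
qed

lemma transforms_Decr:
  assumes "\<And>a N e. M a N \<Longrightarrow> e \<in> E a \<Longrightarrow> e k > 0"
  shows "transforms (Decr k) M I E (\<lambda>a. (\<lambda>e. e(k := e k - 1)) ` E a)"
  unfolding transforms_def
proof (rule progI_const)
  fix a N assume M: "M a N"
  have "runs (Decr k) (\<Union>e\<in>E a. {inst_store (I a) e}) (Suc 0)
      (\<Union>e\<in>E a. {inst_store (I a) (e(k := e k - 1))})"
    by (rule runs_UN) (unfold inst_store_def inst_state_def, rule runs_Decr, use assms[OF M] in auto)
  then show "runs (Decr k) (inst_store (I a) ` E a) (Suc 0)
      (inst_store (I a) ` (\<lambda>e. e(k := e k - 1)) ` E a)"
    by (simp add: UNION_singleton_eq_range image_image)
qed

lemma transforms_Cond:
  assumes "transforms c M I (\<lambda>a. {e \<in> E a. e k \<noteq> 0}) F" "transforms c' M I (\<lambda>a. {e \<in> E a. e k = 0}) G"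
  shows "transforms (Cond (k + 3) {0} c c') M I E (\<lambda>a. F a \<union> G a)"
proof -
  have 1: "{\<sigma> \<in> inst_store (I a) ` E a. reads \<sigma> (k + 3) \<in> {0}}
      = inst_store (I a) ` {e \<in> E a. e k \<noteq> 0}" for a
    by (auto simp: reads_inst_counter split: if_splits)
  have 2: "{\<sigma> \<in> inst_store (I a) ` E a. reads \<sigma> (k + 3) \<notin> {0}}
      = inst_store (I a) ` {e \<in> E a. e k = 0}" for a
    by (auto simp: reads_inst_counter split: if_splits)
  show ?thesis unfolding transforms_def image_Un
    by (rule prog_Cond[OF assms(1)[unfolded transforms_def, folded 1]
          assms(2)[unfolded transforms_def, folded 2]])
qed

lemma transforms_For:
  assumes k: "\<And>a N v e. M a N \<Longrightarrow> v \<le> n a \<Longrightarrow> e \<in> E a v \<Longrightarrow> e k = v"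
    and n: "\<And>a N. 2 \<le> N \<Longrightarrow> M a N \<Longrightarrow> n a \<le> N ^ b"
    and body: "transforms c (\<lambda>x N. M (fst x) N \<and> snd x < n (fst x)) (\<lambda>x. I (fst x))
      (\<lambda>x. (\<lambda>e. e(k := snd x)) ` E (fst x) (Suc (snd x))) (\<lambda>x. E (fst x) (snd x))"
    and E: "\<And>a N. 2 \<le> N \<Longrightarrow> M a N \<Longrightarrow> E a (n a) = E0 a" "\<And>a N. 2 \<le> N \<Longrightarrow> M a N \<Longrightarrow> E a 0 = E1 a"
  shows "transforms (For k c) M I E0 E1"
proof -
  have "prog (For k c) M (\<lambda>a. store_of ` inst_state (I a) ` E a (n a))
      (\<lambda>a. store_of ` inst_state (I a) ` E a 0)"
  proof (rule prog_For[where n = n, OF _ n])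
    show "prog c (\<lambda>(a, v) N. M a N \<and> v < n a)
      (\<lambda>(a, v). store_of ` set_counter k v ` inst_state (I a) ` E a (Suc v))
      (\<lambda>(a, v). store_of ` inst_state (I a) ` E a v)"
      by (rule prog_conseq[OF body[unfolded transforms_def]])
        (auto simp: image_image inst_store_def set_counter_def inst_state_def split: prod.splits)
  qed (use k in \<open>auto simp: inst_state_def counter_def\<close>)
  then have "transforms (For k c) M I (\<lambda>a. E a (n a)) (\<lambda>a. E a 0)"
    by (simp add: transforms_def image_image inst_store_def)
  then show ?thesis by (rule transforms_conseq) (use E in auto)
qed

text \<open>The program is run at every store separately.\<close>

lemma transforms_pointwise:
  assumes "transforms c M' fst (\<lambda>a. {snd a}) G"
    and "\<And>a N e. 2 \<le> N \<Longrightarrow> M a N \<Longrightarrow> e \<in> E a \<Longrightarrow> M' (I a, e) (N ^ Suc b)"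
    and "\<And>a N. 2 \<le> N \<Longrightarrow> M a N \<Longrightarrow> (\<Union>e\<in>E a. G (I a, e)) = F a"
  shows "transforms c M I E F"
proof -
  have "prog c M (\<lambda>a. \<Union>e\<in>E a. inst_store (fst (I a, e)) ` {snd (I a, e)})
     (\<lambda>a. \<Union>e\<in>E a. inst_store (fst (I a, e)) ` G (I a, e))"
    by (rule prog_UN[OF assms(1)[unfolded transforms_def] assms(2)])
  then have "transforms c M I E (\<lambda>a. \<Union>e\<in>E a. G (I a, e))"
    by (simp add: transforms_def UNION_singleton_eq_range image_UN)
  then show ?thesis by (rule transforms_conseq) (use assms(3) in auto)
qed

lemma transforms_clear:
  assumes "\<And>a N e. 2 \<le> N \<Longrightarrow> M a N \<Longrightarrow> e \<in> E a \<Longrightarrow> e k \<le> N ^ b"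
    and F: "\<And>a N. 2 \<le> N \<Longrightarrow> M a N \<Longrightarrow> (\<lambda>e. e(k := 0)) ` E a = F a"
  shows "transforms (For k Skip) M I E F"
proof -
  have 1: "transforms (For k Skip) (\<lambda>a N. snd a k \<le> N) fst (\<lambda>a. {snd a}) (\<lambda>a. {(snd a)(k := 0)})"
  proof (rule transforms_For[where n = "\<lambda>a. snd a k" and E = "\<lambda>a v. {(snd a)(k := v)}" and b = 1])
    show "transforms Skip (\<lambda>x N. snd (fst x) k \<le> N \<and> snd x < snd (fst x) k) (\<lambda>x. fst (fst x))
        (\<lambda>x. (\<lambda>e. e(k := snd x)) ` {(snd (fst x))(k := Suc (snd x))})
        (\<lambda>x. {(snd (fst x))(k := snd x)})"
      by (rule transforms_conseq[OF transforms_Skip[where M = "\<lambda>_ _. True"]]) auto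
  qed auto
  show ?thesis
  proof (rule transforms_pointwise[OF 1, where b = b])
    fix a N e assume "2 \<le> N" "M a N" "e \<in> E a"
    then have "e k \<le> N ^ b" "N ^ b \<le> N ^ Suc b" using assms pow_mono by auto
    then show "snd (I a, e) k \<le> N ^ Suc b" by (simp del: power_Suc)
  next
    show "(\<Union>e\<in>E a. {(snd (I a, e))(k := 0)}) = F a" if "2 \<le> N" "M a N" for a N
      unfolding F[OF that, symmetric] by auto
  qed
qed

section \<open>Computable terms and checkable predicates\<close>

text \<open>Terms and predicates depend on an instance and on the values \<open>e\<close> of the counters.
  Counter 0 holds the length of the input and counter 1 the bound of the quantifiers;
  the counters from some index on serve as scratch space and are 0 when not in use.\<close>

type_synonym env = "nat \<Rightarrow> nat"

definition below :: "nat \<Rightarrow> (inst \<Rightarrow> env \<Rightarrow> 'b) \<Rightarrow> bool" where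
  "below d f \<longleftrightarrow> (\<forall>I e e'. (\<forall>k<d. e k = e' k) \<longrightarrow> f I e = f I e')"

definition bnd :: "inst \<Rightarrow> nat \<Rightarrow> env \<Rightarrow> nat \<Rightarrow> bool" where
  "bnd I d e N \<longleftrightarrow> e 0 = length (word I) \<and> e 1 = bound I \<and> (\<forall>k<d. e k \<le> N)"

definition adm :: "nat \<Rightarrow> inst \<times> env \<Rightarrow> nat \<Rightarrow> bool" where
  "adm r a N \<longleftrightarrow> bnd (fst a) r (snd a) N \<and> (\<forall>k\<ge>r. snd a k = 0)"

text \<open>Adding to \<open>r\<close> instead of overwriting it makes a sum two adders in sequence
  and a product a loop. All counters above \<open>r\<close> are 0 at the start and again at the
  end.\<close>

definition adder :: "nat \<Rightarrow> (inst \<Rightarrow> env \<Rightarrow> nat) \<Rightarrow> com \<Rightarrow> bool" where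
  "adder r f c \<longleftrightarrow> transforms c (adm (Suc r)) fst (\<lambda>a. {snd a})
     (\<lambda>a. {(snd a)(r := snd a r + f (fst a) (snd a))})"

text \<open>The value is polynomial in the counters below \<open>d\<close>, which keeps composed
  programs within a power of \<open>N\<close>. An adder is demanded for every \<open>r\<close> from
  \<open>d\<close> on, because enclosing constructs occupy some of the scratch counters.\<close>

definition computes :: "nat \<Rightarrow> (inst \<Rightarrow> env \<Rightarrow> nat) \<Rightarrow> bool" where
  "computes d f \<longleftrightarrow> 2 \<le> d \<and> below d f \<and>
     (\<exists>b. \<forall>I e N. 2 \<le> N \<longrightarrow> bnd I d e N \<longrightarrow> f I e \<le> N ^ b) \<and> (\<forall>r\<ge>d. \<exists>c. adder r f c)"

text \<open>A true predicate has a successful check, a false one has none.\<close>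

definition checker :: "nat \<Rightarrow> (inst \<Rightarrow> env \<Rightarrow> bool) \<Rightarrow> com \<Rightarrow> bool" where
  "checker r \<phi> c \<longleftrightarrow> transforms c (adm r) fst (\<lambda>a. {snd a}) (\<lambda>a. {e. e = snd a \<and> \<phi> (fst a) e})"

definition checks :: "nat \<Rightarrow> (inst \<Rightarrow> env \<Rightarrow> bool) \<Rightarrow> bool" where
  "checks d \<phi> \<longleftrightarrow> 2 \<le> d \<and> below d \<phi> \<and> (\<forall>r\<ge>d. \<exists>c. checker r \<phi> c)"

section \<open>Computable terms: variables, constants, sums and products\<close>

lemma belowD: "below d f \<Longrightarrow> (\<And>k. k < d \<Longrightarrow> e k = e' k) \<Longrightarrow> f I e = f I e'"
  unfolding below_def by blast

lemma below_upd: "below d f \<Longrightarrow> d \<le> r \<Longrightarrow> f I (e(r := v)) = f I e"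
  by (rule belowD) auto

lemma bnd_mono: "bnd I d e N \<Longrightarrow> d' \<le> d \<Longrightarrow> N \<le> N' \<Longrightarrow> bnd I d' e N'"
  unfolding bnd_def by (meson order_trans order_less_le_trans)

lemma le_pow_Suc: "2 \<le> (N :: nat) \<Longrightarrow> x \<le> N \<Longrightarrow> x \<le> N ^ Suc b"
  using pow_mono[of N 1 "Suc b"] by (simp del: power_Suc)

lemma transforms_adder:
  assumes c: "adder r f c" and f: "below d f" "d \<le> r"
    and M: "\<And>a N e. 2 \<le> N \<Longrightarrow> M a N \<Longrightarrow> e \<in> E a \<Longrightarrow> adm (Suc r) (I a, e) (N ^ Suc b)"
    and F: "\<And>a N. 2 \<le> N \<Longrightarrow> M a N \<Longrightarrow> (\<lambda>e. e(r := e r + f (I a) e)) ` E a = F a"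
  shows "transforms c M I E F"
proof (rule transforms_pointwise[OF c[unfolded adder_def] M])
  show "(\<Union>e\<in>E a. {(snd (I a, e))(r := snd (I a, e) r + f (fst (I a, e)) (snd (I a, e)))}) = F a"
    if "2 \<le> N" "M a N" for a N
    unfolding F[OF that, symmetric] by auto
qed

lemma transforms_checker:
  assumes c: "checker r \<phi> c"
    and M: "\<And>a N e. 2 \<le> N \<Longrightarrow> M a N \<Longrightarrow> e \<in> E a \<Longrightarrow> adm r (I a, e) (N ^ Suc b)"
    and F: "\<And>a N. 2 \<le> N \<Longrightarrow> M a N \<Longrightarrow> {e \<in> E a. \<phi> (I a) e} = F a"
  shows "transforms c M I E F"
proof (rule transforms_pointwise[OF c[unfolded checker_def] M])
  show "(\<Union>e\<in>E a. {e'. e' = snd (I a, e) \<and> \<phi> (fst (I a, e)) e'}) = F a"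
    if "2 \<le> N" "M a N" for a N
    unfolding F[OF that, symmetric] by auto
qed

lemma transforms_Incr':
  assumes "\<And>a N. 2 \<le> N \<Longrightarrow> M a N \<Longrightarrow> (\<lambda>e. e(k := Suc (e k))) ` E a = F a"
  shows "transforms (Incr k) M I E F"
  by (rule transforms_conseq[OF transforms_Incr[where M = M]]) (use assms in auto)

text \<open>Reading a counter by a loop empties it. Its content is therefore moved to
  \<open>r\<close> and to the scratch counter \<open>Suc r\<close> together, and then restored from
  \<open>Suc r\<close>.\<close>

lemma computes_var:
  assumes k: "k < d" "2 \<le> d"
  shows "computes d (\<lambda>I e. e k)"
  unfolding computes_def
proof (intro conjI allI impI)
  show "below d (\<lambda>I e. e k)" unfolding below_def using k by auto
  show "\<exists>b. \<forall>I e N. 2 \<le> N \<longrightarrow> bnd I d e N \<longrightarrow> e k \<le> N ^ b"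
    by (rule exI[of _ 1]) (use k in \<open>auto simp: bnd_def\<close>)
  fix r assume r: "d \<le> r"
  let ?E1 = "\<lambda>a v. {(snd a)(k := v, r := snd a r + (snd a k - v), Suc r := snd a k - v)}"
  let ?E2 = "\<lambda>a v. {(snd a)(k := snd a k - v, r := snd a r + snd a k, Suc r := v)}"
  have "transforms (For k (Incr r ;; Incr (Suc r))) (adm (Suc r)) fst (\<lambda>a. {snd a}) (\<lambda>a. ?E1 a 0)"
  proof (rule transforms_For[where b = 1 and E = ?E1 and n = "\<lambda>a. snd a k"])
    show "transforms (Incr r ;; Incr (Suc r)) (\<lambda>x N. adm (Suc r) (fst x) N \<and> snd x < snd (fst x) k)
     (\<lambda>x. fst (fst x)) (\<lambda>x. (\<lambda>e. e(k := snd x)) ` ?E1 (fst x) (Suc (snd x)))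
     (\<lambda>x. ?E1 (fst x) (snd x))"
      by (rule transforms_Seq[OF transforms_Incr transforms_Incr'])
        (use r k in \<open>auto simp: fun_eq_iff\<close>)
  qed (use r k in \<open>auto simp: adm_def bnd_def fun_eq_iff\<close>)
  moreover have "transforms (For (Suc r) (Incr k)) (adm (Suc r)) fst (\<lambda>a. ?E1 a 0)
     (\<lambda>a. {(snd a)(r := snd a r + snd a k)})"
  proof (rule transforms_For[where b = 1 and E = ?E2 and n = "\<lambda>a. snd a k"])
    show "transforms (Incr k) (\<lambda>x N. adm (Suc r) (fst x) N \<and> snd x < snd (fst x) k)
     (\<lambda>x. fst (fst x)) (\<lambda>x. (\<lambda>e. e(Suc r := snd x)) ` ?E2 (fst x) (Suc (snd x)))
     (\<lambda>x. ?E2 (fst x) (snd x))"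
      by (rule transforms_Incr') (use r k in \<open>auto simp: fun_eq_iff\<close>)
  qed (use r k in \<open>auto simp: adm_def bnd_def fun_eq_iff\<close>)
  ultimately show "\<exists>c. adder r (\<lambda>I e. e k) c"
    unfolding adder_def by (blast intro: transforms_Seq)
qed (use k in auto)

text \<open>Equality is asked for only where counters 0 and 1 hold the input length and the bound,
  so these two values are obtained by reading a counter.\<close>

lemma computes_cong:
  assumes f: "computes d f" and g: "below d g"
    and eq: "\<And>I e N. bnd I d e N \<Longrightarrow> f I e = g I e"
  shows "computes d g"
  unfolding computes_def
proof (intro conjI allI impI)
  show "2 \<le> d" "below d g" using f g by (auto simp: computes_def)
  show "\<exists>b. \<forall>I e N. 2 \<le> N \<longrightarrow> bnd I d e N \<longrightarrow> g I e \<le> N ^ b"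
    using f eq unfolding computes_def by metis
  fix r assume r: "d \<le> r"
  then obtain c where c: "adder r f c"
    using f unfolding computes_def by blast
  have "f (fst a) (snd a) = g (fst a) (snd a)" if "adm (Suc r) a N" for a N
    using that r by (intro eq[where N = N]) (auto simp: adm_def bnd_def)
  then have "adder r g c" using c unfolding adder_def
    by (elim transforms_conseq) auto
  then show "\<exists>c. adder r g c" by blast
qed

lemma computes_length: "2 \<le> d \<Longrightarrow> computes d (\<lambda>I e. length (word I))"
  by (rule computes_cong[OF computes_var[of 0]]) (auto simp: below_def bnd_def)

lemma computes_bound: "2 \<le> d \<Longrightarrow> computes d (\<lambda>I e. bound I)"
  by (rule computes_cong[OF computes_var[of 1]]) (auto simp: below_def bnd_def)

lemma computes_mono:
  assumes "computes d f" "d \<le> d'" shows "computes d' f"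
proof -
  have "below d' f" using assms unfolding computes_def below_def by (meson order_less_le_trans)
  moreover have "\<exists>b. \<forall>I e N. 2 \<le> N \<longrightarrow> bnd I d' e N \<longrightarrow> f I e \<le> N ^ b"
    using assms bnd_mono unfolding computes_def by blast
  ultimately show ?thesis using assms unfolding computes_def by auto
qed

lemma computes_adder:
  assumes "computes d f" "d \<le> r" obtains c where "adder r f c"
  using assms unfolding computes_def by auto

lemma computes_pow:
  assumes "computes d f" obtains b where "\<And>I e N. 2 \<le> N \<Longrightarrow> bnd I d e N \<Longrightarrow> f I e \<le> N ^ b"
  using assms unfolding computes_def by auto

lemma computes_below: "computes d f \<Longrightarrow> below d f"
  unfolding computes_def by auto

lemma computes_two: "computes d f \<Longrightarrow> 2 \<le> d"
  unfolding computes_def by auto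

lemma computesI:
  assumes "2 \<le> d" "below d f" "\<And>I e N. 2 \<le> N \<Longrightarrow> bnd I d e N \<Longrightarrow> f I e \<le> N ^ b"
    and "\<And>r. d \<le> r \<Longrightarrow> \<exists>c. adder r f c"
  shows "computes d f"
  using assms unfolding computes_def by blast

lemma checksD:
  assumes "checks d \<phi>" "d \<le> r"
  obtains c where "checker r \<phi> c"
  using assms unfolding checks_def by blast

lemma computes_Suc:
  assumes f: "computes d f" shows "computes d (\<lambda>I e. Suc (f I e))"
proof -
  obtain b where b: "\<And>I e N. 2 \<le> N \<Longrightarrow> bnd I d e N \<Longrightarrow> f I e \<le> N ^ b"
    by (rule computes_pow[OF f]) blast
  show ?thesis
  proof (rule computesI[where b = "b + 1"])
    show "below d (\<lambda>I e. Suc (f I e))" using computes_below[OF f] by (auto simp: below_def)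
    show "Suc (f I e) \<le> N ^ (b + 1)" if "2 \<le> N" "bnd I d e N" for I e N
      using b[OF that] pow_Suc_le[OF that(1), of b] by linarith
    fix r assume r: "d \<le> r"
    then obtain c where "adder r f c" by (rule computes_adder[OF f])
    then have "adder r (\<lambda>I e. Suc (f I e)) (c ;; Incr r)"
      unfolding adder_def by (rule transforms_Seq) (rule transforms_Incr', auto)
    then show "\<exists>c. adder r (\<lambda>I e. Suc (f I e)) c" by blast
  qed (rule computes_two[OF f])
qed

lemma computes_zero: "2 \<le> d \<Longrightarrow> computes d (\<lambda>I e. 0)"
proof (rule computesI[where b = 0])
  show "\<exists>c. adder r (\<lambda>I e. 0) c" for r
    unfolding adder_def by (rule exI[of _ Skip]) (simp add: transforms_Skip)
qed (auto simp: below_def)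

lemma computes_const: "2 \<le> d \<Longrightarrow> computes d (\<lambda>I e. n)"
  by (induction n) (auto intro: computes_zero computes_Suc)

lemma computes_add:
  assumes f: "computes d f" and g: "computes d g"
  shows "computes d (\<lambda>I e. f I e + g I e)"
proof -
  note bf = computes_below[OF f] and bg = computes_below[OF g] and d = computes_two[OF f]
  obtain n where n: "\<And>I e N. 2 \<le> N \<Longrightarrow> bnd I d e N \<Longrightarrow> f I e \<le> N ^ n"
    by (rule computes_pow[OF f]) blast
  obtain m where m: "\<And>I e N. 2 \<le> N \<Longrightarrow> bnd I d e N \<Longrightarrow> g I e \<le> N ^ m"
    by (rule computes_pow[OF g]) blast
  show ?thesis
  proof (rule computesI[where b = "n + m + 1"])
    show "below d (\<lambda>I e. f I e + g I e)" using bf bg unfolding below_def by metis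
    show "f I e + g I e \<le> N ^ (n + m + 1)" if "2 \<le> N" "bnd I d e N" for I e N
      using le_pow_add n m that by blast
    fix r assume r: "d \<le> r"
    obtain c where c: "adder r f c" by (rule computes_adder[OF f r])
    obtain c' where c': "adder r g c'" by (rule computes_adder[OF g r])
    have "transforms c' (adm (Suc r)) fst (\<lambda>a. {(snd a)(r := snd a r + f (fst a) (snd a))})
      (\<lambda>a. {(snd a)(r := snd a r + (f (fst a) (snd a) + g (fst a) (snd a)))})"
    proof (rule transforms_adder[OF c' bg r, where b = "n + 1"])
      fix a N e assume N: "2 \<le> (N :: nat)" and a: "adm (Suc r) a N"
        and e: "e \<in> {(snd a)(r := snd a r + f (fst a) (snd a))}"
      have "bnd (fst a) d (snd a) N" using a r by (auto simp: adm_def intro: bnd_mono)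
      then have *: "snd a r + f (fst a) (snd a) \<le> N ^ (1 + n + 1)"
        using a n N by (intro le_pow_add) (auto simp: adm_def bnd_def)
      show "adm (Suc r) (fst a, e) (N ^ Suc (n + 1))"
        using a e r d * N le_pow_Suc[OF N] by (auto simp: adm_def bnd_def less_Suc_eq simp del: power_Suc)
    qed (simp add: below_upd[OF bg r] add.assoc)
    then show "\<exists>c. adder r (\<lambda>I e. f I e + g I e) c"
      using transforms_Seq c unfolding adder_def by blast
  qed fact
qed

lemma computes_mult:
  assumes f: "computes d f" and g: "computes d g"
  shows "computes d (\<lambda>I e. f I e * g I e)"
proof -
  note bf = computes_below[OF f] and bg = computes_below[OF g] and d = computes_two[OF f]
  obtain n where n: "\<And>I e N. 2 \<le> N \<Longrightarrow> bnd I d e N \<Longrightarrow> f I e \<le> N ^ n"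
    by (rule computes_pow[OF f]) blast
  obtain m where m: "\<And>I e N. 2 \<le> N \<Longrightarrow> bnd I d e N \<Longrightarrow> g I e \<le> N ^ m"
    by (rule computes_pow[OF g]) blast
  have fg: "f I e * g I e \<le> N ^ (n + m)" if "2 \<le> N" "bnd I d e N" for I e N
    using le_pow_mult n m that by blast
  show ?thesis
  proof (rule computesI[OF d _ fg])
    show "below d (\<lambda>I e. f I e * g I e)" using bf bg unfolding below_def by metis
    fix r assume r: "d \<le> r"
    obtain c where c: "adder (r + 1) f c" by (rule computes_adder[OF f, of "r + 1"]) (use r in auto)
    \<comment> \<open>The second factor is evaluated above the loop counter \<open>r + 1\<close> and
      moved down to \<open>r\<close> afterwards; an adder for \<open>r\<close> itself would want all
      counters above \<open>r\<close> to be 0.\<close>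
    obtain c' where c': "adder (r + 2) g c'" by (rule computes_adder[OF g, of "r + 2"]) (use r in auto)
    let ?f = "\<lambda>a. f (fst a) (snd a)" and ?g = "\<lambda>a. g (fst a) (snd a)"
    \<comment> \<open>With \<open>v\<close> rounds left, \<open>?f a - v\<close> copies of
      \<open>g\<close> have been added.\<close>
    let ?E = "\<lambda>a v. {(snd a)(r := snd a r + (?f a - v) * ?g a, r + 1 := v)}"
    have bd: "bnd (fst a) d (snd a) N" if "adm (Suc r) a N" for a N
      using that r by (auto simp: adm_def intro: bnd_mono)
    have 1: "transforms c (adm (Suc r)) fst (\<lambda>a. {snd a}) (\<lambda>a. ?E a (?f a))"
    proof (rule transforms_adder[OF c bf, where b = 1])
      show "adm (Suc (r + 1)) (fst a, e) (N ^ Suc 1)"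
        if "2 \<le> N" "adm (Suc r) a N" "e \<in> {snd a}" for a N e
        using that r d le_pow_Suc[OF that(1), where b = 1]
        by (auto simp: adm_def bnd_def less_Suc_eq simp del: power_Suc)
    qed (use r in \<open>auto simp: adm_def\<close>)
    have 2: "transforms (For (r + 1) (c' ;; For (r + 2) (Incr r))) (adm (Suc r)) fst
      (\<lambda>a. ?E a (?f a)) (\<lambda>a. {(snd a)(r := snd a r + ?f a * ?g a)})"
    proof (rule transforms_For[where b = n and E = ?E and n = ?f])
      let ?M = "\<lambda>x N. adm (Suc r) (fst x) N \<and> snd x < ?f (fst x)"
      let ?E2 = "\<lambda>x v. {(snd (fst x))(r := snd (fst x) r + (?f (fst x) - Suc (snd x)) * ?g (fst x) +
          (?g (fst x) - v), r + 1 := snd x, r + 2 := v)}"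
      show "transforms (c' ;; For (r + 2) (Incr r)) ?M (\<lambda>x. fst (fst x))
        (\<lambda>x. (\<lambda>e. e(r + 1 := snd x)) ` ?E (fst x) (Suc (snd x))) (\<lambda>x. ?E (fst x) (snd x))"
      proof (rule transforms_Seq)
        show "transforms c' ?M (\<lambda>x. fst (fst x))
          (\<lambda>x. (\<lambda>e. e(r + 1 := snd x)) ` ?E (fst x) (Suc (snd x))) (\<lambda>x. ?E2 x (?g (fst x)))"
        proof (rule transforms_adder[OF c' bg, where b = "n + m + 2"])
          fix x N e assume N: "2 \<le> (N :: nat)" and M: "?M x N"
            and e: "e \<in> (\<lambda>e. e(r + 1 := snd x)) ` ?E (fst x) (Suc (snd x))"
          have b: "bnd (fst (fst x)) d (snd (fst x)) N" using bd M by blast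
          have "(?f (fst x) - Suc (snd x)) * ?g (fst x) \<le> ?f (fst x) * ?g (fst x)" by simp
          also have "\<dots> \<le> N ^ (n + m)" using fg[OF N b] .
          finally have 1: "snd (fst x) r + (?f (fst x) - Suc (snd x)) * ?g (fst x) \<le> N ^ (1 + (n + m) + 1)"
            using M N by (intro le_pow_add) (auto simp: adm_def bnd_def)
          have "snd x \<le> N ^ n" using n[OF N b] M by linarith
          also have "\<dots> \<le> N ^ Suc (n + m + 2)" using N by (intro pow_mono) auto
          finally have 2: "snd x \<le> N ^ Suc (n + m + 2)" .
          have "N ^ (1 + (n + m) + 1) \<le> N ^ Suc (n + m + 2)" using N by (intro pow_mono) auto
          then have 3: "snd (fst x) r + (?f (fst x) - Suc (snd x)) * ?g (fst x) \<le> N ^ Suc (n + m + 2)"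
            using 1 by linarith
          show "adm (Suc (r + 2)) (fst (fst x), e) (N ^ Suc (n + m + 2))"
            using M e r d 2 3 le_pow_Suc[OF N, where b = "n + m + 2"]
            by (auto simp: adm_def bnd_def less_Suc_eq simp del: power_Suc)
        qed (use r in \<open>auto simp: adm_def below_upd[OF bg] fun_eq_iff\<close>)
        show "transforms (For (r + 2) (Incr r)) ?M (\<lambda>x. fst (fst x))
          (\<lambda>x. ?E2 x (?g (fst x))) (\<lambda>x. ?E (fst x) (snd x))"
        proof (rule transforms_For[where b = m and E = ?E2 and n = "\<lambda>x. ?g (fst x)"])
          show "transforms (Incr r) (\<lambda>x N. ?M (fst x) N \<and> snd x < ?g (fst (fst x)))
            (\<lambda>x. fst (fst (fst x))) (\<lambda>x. (\<lambda>e. e(r + 2 := snd x)) ` ?E2 (fst x) (Suc (snd x)))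
            (\<lambda>x. ?E2 (fst x) (snd x))"
            by (rule transforms_Incr') (auto simp: fun_eq_iff)
          show "?E2 x 0 = ?E (fst x) (snd x)" if "?M x N" for x N
          proof -
            have "(?f (fst x) - snd x) = Suc (?f (fst x) - Suc (snd x))" using that by auto
            then show ?thesis using that by (auto simp: fun_eq_iff adm_def)
          qed
        qed (use m bd in auto)
      qed
      show "?E a 0 = {(snd a)(r := snd a r + ?f a * ?g a)}" if "adm (Suc r) a N" for a N
        using that by (auto simp: fun_eq_iff adm_def)
    qed (use n bd in auto)
    show "\<exists>c. adder r (\<lambda>I e. f I e * g I e) c"
      using transforms_Seq[OF 1 2] unfolding adder_def by blast
  qed
qed

section \<open>Checkable predicates: connectives, comparisons, tape contents, bounded quantifiers
  and walks\<close>

lemma adm_bound: "adm r a N \<Longrightarrow> 2 \<le> r \<Longrightarrow> bound (fst a) \<le> N"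
  unfolding adm_def bnd_def by (metis One_nat_def Suc_1 Suc_le_lessD)

lemma checksI:
  assumes "2 \<le> d" "below d \<phi>" "\<And>r. d \<le> r \<Longrightarrow> \<exists>c. checker r \<phi> c"
  shows "checks d \<phi>"
  using assms unfolding checks_def by blast

lemma checks_below: "checks d \<phi> \<Longrightarrow> below d \<phi>"
  unfolding checks_def by auto

lemma checks_two: "checks d \<phi> \<Longrightarrow> 2 \<le> d"
  unfolding checks_def by auto

lemma checks_conj:
  assumes f: "checks d \<phi>" and g: "checks d \<psi>"
  shows "checks d (\<lambda>I e. \<phi> I e \<and> \<psi> I e)"
proof (rule checksI[OF checks_two[OF f]])
  show "below d (\<lambda>I e. \<phi> I e \<and> \<psi> I e)"
    using checks_below[OF f] checks_below[OF g] unfolding below_def by metis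
  fix r assume r: "d \<le> r"
  obtain c where c: "checker r \<phi> c" by (rule checksD[OF f r])
  obtain c' where c': "checker r \<psi> c'" by (rule checksD[OF g r])
  have "transforms c' (adm r) fst (\<lambda>a. {e. e = snd a \<and> \<phi> (fst a) e})
      (\<lambda>a. {e. e = snd a \<and> \<phi> (fst a) e \<and> \<psi> (fst a) e})"
    by (rule transforms_checker[OF c', where b = 0]) auto
  then have "checker r (\<lambda>I e. \<phi> I e \<and> \<psi> I e) (c ;; c')"
    using c unfolding checker_def by (rule transforms_Seq[rotated])
  then show "\<exists>c. checker r (\<lambda>I e. \<phi> I e \<and> \<psi> I e) c" by blast
qed

lemma checks_disj:
  assumes f: "checks d \<phi>" and g: "checks d \<psi>"
  shows "checks d (\<lambda>I e. \<phi> I e \<or> \<psi> I e)"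
proof (rule checksI[OF checks_two[OF f]])
  show "below d (\<lambda>I e. \<phi> I e \<or> \<psi> I e)"
    using checks_below[OF f] checks_below[OF g] unfolding below_def by metis
  fix r assume r: "d \<le> r"
  obtain c where c: "checker r \<phi> c" by (rule checksD[OF f r])
  obtain c' where c': "checker r \<psi> c'" by (rule checksD[OF g r])
  have "checker r (\<lambda>I e. \<phi> I e \<or> \<psi> I e) (Choice c c')"
    unfolding checker_def
    by (rule transforms_conseq[OF transforms_Choice[OF c[unfolded checker_def] c'[unfolded checker_def]]])
      auto
  then show "\<exists>c. checker r (\<lambda>I e. \<phi> I e \<or> \<psi> I e) c" by blast
qed

text \<open>Counter \<open>r + 1\<close> receives \<open>g\<close> and is lowered once for each unit
  of \<open>f\<close> in counter \<open>r\<close>; finding it empty is a failure. What remains of it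
  is cleared, as scratch counters are left at 0.\<close>

lemma checks_le:
  assumes f: "computes d f" and g: "computes d g"
  shows "checks d (\<lambda>I e. f I e \<le> g I e)"
proof (rule checksI)
  note bf = computes_below[OF f] and bg = computes_below[OF g] and d = computes_two[OF f]
  obtain n where n: "\<And>I e N. 2 \<le> N \<Longrightarrow> bnd I d e N \<Longrightarrow> f I e \<le> N ^ n"
    by (rule computes_pow[OF f]) blast
  obtain m where m: "\<And>I e N. 2 \<le> N \<Longrightarrow> bnd I d e N \<Longrightarrow> g I e \<le> N ^ m"
    by (rule computes_pow[OF g]) blast
  show "2 \<le> d" by fact
  show "below d (\<lambda>I e. f I e \<le> g I e)" using bf bg unfolding below_def by metis
  fix r assume r: "d \<le> r"
  obtain c where c: "adder r f c" by (rule computes_adder[OF f r])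
  obtain c' where c': "adder (r + 1) g c'" by (rule computes_adder[OF g, of "r + 1"]) (use r in auto)
  let ?f = "\<lambda>a. f (fst a) (snd a)" and ?g = "\<lambda>a. g (fst a) (snd a)"
  \<comment> \<open>The condition says that all rounds made so far have found a positive counter; at
    \<open>v = 0\<close> it is the comparison to be checked.\<close>
  let ?E = "\<lambda>a v. {e. e = (snd a)(r := v, r + 1 := ?g a - (?f a - v)) \<and> ?f a - v \<le> ?g a}"
  have bd: "bnd (fst a) d (snd a) N" if "adm r a N" for a N
    using that r by (auto simp: adm_def intro: bnd_mono)
  have 1: "transforms c (adm r) fst (\<lambda>a. {snd a}) (\<lambda>a. {(snd a)(r := ?f a)})"
  proof (rule transforms_adder[OF c bf, where b = 0])
    show "adm (Suc r) (fst a, e) (N ^ Suc 0)"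
      if "2 \<le> N" "adm r a N" "e \<in> {snd a}" for a N e
      using that r d by (auto simp: adm_def bnd_def less_Suc_eq)
  qed (use r in \<open>auto simp: adm_def\<close>)
  have 2: "transforms c' (adm r) fst (\<lambda>a. {(snd a)(r := ?f a)}) (\<lambda>a. ?E a (?f a))"
  proof (rule transforms_adder[OF c' bg, where b = n])
    show "adm (Suc (r + 1)) (fst a, e) (N ^ Suc n)"
      if "2 \<le> N" "adm r a N" "e \<in> {(snd a)(r := ?f a)}" for a N e
    proof -
      have "?f a \<le> N ^ n" using n that bd by blast
      also have "\<dots> \<le> N ^ Suc n" using that by (intro pow_mono) auto
      finally show ?thesis
        using that r d le_pow_Suc[OF that(1), where b = n]
        by (auto simp: adm_def bnd_def less_Suc_eq simp del: power_Suc)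
    qed
  qed (use r in \<open>auto simp: adm_def below_upd[OF bg]\<close>)
  have 3: "transforms (For r (Cond (r + 1 + 3) {0} (Decr (r + 1)) Fail)) (adm r) fst (\<lambda>a. ?E a (?f a))
      (\<lambda>a. ?E a 0)"
  proof (rule transforms_For[where b = n and E = ?E and n = ?f])
    let ?E' = "\<lambda>x. (\<lambda>e. e(r := snd x)) ` ?E (fst x) (Suc (snd x))"
    let ?M = "\<lambda>x N. adm r (fst x) N \<and> snd x < ?f (fst x)"
    have "transforms (Cond (r + 1 + 3) {0} (Decr (r + 1)) Fail) ?M
      (\<lambda>x. fst (fst x)) ?E' (\<lambda>x. (\<lambda>e. e(r + 1 := e (r + 1) - 1)) ` {e \<in> ?E' x. e (r + 1) \<noteq> 0} \<union> {})"
      by (rule transforms_Cond[OF transforms_Decr transforms_Fail]) auto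
    then show "transforms (Cond (r + 1 + 3) {0} (Decr (r + 1)) Fail) ?M
      (\<lambda>x. fst (fst x)) ?E' (\<lambda>x. ?E (fst x) (snd x))"
    proof (rule transforms_conseq)
      fix x N assume "?M x N"
      then have *: "?f (fst x) - snd x = Suc (?f (fst x) - Suc (snd x))" by auto
      have E': "?E' x = (if ?f (fst x) - Suc (snd x) \<le> ?g (fst x)
          then {(snd (fst x))(r := snd x, r + 1 := ?g (fst x) - (?f (fst x) - Suc (snd x)))} else {})"
        by (cases "?f (fst x) - Suc (snd x) \<le> ?g (fst x)") (simp, simp add: fun_eq_iff, simp)
      show "(\<lambda>e. e(r + 1 := e (r + 1) - 1)) ` {e \<in> ?E' x. e (r + 1) \<noteq> 0} \<union> {} = ?E (fst x) (snd x)"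
        unfolding E' * by (simp add: Collect_conv_if)
    qed auto
  qed (use n bd in auto)
  have 4: "transforms (For (r + 1) Skip) (adm r) fst (\<lambda>a. ?E a 0)
     (\<lambda>a. {e. e = snd a \<and> f (fst a) e \<le> g (fst a) e})"
  proof (rule transforms_clear[where b = m])
    fix a N e assume "2 \<le> (N :: nat)" "adm r a N" "e \<in> ?E a 0"
    then show "e (r + 1) \<le> N ^ m" using m[OF _ bd, of N a] by auto
  next
    fix a N assume "adm r a N"
    then have "(snd a)(r := 0, Suc r := 0) = snd a" by (auto simp: adm_def fun_eq_iff)
    then show "(\<lambda>e. e(r + 1 := 0)) ` ?E a 0 = {e. e = snd a \<and> f (fst a) e \<le> g (fst a) e}"
      by (auto simp: image_iff)
  qed
  show "\<exists>c. checker r (\<lambda>I e. f I e \<le> g I e) c"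
    using transforms_Seq[OF 1 transforms_Seq[OF 2 transforms_Seq[OF 3 4]]]
    unfolding checker_def by blast
qed

lemma checks_less: "computes d f \<Longrightarrow> computes d g \<Longrightarrow> checks d (\<lambda>I e. f I e < g I e)"
  using checks_le[OF computes_Suc] by (simp add: Suc_le_eq)

lemma checks_eq: "computes d f \<Longrightarrow> computes d g \<Longrightarrow> checks d (\<lambda>I e. f I e = g I e)"
  unfolding order_eq_iff by (intro checks_conj checks_le)

text \<open>A false predicate is one without successful check, so negation has to be expressed
  positively, here as a strict inequality in one of the two directions.\<close>

lemma checks_neq: "computes d f \<Longrightarrow> computes d g \<Longrightarrow> checks d (\<lambda>I e. f I e \<noteq> g I e)"
  unfolding neq_iff by (intro checks_disj checks_less)

lemma checks_const: "2 \<le> d \<Longrightarrow> checks d (\<lambda>I e. b)"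
  using checks_eq[OF computes_const[of d 0] computes_const[of d "if b then 0 else 1"]] by (cases b) simp_all

lemma prog_shift:
  assumes i: "i < 3" and D: "\<And>a p. D a i p < 3"
  shows "prog (Act i (\<lambda>s. {s}) m) M (\<lambda>a. store_of ` {(D a, h a, e a)})
    (\<lambda>a. store_of ` {(D a, (h a)(i := move m (h a i)), e a)})"
proof (rule progI_const)
  fix a
  have "{s \<in> {D a i (h a i)}. s < 3} = {D a i (h a i)}" using D by auto
  then show "runs (Act i (\<lambda>s. {s}) m) (store_of ` {(D a, h a, e a)}) (Suc 0)
      (store_of ` {(D a, (h a)(i := move m (h a i)), e a)})"
    using runs_data[OF i, of "\<lambda>s. {s}" m "D a" "h a" "e a"] by simp
qed

text \<open>\<open>f\<close> is evaluated twice: one copy takes the head from 0 to the cell, and the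
  other brings it back after the test.\<close>

lemma checks_data:
  assumes f: "computes d f" and i: "i < 3"
  shows "checks d (\<lambda>I e. data I i (int (f I e)) \<in> Z)"
proof (rule checksI)
  note bf = computes_below[OF f] and d = computes_two[OF f]
  obtain n where n: "\<And>I e N. 2 \<le> N \<Longrightarrow> bnd I d e N \<Longrightarrow> f I e \<le> N ^ n"
    by (rule computes_pow[OF f]) blast
  show "2 \<le> d" by fact
  show "below d (\<lambda>I e. data I i (int (f I e)) \<in> Z)" using bf unfolding below_def by metis
  fix r assume r: "d \<le> r"
  obtain c where c: "adder r f c" by (rule computes_adder[OF f r])
  obtain c' where c': "adder (r + 1) f c'" by (rule computes_adder[OF f, of "r + 1"]) (use r in auto)
  let ?f = "\<lambda>a. f (fst a) (snd a)"
  let ?st = "\<lambda>a h v u. (data (fst a), (\<lambda>_. 0)(i := int h), (snd a)(r := v, r + 1 := u))"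
  have bd: "bnd (fst a) d (snd a) N" if "adm r a N" for a N
    using that r by (auto simp: adm_def intro: bnd_mono)
  have 1: "transforms c (adm r) fst (\<lambda>a. {snd a}) (\<lambda>a. {(snd a)(r := ?f a)})"
  proof (rule transforms_adder[OF c bf, where b = 0])
    show "adm (Suc r) (fst a, e) (N ^ Suc 0)"
      if "2 \<le> N" "adm r a N" "e \<in> {snd a}" for a N e
      using that r d by (auto simp: adm_def bnd_def less_Suc_eq)
  qed (use r in \<open>auto simp: adm_def\<close>)
  have 2: "transforms c' (adm r) fst (\<lambda>a. {(snd a)(r := ?f a)}) (\<lambda>a. {(snd a)(r := ?f a, r + 1 := ?f a)})"
  proof (rule transforms_adder[OF c' bf, where b = n])
    show "adm (Suc (r + 1)) (fst a, e) (N ^ Suc n)"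
      if "2 \<le> N" "adm r a N" "e \<in> {(snd a)(r := ?f a)}" for a N e
    proof -
      have "?f a \<le> N ^ n" using n that bd by blast
      also have "\<dots> \<le> N ^ Suc n" using that by (intro pow_mono) auto
      finally show ?thesis
        using that r d le_pow_Suc[OF that(1), where b = n]
        by (auto simp: adm_def bnd_def less_Suc_eq simp del: power_Suc)
    qed
  qed (use r in \<open>auto simp: adm_def below_upd[OF bf]\<close>)
  have st: "inst_store (fst a) ` {(snd a)(r := v, r + 1 := u)} = store_of ` {?st a 0 v u}" for a v u
    by (simp add: inst_store_def inst_state_def fun_upd_idem)
  have 3: "prog (For r (Act i (\<lambda>s. {s}) Move_Right)) (adm r) (\<lambda>a. store_of ` {?st a (?f a - ?f a) (?f a) (?f a)})
     (\<lambda>a. store_of ` {?st a (?f a - 0) 0 (?f a)})"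
  proof (rule prog_For[where A = "\<lambda>a v. {?st a (?f a - v) v (?f a)}" and n = ?f and b = n])
    show "prog (Act i (\<lambda>s. {s}) Move_Right) (\<lambda>(a, v) N. adm r a N \<and> v < ?f a)
      (\<lambda>(a, v). store_of ` set_counter r v ` {?st a (?f a - Suc v) (Suc v) (?f a)})
      (\<lambda>(a, v). store_of ` {?st a (?f a - v) v (?f a)})"
      by (rule prog_conseq[OF prog_shift[OF i, where m = Move_Right and
          M = "\<lambda>x N. snd x < ?f (fst x)" and
          D = "\<lambda>x. data (fst (fst x))" and h = "\<lambda>x. (\<lambda>_. 0)(i := int (?f (fst x) - Suc (snd x)))" and
          e = "\<lambda>x. (snd (fst x))(r := snd x, r + 1 := ?f (fst x))"]])
        (auto simp: data_less set_counter_def fun_eq_iff of_nat_diff intro!: arg_cong[where f = store_of])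
  qed (use n bd in \<open>auto simp: counter_def\<close>)
  have test: "prog (Cond i Z Skip Fail) (adm r) (\<lambda>a. store_of ` {?st a (?f a - 0) 0 (?f a)})
     (\<lambda>a. {\<sigma>. \<sigma> \<in> store_of ` {?st a (?f a - 0) 0 (?f a)} \<and> reads \<sigma> i \<in> Z} \<union> {})"
    by (rule prog_Cond[OF prog_Skip prog_Fail])
  let ?B = "\<lambda>a v. {s. s = ?st a v 0 v \<and> data (fst a) i (int (?f a)) \<in> Z}"
  have 4: "prog (Cond i Z Skip Fail) (adm r) (\<lambda>a. store_of ` {?st a (?f a - 0) 0 (?f a)})
     (\<lambda>a. store_of ` ?B a (?f a))"
    by (rule prog_conseq[OF test]) (auto simp: reads_data[OF i])
  have 5: "prog (For (r + 1) (Act i (\<lambda>s. {s}) Move_Left)) (adm r)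
     (\<lambda>a. store_of ` ?B a (?f a)) (\<lambda>a. store_of ` ?B a 0)"
  proof (rule prog_For[where n = ?f and b = n])
    have "prog (Act i (\<lambda>s. {s}) Move_Left) (\<lambda>x N. data (fst (fst x)) i (int (?f (fst x))) \<in> Z)
      (\<lambda>x. store_of ` set_counter (r + 1) (snd x) ` {?st (fst x) (Suc (snd x)) 0 (Suc (snd x))})
      (\<lambda>x. store_of ` {?st (fst x) (snd x) 0 (snd x)})"
      by (rule prog_conseq[OF prog_shift[OF i, where m = Move_Left and M = "\<lambda>x N. True" and
          D = "\<lambda>x. data (fst (fst x))" and h = "\<lambda>x. (\<lambda>_. 0)(i := int (Suc (snd x)))" and
          e = "\<lambda>x. (snd (fst x))(r := 0, r + 1 := snd x)"]])
        (auto simp: data_less set_counter_def fun_eq_iff intro!: arg_cong[where f = store_of])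
    \<comment> \<open>The index set is the singleton of \<open>x\<close> or empty, according to the
      tested symbol, so that a failed test leaves no store.\<close>
    then have "prog (Act i (\<lambda>s. {s}) Move_Left) (\<lambda>x N. True)
      (\<lambda>x. \<Union>j\<in>{j. data (fst (fst x)) i (int (?f (fst x))) \<in> Z \<and> j = x}.
         store_of ` set_counter (r + 1) (snd j) ` {?st (fst j) (Suc (snd j)) 0 (Suc (snd j))})
      (\<lambda>x. \<Union>j\<in>{j. data (fst (fst x)) i (int (?f (fst x))) \<in> Z \<and> j = x}.
         store_of ` {?st (fst j) (snd j) 0 (snd j)})"
      by (rule prog_UN) auto
    then show "prog (Act i (\<lambda>s. {s}) Move_Left) (\<lambda>(a, v) N. adm r a N \<and> v < ?f a)
      (\<lambda>(a, v). store_of ` set_counter (r + 1) v ` ?B a (Suc v))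
      (\<lambda>(a, v). store_of ` ?B a v)"
      by (rule prog_conseq) (auto split: prod.splits)
  qed (use n bd in \<open>auto simp: counter_def\<close>)
  have z: "(snd a)(r := 0, r + 1 := 0) = snd a" if "adm r a N" for a N
    using that by (auto simp: adm_def fun_eq_iff)
  have 12: "prog (c ;; c') (adm r) (\<lambda>a. inst_store (fst a) ` {snd a})
     (\<lambda>a. store_of ` {?st a (?f a - ?f a) (?f a) (?f a)})"
    using transforms_Seq[OF 1 2] unfolding transforms_def st by simp
  have "prog ((c ;; c') ;; For r (Act i (\<lambda>s. {s}) Move_Right) ;; Cond i Z Skip Fail ;;
      For (r + 1) (Act i (\<lambda>s. {s}) Move_Left)) (adm r) (\<lambda>a. inst_store (fst a) ` {snd a})
      (\<lambda>a. store_of ` ?B a 0)"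
    by (intro prog_Seq[OF 12] prog_Seq[OF 3] prog_Seq[OF 4] 5)
  then have "checker r (\<lambda>I e. data I i (int (f I e)) \<in> Z) ((c ;; c') ;; For r (Act i (\<lambda>s. {s}) Move_Right) ;;
      Cond i Z Skip Fail ;; For (r + 1) (Act i (\<lambda>s. {s}) Move_Left))"
    unfolding checker_def transforms_def
    by (rule prog_conseq)
      (use z in \<open>auto simp: inst_store_def inst_state_def fun_upd_idem\<close>)
  then show "\<exists>c. checker r (\<lambda>I e. data I i (int (f I e)) \<in> Z) c" by blast
qed

lemma transforms_move:
  assumes "p \<noteq> q" and M: "\<And>a N e. 2 \<le> N \<Longrightarrow> M a N \<Longrightarrow> e \<in> E a \<Longrightarrow> e q \<le> N ^ b"
    and F: "\<And>a N. 2 \<le> N \<Longrightarrow> M a N \<Longrightarrow> (\<lambda>e. e(p := e p + e q, q := 0)) ` E a = F a"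
  shows "transforms (For q (Incr p)) M I E F"
proof -
  let ?E = "\<lambda>a v. {(snd a)(p := snd a p + (snd a q - v), q := v)}"
  have 1: "transforms (For q (Incr p)) (\<lambda>a N. snd a q \<le> N) fst (\<lambda>a. {snd a}) (\<lambda>a. ?E a 0)"
  proof (rule transforms_For[where n = "\<lambda>a. snd a q" and E = ?E and b = 1])
    show "transforms (Incr p) (\<lambda>x N. snd (fst x) q \<le> N \<and> snd x < snd (fst x) q) (\<lambda>x. fst (fst x))
        (\<lambda>x. (\<lambda>e. e(q := snd x)) ` ?E (fst x) (Suc (snd x))) (\<lambda>x. ?E (fst x) (snd x))"
      by (rule transforms_Incr') (use \<open>p \<noteq> q\<close> in \<open>auto simp: fun_eq_iff\<close>)
  qed (use \<open>p \<noteq> q\<close> in \<open>auto simp: fun_eq_iff\<close>)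
  show ?thesis
  proof (rule transforms_pointwise[OF 1, where b = b])
    fix a N e assume *: "2 \<le> N" "M a N" "e \<in> E a"
    then have "e q \<le> N ^ b" "N ^ b \<le> N ^ Suc b" using M pow_mono by auto
    then show "snd (I a, e) q \<le> N ^ Suc b" by (simp del: power_Suc)
  next
    show "(\<Union>e\<in>E a. ?E (I a, e) 0) = F a" if "2 \<le> N" "M a N" for a N
      unfolding F[OF that, symmetric] by auto
  qed
qed

text \<open>Each unit of \<open>q\<close> is either added to \<open>p\<close> or dropped, so every
  number up to the content of \<open>q\<close> is a possible guess.\<close>

lemma transforms_guess:
  assumes "p \<noteq> q" and M: "\<And>a N e. 2 \<le> N \<Longrightarrow> M a N \<Longrightarrow> e \<in> E a \<Longrightarrow> e q \<le> N ^ b"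
    and F: "\<And>a N. 2 \<le> N \<Longrightarrow> M a N \<Longrightarrow> (\<Union>e\<in>E a. (\<lambda>u. e(p := e p + u, q := 0)) ` {..e q}) = F a"
  shows "transforms (For q (Choice (Incr p) Skip)) M I E F"
proof -
  let ?E = "\<lambda>a v. (\<lambda>u. (snd a)(p := snd a p + u, q := v)) ` {..snd a q - v}"
  have 1: "transforms (For q (Choice (Incr p) Skip)) (\<lambda>a N. snd a q \<le> N) fst (\<lambda>a. {snd a}) (\<lambda>a. ?E a 0)"
  proof (rule transforms_For[where n = "\<lambda>a. snd a q" and E = ?E and b = 1])
    let ?M = "\<lambda>x N. snd (fst x) q \<le> N \<and> snd x < snd (fst x) q"
    let ?E' = "\<lambda>x. (\<lambda>e. e(q := snd x)) ` ?E (fst x) (Suc (snd x))"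
    have "transforms (Choice (Incr p) Skip) ?M (\<lambda>x. fst (fst x)) ?E'
        (\<lambda>x. (\<lambda>e. e(p := Suc (e p))) ` ?E' x \<union> ?E' x)"
      by (rule transforms_Choice[OF transforms_Incr transforms_Skip])
    then show "transforms (Choice (Incr p) Skip) ?M (\<lambda>x. fst (fst x)) ?E' (\<lambda>x. ?E (fst x) (snd x))"
    proof (rule transforms_conseq)
      fix x :: "(inst \<times> (nat \<Rightarrow> nat)) \<times> nat" and N assume "snd (fst x) q \<le> N \<and> snd x < snd (fst x) q"
      then have "snd (fst x) q - snd x = Suc (snd (fst x) q - Suc (snd x))" by auto
      then have *: "{..snd (fst x) q - snd x} = {..snd (fst x) q - Suc (snd x)} \<union>
            (Suc ` {..snd (fst x) q - Suc (snd x)})"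
        by (auto simp: image_Suc_atMost)
      show "(\<lambda>e. e(p := Suc (e p))) ` (\<lambda>e. e(q := snd x)) ` ?E (fst x) (Suc (snd x)) \<union>
          (\<lambda>e. e(q := snd x)) ` ?E (fst x) (Suc (snd x)) = ?E (fst x) (snd x)"
        unfolding * image_Un image_image using \<open>p \<noteq> q\<close> by (simp add: fun_upd_twist Un_commute)
    qed auto
  qed (use \<open>p \<noteq> q\<close> in \<open>auto simp: fun_eq_iff\<close>)
  show ?thesis
  proof (rule transforms_pointwise[OF 1, where b = b])
    fix a N e assume *: "2 \<le> N" "M a N" "e \<in> E a"
    then have "e q \<le> N ^ b" "N ^ b \<le> N ^ Suc b" using M pow_mono by auto
    then show "snd (I a, e) q \<le> N ^ Suc b" by (simp del: power_Suc)
  next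
    show "(\<Union>e\<in>E a. ?E (I a, e) 0) = F a" if "2 \<le> N" "M a N" for a N
      unfolding F[OF that, symmetric] by auto
  qed
qed

text \<open>The premise is stated for terms \<open>t\<close>, so that \<open>t\<close> can be the counter of the
  quantified variable as well as a constant.\<close>

lemma checks_ex:
  assumes d: "2 \<le> d"
    and H: "\<And>d' t. d \<le> d' \<Longrightarrow> computes d' t \<Longrightarrow> checks d' (\<lambda>I e. \<psi> I e (t I e))"
  shows "checks d (\<lambda>I e. \<exists>v\<le>bound I. \<psi> I e v)"
proof (rule checksI[OF d])
  have bel: "below d (\<lambda>I e. \<psi> I e v)" for v
    using checks_below[OF H[OF order_refl computes_const[OF d]]] .
  then show "below d (\<lambda>I e. \<exists>v\<le>bound I. \<psi> I e v)" unfolding below_def by metis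
  fix r assume r: "d \<le> r"
  obtain c where c: "adder (r + 1) (\<lambda>I e. bound I) c"
    by (rule computes_adder[OF computes_bound, of "r + 1"]) (use d r in auto)
  \<comment> \<open>Counter \<open>r\<close> is the quantified variable, so the scratch space of the
    body begins at \<open>Suc r\<close>.\<close>
  obtain c' where c': "checker (Suc r) (\<lambda>I e. \<psi> I e (e r)) c'"
    by (rule checksD[OF H[of "Suc r" "\<lambda>I e. e r", OF _ computes_var] order_refl]) (use d r in auto)
  let ?P = "\<lambda>a. bound (fst a)"
  have 1: "transforms c (adm r) fst (\<lambda>a. {snd a}) (\<lambda>a. {(snd a)(r + 1 := ?P a)})"
  proof (rule transforms_adder[OF c, where b = 0 and d = 2])
    show "adm (Suc (r + 1)) (fst a, e) (N ^ Suc 0)"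
      if "2 \<le> N" "adm r a N" "e \<in> {snd a}" for a N e
      using that r d by (auto simp: adm_def bnd_def less_Suc_eq)
  qed (use r d in \<open>auto simp: adm_def below_def\<close>)
  have 2: "transforms (For (r + 1) (Choice (Incr r) Skip)) (adm r) fst (\<lambda>a. {(snd a)(r + 1 := ?P a)})
    (\<lambda>a. (\<lambda>u. (snd a)(r := u)) ` {..?P a})"
  proof (rule transforms_guess[where b = 1])
    show "e (r + 1) \<le> N ^ 1" if "2 \<le> N" "adm r a N" "e \<in> {(snd a)(r + 1 := ?P a)}" for a N e
      using that d r adm_bound[of r a N] by auto
    show "(\<Union>e\<in>{(snd a)(r + 1 := ?P a)}. (\<lambda>u. e(r := e r + u, r + 1 := 0)) ` {..e (r + 1)}) =
        (\<lambda>u. (snd a)(r := u)) ` {..?P a}" if "adm r a N" for a N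
    proof -
      have "(snd a)(r + 1 := ?P a, r := ((snd a)(r + 1 := ?P a)) r + u, r + 1 := 0) = (snd a)(r := u)" for u
        using that by (auto simp: adm_def fun_eq_iff)
      then show ?thesis by simp
    qed
  qed auto
  have 3: "transforms c' (adm r) fst (\<lambda>a. (\<lambda>u. (snd a)(r := u)) ` {..?P a})
      (\<lambda>a. (\<lambda>u. (snd a)(r := u)) ` {u. u \<le> ?P a \<and> \<psi> (fst a) (snd a) u})"
  proof (rule transforms_checker[OF c', where b = 0])
    show "adm (Suc r) (fst a, e) (N ^ Suc 0)"
      if "2 \<le> N" "adm r a N" "e \<in> (\<lambda>u. (snd a)(r := u)) ` {..?P a}" for a N e
      using that r d adm_bound[of r a N] by (auto simp: adm_def bnd_def less_Suc_eq)
  qed (auto simp: below_upd[OF bel r])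
  have 4: "transforms (For r Skip) (adm r) fst
      (\<lambda>a. (\<lambda>u. (snd a)(r := u)) ` {u. u \<le> ?P a \<and> \<psi> (fst a) (snd a) u})
      (\<lambda>a. {e. e = snd a \<and> (\<exists>v\<le>?P a. \<psi> (fst a) e v)})"
  proof (rule transforms_clear[where b = 1])
    fix a N e assume "2 \<le> (N :: nat)" "adm r a N"
      "e \<in> (\<lambda>u. (snd a)(r := u)) ` {u. u \<le> ?P a \<and> \<psi> (fst a) (snd a) u}"
    then show "e r \<le> N ^ 1" using r d adm_bound[of r a N] by auto
  next
    fix a N assume "adm r a N"
    then have "(snd a)(r := 0) = snd a" by (auto simp: adm_def fun_eq_iff)
    then show "(\<lambda>e. e(r := 0)) ` (\<lambda>u. (snd a)(r := u)) ` {u. u \<le> ?P a \<and> \<psi> (fst a) (snd a) u} =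
        {e. e = snd a \<and> (\<exists>v\<le>?P a. \<psi> (fst a) e v)}"
      by (auto simp: image_image)
  qed
  show "\<exists>c. checker r (\<lambda>I e. \<exists>v\<le>bound I. \<psi> I e v) c"
    using transforms_Seq[OF 1 transforms_Seq[OF 2 transforms_Seq[OF 3 4]]]
    unfolding checker_def by blast
qed

text \<open>All instances are checked in a loop. Counter \<open>r\<close> runs upwards through the
  values while \<open>r + 1\<close> counts the remaining rounds, \<open>Suc (bound I)\<close> in
  total because the value 0 is included.\<close>

lemma checks_all:
  assumes d: "2 \<le> d"
    and H: "\<And>d' t. d \<le> d' \<Longrightarrow> computes d' t \<Longrightarrow> checks d' (\<lambda>I e. \<psi> I e (t I e))"
  shows "checks d (\<lambda>I e. \<forall>v\<le>bound I. \<psi> I e v)"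
proof (rule checksI[OF d])
  have bel: "below d (\<lambda>I e. \<psi> I e v)" for v
    using checks_below[OF H[OF order_refl computes_const[OF d]]] .
  then show "below d (\<lambda>I e. \<forall>v\<le>bound I. \<psi> I e v)" unfolding below_def by metis
  fix r assume r: "d \<le> r"
  obtain c where c: "adder (r + 1) (\<lambda>I e. Suc (bound I)) c"
    by (rule computes_adder[OF computes_Suc[OF computes_bound], of "r + 1"]) (use d r in auto)
  obtain c' where c': "checker (r + 2) (\<lambda>I e. \<psi> I e (e r)) c'"
    by (rule checksD[OF H[of "r + 2" "\<lambda>I e. e r", OF _ computes_var] order_refl]) (use d r in auto)
  let ?P = "\<lambda>a. Suc (bound (fst a))"
  let ?E = "\<lambda>a v. {e. e = (snd a)(r := ?P a - v, r + 1 := v) \<and> (\<forall>u<?P a - v. \<psi> (fst a) (snd a) u)}"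
  have P: "?P a \<le> N ^ Suc 1" if "2 \<le> N" "adm r a N" for a N
    using that r d le_pow_add[of N 1 0 "bound (fst a)" 1] adm_bound[of r a N] by auto
  have 1: "transforms c (adm r) fst (\<lambda>a. {snd a}) (\<lambda>a. ?E a (?P a))"
  proof (rule transforms_adder[OF c, where b = 0 and d = 2])
    show "adm (Suc (r + 1)) (fst a, e) (N ^ Suc 0)"
      if "2 \<le> N" "adm r a N" "e \<in> {snd a}" for a N e
      using that r d by (auto simp: adm_def bnd_def less_Suc_eq)
    show "(\<lambda>e. e(r + 1 := e (r + 1) + Suc (bound (fst a)))) ` {snd a} = ?E a (?P a)"
      if "adm r a N" for a N
    proof -
      have "(snd a)(r := 0) = snd a" "snd a (Suc r) = 0" using that by (auto simp: adm_def fun_eq_iff)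
      then show ?thesis by simp
    qed
  qed (use r d in \<open>auto simp: below_def\<close>)
  have 2: "transforms (For (r + 1) (c' ;; Incr r)) (adm r) fst (\<lambda>a. ?E a (?P a)) (\<lambda>a. ?E a 0)"
  proof (rule transforms_For[where b = "Suc 1" and E = ?E and n = ?P])
    let ?M = "\<lambda>x N. adm r (fst x) N \<and> snd x < ?P (fst x)"
    let ?E' = "\<lambda>x. (\<lambda>e. e(r + 1 := snd x)) ` ?E (fst x) (Suc (snd x))"
    let ?F = "\<lambda>x. {e. e = (snd (fst x))(r := ?P (fst x) - Suc (snd x), r + 1 := snd x) \<and>
      (\<forall>u<?P (fst x) - snd x. \<psi> (fst (fst x)) (snd (fst x)) u)}"
    have E': "?E' x = (if \<forall>u<?P (fst x) - Suc (snd x). \<psi> (fst (fst x)) (snd (fst x)) u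
      then {(snd (fst x))(r := ?P (fst x) - Suc (snd x), r + 1 := snd x)} else {})" for x
      by (simp add: Collect_conv_if)
    show "transforms (c' ;; Incr r) ?M (\<lambda>x. fst (fst x)) ?E' (\<lambda>x. ?E (fst x) (snd x))"
    proof (rule transforms_Seq)
      show "transforms c' ?M (\<lambda>x. fst (fst x)) ?E' ?F"
      proof (rule transforms_checker[OF c', where b = 1])
        show "adm (r + 2) (fst (fst x), e) (N ^ Suc 1)" if "2 \<le> N" "?M x N" "e \<in> ?E' x" for x N e
        proof -
          have "e = (snd (fst x))(r := ?P (fst x) - Suc (snd x), r + 1 := snd x)"
            using that(3) unfolding E' by (simp split: if_splits)
          then show ?thesis
            using that r d P[OF that(1), of "fst x"] le_pow_Suc[OF that(1), where b = 1]
            by (auto simp: adm_def bnd_def less_Suc_eq simp del: power_Suc)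
        qed
        show "{e \<in> ?E' x. \<psi> (fst (fst x)) e (e r)} = ?F x" if "?M x N" for x N
        proof -
          have *: "?P (fst x) - snd x = Suc (?P (fst x) - Suc (snd x))" using that by auto
          have "{e \<in> ?E' x. \<psi> (fst (fst x)) e (e r)} =
            (if \<forall>u<?P (fst x) - snd x. \<psi> (fst (fst x)) (snd (fst x)) u
            then {(snd (fst x))(r := ?P (fst x) - Suc (snd x), r + 1 := snd x)} else {})"
            unfolding E' * All_less_Suc using r
            by (auto simp: below_upd[OF bel] less_Suc_eq)
          then show ?thesis by (simp add: Collect_conv_if)
        qed
      qed
      show "transforms (Incr r) ?M (\<lambda>x. fst (fst x)) ?F (\<lambda>x. ?E (fst x) (snd x))"
      proof (rule transforms_Incr')
        show "(\<lambda>e. e(r := Suc (e r))) ` ?F x = ?E (fst x) (snd x)" if "?M x N" for x N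
        proof -
          have *: "?P (fst x) - snd x = Suc (?P (fst x) - Suc (snd x))" using that by auto
          show ?thesis unfolding * by (simp add: Collect_conv_if fun_upd_twist)
        qed
      qed
    qed
  qed (use P in auto)
  have 3: "transforms (For r Skip) (adm r) fst (\<lambda>a. ?E a 0)
      (\<lambda>a. {e. e = snd a \<and> (\<forall>v\<le>bound (fst a). \<psi> (fst a) e v)})"
  proof (rule transforms_clear[where b = "Suc 1"])
    show "e r \<le> N ^ Suc 1" if "2 \<le> N" "adm r a N" "e \<in> ?E a 0" for a N e
      using P that by auto
    show "(\<lambda>e. e(r := 0)) ` ?E a 0 = {e. e = snd a \<and> (\<forall>v\<le>bound (fst a). \<psi> (fst a) e v)}"
      if "adm r a N" for a N
    proof -
      have "(snd a)(r := 0) = snd a" "(snd a)(Suc r := 0, r := 0) = snd a"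
        using that by (auto simp: adm_def fun_eq_iff)
      then show ?thesis by (auto simp: Collect_conv_if less_Suc_eq_le fun_upd_twist)
    qed
  qed
  show "\<exists>c. checker r (\<lambda>I e. \<forall>v\<le>bound I. \<psi> I e v) c"
    using transforms_Seq[OF 1 transforms_Seq[OF 2 3]] unfolding checker_def by blast
qed

text \<open>Targets are limited by the bound, so the next node of a walk is found by a bounded guess
  and fits into a counter.\<close>

definition step_rel :: "(inst \<Rightarrow> env \<Rightarrow> nat \<Rightarrow> nat \<Rightarrow> bool) \<Rightarrow> inst \<Rightarrow> env \<Rightarrow> (nat \<times> nat) set" where
  "step_rel \<rho> I e = {(m, m'). m' \<le> bound I \<and> \<rho> I e m m'}"

text \<open>Only the current node is stored. In each round the next node is guessed and tested
  against \<open>\<rho>\<close>, or the round is skipped, which accounts for all lengths up to the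
  bound. The end is compared with \<open>y\<close> after the last round.\<close>

lemma checks_walk:
  assumes x: "computes d x" and y: "computes d y"
    and H: "\<And>d' t u. d \<le> d' \<Longrightarrow> computes d' t \<Longrightarrow> computes d' u \<Longrightarrow>
      checks d' (\<lambda>I e. \<rho> I e (t I e) (u I e))"
  shows "checks d (\<lambda>I e. \<exists>j\<le>bound I. (x I e, y I e) \<in> step_rel \<rho> I e ^^ j)"
proof (rule checksI)
  note d = computes_two[OF x] and bx = computes_below[OF x] and by_ = computes_below[OF y]
  show "2 \<le> d" by fact
  have bel: "below d (\<lambda>I e. \<rho> I e u v)" for u v
    using checks_below[OF H[OF order_refl computes_const[OF d] computes_const[OF d]]] .
  have step: "step_rel \<rho> I e = step_rel \<rho> I e'" if "\<And>k. k < d \<Longrightarrow> e k = e' k" for I e e'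
    unfolding step_rel_def using belowD[OF bel that] by simp
  show "below d (\<lambda>I e. \<exists>j\<le>bound I. (x I e, y I e) \<in> step_rel \<rho> I e ^^ j)"
    unfolding below_def
  proof (intro allI impI)
    fix I e e' assume *: "\<forall>k<d. e k = (e' k :: nat)"
    then show "(\<exists>j\<le>bound I. (x I e, y I e) \<in> step_rel \<rho> I e ^^ j) =
      (\<exists>j\<le>bound I. (x I e', y I e') \<in> step_rel \<rho> I e' ^^ j)"
      using step[of e e' I] belowD[OF bx, of e e' I] belowD[OF by_, of e e' I] by simp
  qed
  fix r assume r: "d \<le> r"
  obtain n where n: "\<And>I e N. 2 \<le> N \<Longrightarrow> bnd I d e N \<Longrightarrow> x I e \<le> N ^ n"
    by (rule computes_pow[OF x]) blast
  obtain cx where cx: "adder r x cx" by (rule computes_adder[OF x r])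
  obtain c1 where c1: "adder (r + 1) (\<lambda>I e. bound I) c1"
    by (rule computes_adder[OF computes_bound, of "r + 1"]) (use d r in auto)
  obtain c3 where c3: "adder (r + 3) (\<lambda>I e. bound I) c3"
    by (rule computes_adder[OF computes_bound, of "r + 3"]) (use d r in auto)
  \<comment> \<open>Counter \<open>r + 3\<close> holds the range of the guess and is 0 again once
    the guess is made, so the test may use it as scratch space.\<close>
  obtain c' where c': "checker (r + 3) (\<lambda>I e. \<rho> I e (e r) (e (r + 2))) c'"
    by (rule checksD[OF H[of "r + 3" "\<lambda>I e. e r" "\<lambda>I e. e (r + 2)", OF _ computes_var computes_var] order_refl])
      (use d r in auto)
  obtain cy where cy: "checker (r + 1) (\<lambda>I e. e r = y I e) cy"
    by (rule checksD[OF checks_eq[OF computes_var[of r "r + 1"] computes_mono[OF y]] order_refl])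
      (use d r in auto)
  let ?P = "\<lambda>a. bound (fst a)"
  let ?x = "\<lambda>a. x (fst a) (snd a)"
  let ?R = "\<lambda>a. step_rel \<rho> (fst a) (snd a)"
  let ?W = "\<lambda>a k. {u. \<exists>j\<le>k. (?x a, u) \<in> ?R a ^^ j}"
  let ?E = "\<lambda>a v. (\<lambda>u. (snd a)(r := u, r + 1 := v)) ` ?W a (?P a - v)"
  have bd: "bnd (fst a) d (snd a) N" if "adm r a N" for a N
    using that r by (auto simp: adm_def intro: bnd_mono)
  have W: "u \<le> N ^ Suc n" if "2 \<le> N" "adm r a N" "u \<in> ?W a k" for a N u k
  proof -
    from that(3) obtain j where j: "(?x a, u) \<in> ?R a ^^ j" by blast
    have "?x a \<le> N ^ n" using n[OF that(1) bd[OF that(2)]] .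
    also have "\<dots> \<le> N ^ Suc n" using that by (intro pow_mono) auto
    finally have "?x a \<le> N ^ Suc n" .
    moreover have "?P a \<le> N ^ Suc n" using adm_bound[OF that(2)] d r le_pow_Suc that(1) by simp
    ultimately show ?thesis using j by (cases j) (auto simp: step_rel_def)
  qed
  have W0: "?W a 0 = {?x a}" for a by auto
  have WSuc: "?W a (Suc k) = ?W a k \<union> {m. m \<le> ?P a \<and> (\<exists>u\<in>?W a k. \<rho> (fst a) (snd a) u m)}" for a k
  proof -
    have "(\<exists>j\<le>Suc k. (?x a, m) \<in> ?R a ^^ j) \<longleftrightarrow> (\<exists>j\<le>k. (?x a, m) \<in> ?R a ^^ j) \<or>
      (\<exists>j\<le>k. (?x a, m) \<in> ?R a ^^ Suc j)" for m
    proof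
      assume "\<exists>j\<le>Suc k. (?x a, m) \<in> ?R a ^^ j"
      then obtain j where "j \<le> Suc k" "(?x a, m) \<in> ?R a ^^ j" by blast
      then show "(\<exists>j\<le>k. (?x a, m) \<in> ?R a ^^ j) \<or> (\<exists>j\<le>k. (?x a, m) \<in> ?R a ^^ Suc j)"
        by (cases j) (blast, meson Suc_le_mono)
    qed (meson Suc_le_mono le_SucI)
    then show ?thesis by (auto simp: step_rel_def relcomp_unfold)
  qed
  have 1: "transforms cx (adm r) fst (\<lambda>a. {snd a}) (\<lambda>a. {(snd a)(r := ?x a)})"
  proof (rule transforms_adder[OF cx bx, where b = 0])
    show "adm (Suc r) (fst a, e) (N ^ Suc 0)" if "2 \<le> N" "adm r a N" "e \<in> {snd a}" for a N e
      using that r d by (auto simp: adm_def bnd_def less_Suc_eq)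
  qed (use r in \<open>auto simp: adm_def\<close>)
  have 2: "transforms c1 (adm r) fst (\<lambda>a. {(snd a)(r := ?x a)}) (\<lambda>a. ?E a (?P a))"
  proof (rule transforms_adder[OF c1, where b = n and d = 2])
    show "adm (Suc (r + 1)) (fst a, e) (N ^ Suc n)"
      if "2 \<le> N" "adm r a N" "e \<in> {(snd a)(r := ?x a)}" for a N e
      using that r d le_pow_Suc[OF that(1), where b = n] W[OF that(1,2), of "?x a" 0]
      by (auto simp: adm_def bnd_def less_Suc_eq simp del: power_Suc)
    show "(\<lambda>e. e(r + 1 := e (r + 1) + bound (fst a))) ` {(snd a)(r := ?x a)} = ?E a (?P a)"
      if "adm r a N" for a N
    proof -
      have "?W a (?P a - ?P a) = {?x a}" using W0 by simp
      then show ?thesis using that by (simp add: adm_def)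
    qed
  qed (use r d in \<open>auto simp: below_def\<close>)
  \<comment> \<open>Counter \<open>r\<close> is the current node, \<open>r + 1\<close> the number of
    rounds left, \<open>r + 2\<close> the guessed node and \<open>r + 3\<close> the range of the
    guess. After the test the guess replaces the current node.\<close>
  let ?B = "c3 ;; For (r + 3) (Choice (Incr (r + 2)) Skip) ;; c' ;; For r Skip ;; For (r + 2) (Incr r)"
  have 3: "transforms (For (r + 1) (Choice Skip ?B)) (adm r) fst (\<lambda>a. ?E a (?P a)) (\<lambda>a. ?E a 0)"
  proof (rule transforms_For[where b = 1 and E = ?E and n = ?P])
    let ?M = "\<lambda>a N. adm r (fst a) N \<and> snd a < ?P (fst a)"
    let ?I = "\<lambda>a. fst (fst a)"
    let ?V = "\<lambda>a. ?W (fst a) (?P (fst a) - Suc (snd a))"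
    let ?S = "\<lambda>a u m l. (snd (fst a))(r := u, r + 1 := snd a, r + 2 := m, r + 3 := l)"
    let ?E' = "\<lambda>a. (\<lambda>e. e(r + 1 := snd a)) ` ?E (fst a) (Suc (snd a))"
    have zero: "snd (fst a) (r + 2) = 0" "snd (fst a) (r + 3) = 0"
      "snd (fst a) (Suc (Suc r)) = 0" if "?M a N" for a N
      using that by (auto simp: adm_def)
    have E': "?E' a = (\<lambda>u. ?S a u 0 0) ` ?V a" if "?M a N" for a N
      unfolding image_image by (rule image_cong) (use zero[OF that] in \<open>auto simp: fun_eq_iff\<close>)
    have V: "u \<le> N ^ Suc n" if "2 \<le> N" "?M a N" "u \<in> ?V a" for u a N
      using W that by blast
    have P: "?P (fst a) \<le> N ^ Suc n" "snd a \<le> N ^ Suc n" "?P (fst a) \<le> N" if "2 \<le> N" "?M a N" for a N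
    proof -
      show "?P (fst a) \<le> N" using adm_bound[of r "fst a" N] that d r by simp
      then show *: "?P (fst a) \<le> N ^ Suc n" using le_pow_Suc[OF that(1)] by simp
      show "snd a \<le> N ^ Suc n" using * that by simp
    qed
    have S: "adm (r + 4) (?I a, ?S a u m l) (N ^ Suc n)"
      if "2 \<le> N" "?M a N" "u \<in> ?V a" "m \<le> ?P (fst a)" "l \<le> ?P (fst a)" for a u m l N
    proof -
      have "m \<le> N ^ Suc n" "l \<le> N ^ Suc n" using P[OF that(1,2)] that by linarith+
      then show ?thesis
        using that V[OF that(1-3)] P[OF that(1,2)] d r le_pow_Suc[OF that(1), where b = n]
        by (auto simp: adm_def bnd_def less_Suc_eq numeral_eq_Suc simp del: power_Suc)
    qed
    have b1: "transforms c3 ?M ?I (\<lambda>a. (\<lambda>u. ?S a u 0 0) ` ?V a) (\<lambda>a. (\<lambda>u. ?S a u 0 (?P (fst a))) ` ?V a)"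
    proof (rule transforms_adder[OF c3, where b = n and d = 2])
      show "adm (Suc (r + 3)) (?I a, e) (N ^ Suc n)"
        if "2 \<le> N" "?M a N" "e \<in> (\<lambda>u. ?S a u 0 0) ` ?V a" for a N e
        using that S[OF that(1,2), of _ 0 0] by (auto simp: numeral_eq_Suc simp del: power_Suc)
    qed (use r d in \<open>auto simp: below_def image_image\<close>)
    let ?G = "\<lambda>a. (\<Union>u\<in>?V a. (\<lambda>m. ?S a u m 0) ` {..?P (fst a)})"
    have b2: "transforms (For (r + 3) (Choice (Incr (r + 2)) Skip)) ?M ?I
        (\<lambda>a. (\<lambda>u. ?S a u 0 (?P (fst a))) ` ?V a) ?G"
    proof (rule transforms_guess[where b = 1])
      show "e (r + 3) \<le> N ^ 1"
        if "2 \<le> N" "?M a N" "e \<in> (\<lambda>u. ?S a u 0 (?P (fst a))) ` ?V a" for a N e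
        using that P[OF that(1,2)] by auto
    qed (auto simp: image_image)
    let ?G' = "\<lambda>a. (\<Union>u\<in>?V a. (\<lambda>m. ?S a u m 0) ` {m. m \<le> ?P (fst a) \<and> \<rho> (?I a) (snd (fst a)) u m})"
    have b3: "transforms c' ?M ?I ?G ?G'"
    proof (rule transforms_checker[OF c', where b = n])
      fix a N e assume *: "2 \<le> (N :: nat)" "?M a N" "e \<in> ?G a"
      then obtain u m where um: "u \<in> ?V a" "m \<le> ?P (fst a)" "e = ?S a u m 0" by blast
      have "adm (r + 4) (?I a, e) (N ^ Suc n)" unfolding um(3) by (rule S[OF *(1,2) um(1,2)]) simp
      moreover have "e k = 0" if "r + 3 \<le> k" for k
        using that um(3) *(2) by (auto simp: adm_def)
      ultimately show "adm (r + 3) (?I a, e) (N ^ Suc n)"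
        by (auto simp: adm_def bnd_def simp del: power_Suc)
    next
      fix a N
      have "\<rho> (?I a) (?S a u m 0) u m = \<rho> (?I a) (snd (fst a)) u m" for u m
        by (rule belowD[OF bel]) (use r in auto)
      then show "{e \<in> ?G a. \<rho> (?I a) e (e r) (e (r + 2))} = ?G' a"
        by auto
    qed
    let ?G'' = "\<lambda>a. (\<Union>u\<in>?V a. (\<lambda>m. ?S a 0 m 0) ` {m. m \<le> ?P (fst a) \<and> \<rho> (?I a) (snd (fst a)) u m})"
    have b4: "transforms (For r Skip) ?M ?I ?G' ?G''"
    proof (rule transforms_clear[where b = "Suc n"])
      fix a N e assume *: "2 \<le> (N :: nat)" "?M a N" "e \<in> ?G' a"
      then obtain u m where "u \<in> ?V a" "e = ?S a u m 0" by blast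
      then show "e r \<le> N ^ Suc n" using V[OF *(1,2), of u] by (simp del: power_Suc)
    next
      fix a :: "(inst \<times> env) \<times> nat"
      have "(?S a u m 0)(r := 0) = ?S a 0 m 0" for u m by (auto simp: fun_eq_iff)
      then show "(\<lambda>e. e(r := 0)) ` ?G' a = ?G'' a"
        by (simp only: image_UN image_image)
    qed
    let ?H = "\<lambda>a. (\<lambda>m. (snd (fst a))(r := m, r + 1 := snd a)) `
      {m. m \<le> ?P (fst a) \<and> (\<exists>u\<in>?V a. \<rho> (?I a) (snd (fst a)) u m)}"
    have b5: "transforms (For (r + 2) (Incr r)) ?M ?I ?G'' ?H"
    proof (rule transforms_move[where b = 1])
      show "e (r + 2) \<le> N ^ 1" if "2 \<le> N" "?M a N" "e \<in> ?G'' a" for a N e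
        using that P[OF that(1,2)] by auto
      show "(\<lambda>e. e(r := e r + e (r + 2), r + 2 := 0)) ` ?G'' a = ?H a" if "?M a N" for a N
      proof -
        have "(?S a 0 m 0)(r := (?S a 0 m 0) r + (?S a 0 m 0) (r + 2), r + 2 := 0) =
          (snd (fst a))(r := m, r + 1 := snd a)" for m
          using zero[OF that] by (auto simp: fun_eq_iff)
        then show ?thesis by (simp only: image_UN image_image) blast
      qed
    qed auto
    have "transforms ?B ?M ?I (\<lambda>a. (\<lambda>u. ?S a u 0 0) ` ?V a) ?H"
      by (intro transforms_Seq[OF b1] transforms_Seq[OF b2] transforms_Seq[OF b3] transforms_Seq[OF b4] b5)
    then have "transforms ?B ?M ?I ?E' ?H"
      by (rule transforms_conseq) (assumption, erule E'[symmetric], rule refl)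
    from transforms_Choice[OF transforms_Skip this]
    show "transforms (Choice Skip ?B) ?M ?I ?E' (\<lambda>a. ?E (fst a) (snd a))"
    proof (rule transforms_conseq)
      fix a N assume M: "?M a N"
      then have *: "?P (fst a) - snd a = Suc (?P (fst a) - Suc (snd a))" by auto
      have "?E' a = (\<lambda>u. (snd (fst a))(r := u, r + 1 := snd a)) ` ?V a"
        unfolding image_image by simp
      then show "?E' a \<union> ?H a = ?E (fst a) (snd a)"
        unfolding * WSuc image_Un by simp
    qed auto
  qed (use d r adm_bound in auto)
  have 4: "transforms cy (adm r) fst (\<lambda>a. ?E a 0)
    (\<lambda>a. {e. e = (snd a)(r := y (fst a) (snd a)) \<and> (\<exists>j\<le>?P a. (?x a, y (fst a) (snd a)) \<in> ?R a ^^ j)})"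
  proof (rule transforms_checker[OF cy, where b = n])
    fix a N e assume *: "2 \<le> (N :: nat)" "adm r a N" "e \<in> ?E a 0"
    then obtain u where u: "u \<in> ?W a (?P a)" "e = (snd a)(r := u, r + 1 := 0)" by auto
    show "adm (r + 1) (fst a, e) (N ^ Suc n)"
      using * u(2) W[OF *(1,2) u(1)] d r le_pow_Suc[OF *(1), where b = n]
      by (auto simp: adm_def bnd_def less_Suc_eq simp del: power_Suc)
  next
    fix a N assume a: "adm r a N"
    have y: "y (fst a) ((snd a)(r := u, r + 1 := 0)) = y (fst a) (snd a)" for u
      by (rule belowD[OF by_]) (use r in auto)
    have "(snd a)(r := u, r + 1 := 0) = (snd a)(r := u)" for u
      using a by (auto simp: adm_def fun_eq_iff)
    then show "{e \<in> ?E a 0. e r = y (fst a) e} =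
      {e. e = (snd a)(r := y (fst a) (snd a)) \<and> (\<exists>j\<le>?P a. (?x a, y (fst a) (snd a)) \<in> ?R a ^^ j)}"
      using y by auto
  qed
  obtain m where m: "\<And>I e N. 2 \<le> N \<Longrightarrow> bnd I d e N \<Longrightarrow> y I e \<le> N ^ m"
    by (rule computes_pow[OF y]) blast
  have 5: "transforms (For r Skip) (adm r) fst
    (\<lambda>a. {e. e = (snd a)(r := y (fst a) (snd a)) \<and> (\<exists>j\<le>?P a. (?x a, y (fst a) (snd a)) \<in> ?R a ^^ j)})
    (\<lambda>a. {e. e = snd a \<and> (\<exists>j\<le>?P a. (x (fst a) e, y (fst a) e) \<in> step_rel \<rho> (fst a) e ^^ j)})"
  proof (rule transforms_clear[where b = m])
    fix a N e assume "2 \<le> (N :: nat)" "adm r a N"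
      "e \<in> {e. e = (snd a)(r := y (fst a) (snd a)) \<and> (\<exists>j\<le>?P a. (?x a, y (fst a) (snd a)) \<in> ?R a ^^ j)}"
    then show "e r \<le> N ^ m" using m bd by auto
  next
    fix a N assume "adm r a N"
    then have "(snd a)(r := 0) = snd a" by (auto simp: adm_def fun_eq_iff)
    then show "(\<lambda>e. e(r := 0)) ` {e. e = (snd a)(r := y (fst a) (snd a)) \<and>
        (\<exists>j\<le>?P a. (?x a, y (fst a) (snd a)) \<in> ?R a ^^ j)} =
      {e. e = snd a \<and> (\<exists>j\<le>?P a. (x (fst a) e, y (fst a) e) \<in> step_rel \<rho> (fst a) e ^^ j)}"
      by (auto simp: Collect_conv_if)
  qed
  show "\<exists>c. checker r (\<lambda>I e. \<exists>j\<le>bound I. (x I e, y I e) \<in> step_rel \<rho> I e ^^ j) c"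
    using transforms_Seq[OF 1 transforms_Seq[OF 2 transforms_Seq[OF 3 transforms_Seq[OF 4 5]]]]
    unfolding checker_def by blast
qed

section \<open>Reachability between sets described by checkable predicates\<close>

lemma prog_write:
  assumes i: "i < 3"
  shows "prog (Act i f m) M (\<lambda>a. store_of ` {(D a, h a, e a)})
    (\<lambda>a. store_of ` (\<lambda>s. ((D a)(i := (D a i)(h a i := s)), (h a)(i := move m (h a i)), e a)) `
      {s \<in> f (D a i (h a i)). s < 3})"
  by (rule progI_const) (use runs_data[OF i] in \<open>simp add: image_image\<close>)

text \<open>Counter 2 is reserved for the outer loop over the steps of a path; the scratch space of
  everything inside that loop begins at 3.\<close>

definition env_of :: "inst \<Rightarrow> nat \<Rightarrow> env" where
  "env_of I v = (\<lambda>_. 0)(0 := length (word I), 1 := bound I, 2 := v)"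

definition size_le :: "inst \<times> nat \<Rightarrow> nat \<Rightarrow> bool" where
  "size_le a N \<longleftrightarrow> length (word (fst a)) \<le> N \<and> bound (fst a) \<le> N \<and> snd a \<le> N"

lemma adm_env_of: "adm 3 (I, env_of I v) N \<longleftrightarrow> size_le (I, v) N"
  by (auto simp: adm_def bnd_def env_of_def size_le_def less_Suc_eq numeral_eq_Suc)

lemma adm_Suc: "adm r a N \<Longrightarrow> adm (Suc r) a N"
  by (auto simp: adm_def bnd_def less_Suc_eq)

lemma adm_upd: "adm r (I, e) N \<Longrightarrow> 2 \<le> r \<Longrightarrow> v \<le> N \<Longrightarrow> adm (Suc r) (I, e(r := v)) N"
  by (auto simp: adm_def bnd_def less_Suc_eq)

lemma bound_adders:
  obtains c c' where "adder 3 (\<lambda>I e. bound I) c" "adder 4 (\<lambda>I e. bound I) c'"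
proof -
  obtain c where c: "adder 3 (\<lambda>I e. bound I) c"
    by (rule computes_adder[OF computes_bound, of 2 3]) auto
  obtain c' where "adder 4 (\<lambda>I e. bound I) c'"
    by (rule computes_adder[OF computes_bound, of 2 4]) auto
  with c show ?thesis by (rule that)
qed

text \<open>Two copies of the bound: counter 3 controls a sweep over the cells of a tape, and
  counter 4 the return of the heads.\<close>

lemma prog_load_bound:
  assumes c: "adder 3 (\<lambda>I e. bound I) c" and c': "adder 4 (\<lambda>I e. bound I) c'"
  shows "prog (c ;; c') (\<lambda>a. size_le (g a)) (\<lambda>a. {inst_store (fst (g a)) (env_of (fst (g a)) (snd (g a)))})
    (\<lambda>a. {inst_store (fst (g a)) ((env_of (fst (g a)) (snd (g a)))
      (3 := bound (fst (g a)), 4 := bound (fst (g a))))})"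
proof -
  let ?e = "\<lambda>a. env_of (fst (g a)) (snd (g a))"
  have 1: "transforms c (\<lambda>a. size_le (g a)) (\<lambda>a. fst (g a)) (\<lambda>a. {?e a})
    (\<lambda>a. {(?e a)(3 := bound (fst (g a)))})"
  proof (rule transforms_adder[OF c, where b = 0 and d = 2])
    fix a N e assume "2 \<le> (N :: nat)" "size_le (g a) N" "e \<in> {?e a}"
    then have "adm 3 (fst (g a), e) N" using adm_env_of by auto
    then show "adm (Suc 3) (fst (g a), e) (N ^ Suc 0)" using adm_Suc[of 3] by simp
  qed (auto simp: below_def env_of_def)
  have 2: "transforms c' (\<lambda>a. size_le (g a)) (\<lambda>a. fst (g a)) (\<lambda>a. {(?e a)(3 := bound (fst (g a)))})
    (\<lambda>a. {(?e a)(3 := bound (fst (g a)), 4 := bound (fst (g a)))})"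
  proof (rule transforms_adder[OF c', where b = 0 and d = 2])
    fix a N e assume *: "2 \<le> (N :: nat)" "size_le (g a) N" "e \<in> {(?e a)(3 := bound (fst (g a)))}"
    then have "adm 3 (fst (g a), ?e a) N" using adm_env_of by auto
    then have "adm (Suc 3) (fst (g a), e) N" using * adm_upd[of 3] by (simp add: size_le_def)
    from adm_Suc[OF this] show "adm (Suc 4) (fst (g a), e) (N ^ Suc 0)" by simp
  qed (auto simp: below_def env_of_def)
  show ?thesis using transforms_Seq[OF 1 2] by (simp add: transforms_def)
qed

lemma prog_rewind:
  assumes i: "i < 3"
  shows "prog (For 4 (Act i (\<lambda>s. {s}) Move_Left)) (\<lambda>a N. v a \<le> N)
    (\<lambda>a. store_of ` {(data (I a), (h a)(i := int (v a)), (e a)(4 := v a))})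
    (\<lambda>a. store_of ` {(data (I a), (h a)(i := 0), (e a)(4 := 0))})"
proof -
  let ?A = "\<lambda>a u. {(data (I a), (h a)(i := int u), (e a)(4 := u))}"
  have "prog (For 4 (Act i (\<lambda>s. {s}) Move_Left)) (\<lambda>a N. v a \<le> N) (\<lambda>a. store_of ` ?A a (v a))
      (\<lambda>a. store_of ` ?A a 0)"
  proof (rule prog_For[where b = 1])
    show "prog (Act i (\<lambda>s. {s}) Move_Left) (\<lambda>(a, u) N. v a \<le> N \<and> u < v a)
      (\<lambda>(a, u). store_of ` set_counter 4 u ` ?A a (Suc u)) (\<lambda>(a, u). store_of ` ?A a u)"
      by (rule prog_conseq[OF prog_shift[OF i, where m = Move_Left and M = "\<lambda>x N. True" and
          D = "\<lambda>x. data (I (fst x))" and h = "\<lambda>x. (h (fst x))(i := int (Suc (snd x)))" and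
          e = "\<lambda>x. (e (fst x))(4 := snd x)"]])
        (auto simp: data_less set_counter_def fun_eq_iff intro!: arg_cong[where f = store_of])
  qed (auto simp: counter_def)
  then show ?thesis by simp
qed

lemma data_later: "(data I)(2 := set_tape S) = data (I\<lparr>later := S\<rparr>)"
  by (rule ext) (auto simp: data_def)

lemma data_now: "(data I)(1 := set_tape S) = data (I\<lparr>now := S\<rparr>)"
  by (rule ext) (auto simp: data_def)

lemma data_simps: "data I 1 = set_tape (now I)" "data I 2 = set_tape (later I)"
  by (simp_all add: data_def)

lemma set_tape_upd: "(set_tape S)(int k := 2) = set_tape (insert k S)"
  "(set_tape S)(int k := 0) = set_tape (S - {k})"
  by (rule ext, auto simp: set_tape_def)+

text \<open>The set written so far is extended by one bit. Removing \<open>k\<close> from a subset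
  of \<open>{..<k}\<close> changes nothing, but this is the form in which the writing of 0 at cell
  \<open>k\<close> appears.\<close>

lemma Pow_lessThan_Suc:
  "Pow {..<Suc k} = (\<Union>S\<in>Pow {..<k}. (\<lambda>s. if s = 2 then insert k S else S - {k}) ` {0 :: nat, 2})"
proof (intro equalityI subsetI)
  fix T assume T: "T \<in> Pow {..<Suc k}"
  then have "T = (if k \<in> T then insert k (T - {k}) else (T - {k}) - {k})" by auto
  moreover have "T - {k} \<in> Pow {..<k}" using T by (auto simp: less_Suc_eq)
  ultimately show "T \<in> (\<Union>S\<in>Pow {..<k}. (\<lambda>s. if s = 2 then insert k S else S - {k}) ` {0 :: nat, 2})"
    by (intro UN_I[of "T - {k}"]) auto
qed (auto simp: less_Suc_eq split: if_splits)

lemma prog_guess_bit: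
  "prog (Act 2 (\<lambda>_. {0, 2}) Move_Right) M
    (\<lambda>a. store_of ` {(data (I a), (\<lambda>_. 0)(2 := int (k a)), e a)})
    (\<lambda>a. store_of ` (\<lambda>S. (data ((I a)\<lparr>later := S\<rparr>), (\<lambda>_. 0)(2 := int (Suc (k a))), e a)) `
      (\<lambda>s. if s = 2 then insert (k a) (later (I a)) else later (I a) - {k a}) ` {0 :: nat, 2})"
proof (rule prog_conseq[OF prog_write[where M = "\<lambda>_ _. True" and D = "\<lambda>a. data (I a)" and
      h = "\<lambda>a. (\<lambda>_. 0)(2 := int (k a))" and e = e]])
  fix a N
  have eq: "(\<lambda>s. ((data (I a))(2 := (data (I a) 2)(((\<lambda>_ :: nat. 0)(2 := int (k a))) 2 := s)),
      ((\<lambda>_ :: nat. 0)(2 := int (k a)))(2 := move Move_Right (((\<lambda>_ :: nat. 0)(2 := int (k a))) 2)), e a)) `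
      {s \<in> {0, 2}. s < 3} =
    (\<lambda>S. (data ((I a)\<lparr>later := S\<rparr>), (\<lambda>_ :: nat. 0)(2 := int (Suc (k a))), e a)) `
      (\<lambda>s. if s = 2 then insert (k a) (later (I a)) else later (I a) - {k a}) ` {0 :: nat, 2}"
  proof -
    have 02: "{s \<in> {0::nat, 2}. s < 3} = {0, 2}" by auto
    show ?thesis unfolding 02 by (simp add: data_simps set_tape_upd data_later add.commute)
  qed
  show "True \<and> store_of ` {(data (I a), (\<lambda>_ :: nat. 0)(2 := int (k a)), e a)} =
      store_of ` {(data (I a), (\<lambda>_ :: nat. 0)(2 := int (k a)), e a)} \<and>
    store_of ` (\<lambda>s. ((data (I a))(2 := (data (I a) 2)(((\<lambda>_ :: nat. 0)(2 := int (k a))) 2 := s)),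
      ((\<lambda>_ :: nat. 0)(2 := int (k a)))(2 := move Move_Right (((\<lambda>_ :: nat. 0)(2 := int (k a))) 2)), e a)) `
      {s \<in> {0, 2}. s < 3} =
    store_of ` (\<lambda>S. (data ((I a)\<lparr>later := S\<rparr>), (\<lambda>_ :: nat. 0)(2 := int (Suc (k a))), e a)) `
      (\<lambda>s. if s = 2 then insert (k a) (later (I a)) else later (I a) - {k a}) ` {0 :: nat, 2}"
    by (intro conjI TrueI refl) (rule arg_cong[where f = "image store_of", OF eq])
qed simp

lemma later_idem: "later I = S \<Longrightarrow> I\<lparr>later := S\<rparr> = I"
  by (cases I) auto

text \<open>After \<open>k\<close> writing steps tape 2 may hold any subset of
  \<open>{..<k}\<close>. As \<open>later\<close> is empty before, no cell beyond the range is filled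
  at the end.\<close>

lemma guess_set:
  obtains c where "prog c (\<lambda>a N. size_le a N \<and> later (fst a) = {})
    (\<lambda>a. {inst_store (fst a) (env_of (fst a) (snd a))})
    (\<lambda>a. (\<lambda>S. inst_store ((fst a)\<lparr>later := S\<rparr>) (env_of (fst a) (snd a))) ` Pow {..<bound (fst a)})"
proof -
  obtain c c' where c: "adder 3 (\<lambda>I e. bound I) c" "adder 4 (\<lambda>I e. bound I) c'" by (rule bound_adders)
  let ?M = "\<lambda>a N. size_le a N \<and> later (fst a) = {}"
  let ?e = "\<lambda>a. env_of (fst a) (snd a)"
  let ?P = "\<lambda>a. bound (fst a)"
  let ?s = "\<lambda>a u S. (data ((fst a)\<lparr>later := S\<rparr>), (\<lambda>_ :: nat. 0)(2 := int (?P a - u)), (?e a)(3 := u, 4 := ?P a))"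
  let ?A = "\<lambda>a u. ?s a u ` Pow {..<?P a - u}"
  have 1: "prog (c ;; c') ?M (\<lambda>a. {inst_store (fst a) (?e a)}) (\<lambda>a. store_of ` ?A a (?P a))"
    by (rule prog_conseq[OF prog_load_bound[OF c, where g = "\<lambda>a. a"]])
      (auto simp: inst_store_def inst_state_def fun_upd_idem later_idem)
  have 2: "prog (For 3 (Act 2 (\<lambda>_. {0, 2}) Move_Right)) ?M (\<lambda>a. store_of ` ?A a (?P a))
      (\<lambda>a. store_of ` ?A a 0)"
  proof (rule prog_For[where b = 1])
    let ?k = "\<lambda>x. ?P (fst x) - Suc (snd x)"
    let ?I = "\<lambda>x S. (fst (fst x))\<lparr>later := S\<rparr>"
    let ?f = "\<lambda>x. (?e (fst x))(3 := snd x, 4 := ?P (fst x))"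
    let ?T = "\<lambda>x S. (\<lambda>s. if s = 2 then insert (?k x) S else S - {?k x}) ` {0 :: nat, 2}"
    have "prog (Act 2 (\<lambda>_. {0, 2}) Move_Right) (\<lambda>y N. True)
      (\<lambda>y. store_of ` {(data (?I (fst y) (snd y)), (\<lambda>_ :: nat. 0)(2 := int (?k (fst y))), ?f (fst y))})
      (\<lambda>y. store_of ` (\<lambda>T. (data ((?I (fst y) (snd y))\<lparr>later := T\<rparr>), (\<lambda>_ :: nat. 0)(2 := int (Suc (?k (fst y)))), ?f (fst y))) `
        (\<lambda>s. if s = 2 then insert (?k (fst y)) (later (?I (fst y) (snd y)))
          else later (?I (fst y) (snd y)) - {?k (fst y)}) ` {0 :: nat, 2})"
      by (rule prog_guess_bit)
    then have "prog (Act 2 (\<lambda>_. {0, 2}) Move_Right) (\<lambda>y N. True)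
      (\<lambda>y. store_of ` {(data (?I (fst y) (snd y)), (\<lambda>_ :: nat. 0)(2 := int (?k (fst y))), ?f (fst y))})
      (\<lambda>y. store_of ` (\<lambda>T. (data (?I (fst y) T), (\<lambda>_ :: nat. 0)(2 := int (Suc (?k (fst y)))), ?f (fst y))) `
        ?T (fst y) (snd y))"
      by simp
    from prog_UN[OF this, where M = "\<lambda>_ _. True" and J = "\<lambda>x. Pow {..<?k x}" and f = "\<lambda>x S. (x, S)"]
    have *: "prog (Act 2 (\<lambda>_. {0, 2}) Move_Right) (\<lambda>x N. True)
      (\<lambda>x. \<Union>S\<in>Pow {..<?k x}. store_of ` {(data (?I x S), (\<lambda>_ :: nat. 0)(2 := int (?k x)), ?f x)})
      (\<lambda>x. \<Union>S\<in>Pow {..<?k x}. store_of ` (\<lambda>T. (data (?I x T), (\<lambda>_ :: nat. 0)(2 := int (Suc (?k x))), ?f x)) ` ?T x S)"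
      by simp
    show "prog (Act 2 (\<lambda>_. {0, 2}) Move_Right) (\<lambda>(a, u) N. ?M a N \<and> u < ?P a)
      (\<lambda>(a, u). store_of ` set_counter 3 u ` ?A a (Suc u)) (\<lambda>(a, u). store_of ` ?A a u)"
    proof (rule prog_conseq[OF *], intro conjI TrueI)
      fix x N assume M: "(case x of (a, u) \<Rightarrow> \<lambda>N. ?M a N \<and> u < ?P a) N"
      obtain a u where x: "x = (a, u)" by (cases x)
      show "(\<Union>S\<in>Pow {..<?k x}. store_of ` {(data (?I x S), (\<lambda>_ :: nat. 0)(2 := int (?k x)), ?f x)}) =
        (case x of (a, u) \<Rightarrow> store_of ` set_counter 3 u ` ?A a (Suc u))"
        unfolding x
        by (simp add: set_counter_def image_image UNION_singleton_eq_range fun_upd_twist[of 4 3])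
      have k: "?P a - u = Suc (?k x)" using M x by auto
      have "?A a u = (\<Union>S\<in>Pow {..<?k x}. (\<lambda>T. (data (?I x T), (\<lambda>_ :: nat. 0)(2 := int (Suc (?k x))), ?f x)) ` ?T x S)"
        unfolding k Pow_lessThan_Suc image_UN by (simp add: x)
      then show "(\<Union>S\<in>Pow {..<?k x}. store_of ` (\<lambda>T. (data (?I x T), (\<lambda>_ :: nat. 0)(2 := int (Suc (?k x))), ?f x)) ` ?T x S) =
        (case x of (a, u) \<Rightarrow> store_of ` ?A a u)"
        by (simp only: x prod.case image_UN)
    qed
  qed (auto simp: counter_def size_le_def)
  have "prog (For 4 (Act 2 (\<lambda>s. {s}) Move_Left)) (\<lambda>y N. ?P (fst y) \<le> N)
    (\<lambda>y. store_of ` {(data ((fst (fst y))\<lparr>later := snd y\<rparr>), (\<lambda>_ :: nat. 0)(2 := int (?P (fst y))), ((?e (fst y))(3 := 0))(4 := ?P (fst y)))})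
    (\<lambda>y. store_of ` {(data ((fst (fst y))\<lparr>later := snd y\<rparr>), (\<lambda>_ :: nat. 0)(2 := 0), ((?e (fst y))(3 := 0))(4 := 0))})"
    by (rule prog_rewind) simp
  from prog_UN[OF this, where M = ?M and J = "\<lambda>a. Pow {..<?P a}" and f = "\<lambda>x S. (x, S)" and b = 0]
  have 3: "prog (For 4 (Act 2 (\<lambda>s. {s}) Move_Left)) ?M (\<lambda>a. store_of ` ?A a 0)
    (\<lambda>a. \<Union>S\<in>Pow {..<?P a}. store_of ` {(data ((fst a)\<lparr>later := S\<rparr>), (\<lambda>_ :: nat. 0)(2 := 0), ((?e a)(3 := 0))(4 := 0))})"
    by (simp add: size_le_def image_image UNION_singleton_eq_range)
  have 4: "((?e a)(3 := 0))(4 := 0) = ?e a" for a :: "inst \<times> nat"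
    by (auto simp: env_of_def)
  show ?thesis
    by (rule that, rule prog_conseq[OF prog_Seq[OF 1 prog_Seq[OF 2 3]]])
      (simp add: 4 inst_store_def inst_state_def UNION_singleton_eq_range fun_upd_idem)
qed

text \<open>The outcome of the test is the same for all stores of an index, so the result is one
  family instead of a union; on the other indices a branch starts from the empty set of
  stores.\<close>

lemma prog_if:
  assumes "prog c (\<lambda>x N. M x N \<and> b x) X Y" "prog c' (\<lambda>x N. M x N \<and> \<not> b x) X Y"
    and b: "\<And>x N \<sigma>. M x N \<Longrightarrow> \<sigma> \<in> X x \<Longrightarrow> reads \<sigma> i \<in> A \<longleftrightarrow> b x"
  shows "prog (Cond i A c c') M X Y"
proof -
  have 1: "prog c M (\<lambda>x. {\<sigma> \<in> X x. reads \<sigma> i \<in> A}) (\<lambda>x. if b x then Y x else {})"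
  proof -
    obtain n where n: "\<And>x N. 2 \<le> N \<Longrightarrow> M x N \<Longrightarrow> b x \<Longrightarrow> runs c (X x) (N ^ n) (Y x)"
      using assms(1) unfolding prog_def by blast
    show ?thesis unfolding prog_def
    proof (intro exI allI impI)
      fix x N assume "2 \<le> (N :: nat)" "M x N"
      moreover have "{\<sigma> \<in> X x. reads \<sigma> i \<in> A} = (if b x then X x else {})" using b[OF \<open>M x N\<close>] by auto
      ultimately show "runs c {\<sigma> \<in> X x. reads \<sigma> i \<in> A} (N ^ n) (if b x then Y x else {})"
        using n runs_empty by simp
    qed
  qed
  have 2: "prog c' M (\<lambda>x. {\<sigma> \<in> X x. reads \<sigma> i \<notin> A}) (\<lambda>x. if b x then {} else Y x)"
  proof -
    obtain n where n: "\<And>x N. 2 \<le> N \<Longrightarrow> M x N \<Longrightarrow> \<not> b x \<Longrightarrow> runs c' (X x) (N ^ n) (Y x)"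
      using assms(2) unfolding prog_def by blast
    show ?thesis unfolding prog_def
    proof (intro exI allI impI)
      fix x N assume "2 \<le> (N :: nat)" "M x N"
      moreover have "{\<sigma> \<in> X x. reads \<sigma> i \<notin> A} = (if b x then {} else X x)" using b[OF \<open>M x N\<close>] by auto
      ultimately show "runs c' {\<sigma> \<in> X x. reads \<sigma> i \<notin> A} (N ^ n) (if b x then {} else Y x)"
        using n runs_empty by simp
    qed
  qed
  show ?thesis by (rule prog_conseq[OF prog_Cond[OF 1 2]]) auto
qed

lemma prog_put:
  assumes "i < 3" "s < 3"
  shows "prog (Act i (\<lambda>_. {s}) m) M (\<lambda>a. store_of ` {(D a, h a, e a)})
    (\<lambda>a. store_of ` {((D a)(i := (D a i)(h a i := s)), (h a)(i := move m (h a i)), e a)})"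
proof -
  have "{x \<in> {s}. x < 3} = {s}" using assms by auto
  then show ?thesis using prog_write[OF assms(1), of "\<lambda>_. {s}" m M D h e] by simp
qed

text \<open>Copying also blanks the cell of tape 2, because the next guess presupposes that
  \<open>later\<close> is empty.\<close>

abbreviation copy_bit :: com where
  "copy_bit \<equiv> Cond 2 {2} (Act 1 (\<lambda>_. {2}) Move_Right) (Act 1 (\<lambda>_. {0}) Move_Right) ;;
     Act 2 (\<lambda>_. {0}) Move_Right"

definition heads :: "nat \<Rightarrow> nat \<Rightarrow> int" where
  "heads k = (\<lambda>_. 0)(1 := int k, 2 := int k)"

lemma prog_copy_bit:
  "prog copy_bit M (\<lambda>a. store_of ` {(data (I a), heads (k a), e a)})
    (\<lambda>a. store_of ` {(data ((I a)\<lparr>now := if k a \<in> later (I a) then insert (k a) (now (I a)) else now (I a) - {k a},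
       later := later (I a) - {k a}\<rparr>), heads (Suc (k a)), e a)})"
proof -
  let ?S = "\<lambda>a. if k a \<in> later (I a) then insert (k a) (now (I a)) else now (I a) - {k a}"
  let ?h = "\<lambda>a. (heads (k a))(1 := int (Suc (k a)))"
  have h: "heads k 1 = int k" "heads k 2 = int k" for k by (simp_all add: heads_def)
  have 1: "prog (Cond 2 {2} (Act 1 (\<lambda>_. {2}) Move_Right) (Act 1 (\<lambda>_. {0}) Move_Right)) M
    (\<lambda>a. store_of ` {(data (I a), heads (k a), e a)})
    (\<lambda>a. store_of ` {(data ((I a)\<lparr>now := ?S a\<rparr>), ?h a, e a)})"
  proof (rule prog_if[where b = "\<lambda>a. k a \<in> later (I a)"])
    show "prog (Act 1 (\<lambda>_. {2}) Move_Right) (\<lambda>x N. M x N \<and> k x \<in> later (I x))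
      (\<lambda>a. store_of ` {(data (I a), heads (k a), e a)})
      (\<lambda>a. store_of ` {(data ((I a)\<lparr>now := ?S a\<rparr>), ?h a, e a)})"
      by (rule prog_conseq[OF prog_put[where M = "\<lambda>_ _. True" and D = "\<lambda>a. data (I a)" and
          h = "\<lambda>a. heads (k a)" and e = e and i = 1 and s = 2]])
        (auto simp: h[simplified] data_simps[simplified] set_tape_upd data_now[simplified] add.commute)
    show "prog (Act 1 (\<lambda>_. {0}) Move_Right) (\<lambda>x N. M x N \<and> k x \<notin> later (I x))
      (\<lambda>a. store_of ` {(data (I a), heads (k a), e a)})
      (\<lambda>a. store_of ` {(data ((I a)\<lparr>now := ?S a\<rparr>), ?h a, e a)})"
      by (rule prog_conseq[OF prog_put[where M = "\<lambda>_ _. True" and D = "\<lambda>a. data (I a)" and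
          h = "\<lambda>a. heads (k a)" and e = e and i = 1 and s = 0]])
        (auto simp: h[simplified] data_simps[simplified] set_tape_upd data_now[simplified] add.commute)
  qed (auto simp: reads_data h data_simps set_tape_def split: if_splits)
  have 2: "prog (Act 2 (\<lambda>_. {0}) Move_Right) M
    (\<lambda>a. store_of ` {(data ((I a)\<lparr>now := ?S a\<rparr>), ?h a, e a)})
    (\<lambda>a. store_of ` {(data ((I a)\<lparr>now := ?S a, later := later (I a) - {k a}\<rparr>), heads (Suc (k a)), e a)})"
  proof (rule prog_conseq[OF prog_put[where M = M and D = "\<lambda>a. data ((I a)\<lparr>now := ?S a\<rparr>)" and
      h = ?h and e = e and i = 2 and s = 0]])
    fix a N
    have "(data ((I a)\<lparr>now := ?S a\<rparr>))(2 := (data ((I a)\<lparr>now := ?S a\<rparr>) 2)(?h a 2 := 0)) =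
      data ((I a)\<lparr>now := ?S a, later := later (I a) - {k a}\<rparr>)"
      using data_later[of "(I a)\<lparr>now := ?S a\<rparr>" "later (I a) - {k a}"]
      by (simp add: heads_def data_simps set_tape_upd)
    moreover have "(?h a)(2 := move Move_Right (?h a 2)) = heads (Suc (k a))"
      by (auto simp: heads_def)
    ultimately show "M a N \<Longrightarrow> M a N \<and> store_of ` {(data ((I a)\<lparr>now := ?S a\<rparr>), ?h a, e a)} =
        store_of ` {(data ((I a)\<lparr>now := ?S a\<rparr>), ?h a, e a)} \<and>
      store_of ` {((data ((I a)\<lparr>now := ?S a\<rparr>))(2 := (data ((I a)\<lparr>now := ?S a\<rparr>) 2)(?h a 2 := 0)),
        (?h a)(2 := move Move_Right (?h a 2)), e a)} =
      store_of ` {(data ((I a)\<lparr>now := ?S a, later := later (I a) - {k a}\<rparr>), heads (Suc (k a)), e a)}"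
      by (simp only: simp_thms)
  qed simp_all
  show ?thesis by (rule prog_Seq[OF 1 2])
qed

lemma copy_set:
  obtains c where "prog c (\<lambda>a N. size_le a N \<and> now (fst a) \<subseteq> {..<bound (fst a)} \<and> later (fst a) \<subseteq> {..<bound (fst a)})
    (\<lambda>a. {inst_store (fst a) (env_of (fst a) (snd a))})
    (\<lambda>a. {inst_store ((fst a)\<lparr>now := later (fst a), later := {}\<rparr>) (env_of (fst a) (snd a))})"
proof -
  obtain c c' where c: "adder 3 (\<lambda>I e. bound I) c" "adder 4 (\<lambda>I e. bound I) c'" by (rule bound_adders)
  let ?M = "\<lambda>a N. size_le a N \<and> now (fst a) \<subseteq> {..<bound (fst a)} \<and> later (fst a) \<subseteq> {..<bound (fst a)}"
  let ?e = "\<lambda>a. env_of (fst a) (snd a)"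
  let ?P = "\<lambda>a. bound (fst a)"
  \<comment> \<open>After \<open>k\<close> cells the part of \<open>now\<close> below
    \<open>k\<close> is that of the old \<open>later\<close>, and the same part of
    \<open>later\<close> is erased.\<close>
  let ?I = "\<lambda>a k. (fst a)\<lparr>now := later (fst a) \<inter> {..<k} \<union> now (fst a) \<inter> {k..}, later := later (fst a) \<inter> {k..}\<rparr>"
  let ?A = "\<lambda>a u. {(data (?I a (?P a - u)), heads (?P a - u), (?e a)(4 := ?P a, 3 := u))}"
  have I0: "?I a 0 = fst a" for a by (cases "fst a") auto
  have IP: "?I a (?P a) = (fst a)\<lparr>now := later (fst a), later := {}\<rparr>" if "?M a N" for a N
  proof -
    have "later (fst a) \<inter> {?P a..} = {}" "now (fst a) \<inter> {?P a..} = {}"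
      "later (fst a) \<inter> {..<?P a} = later (fst a)" using that by auto
    then show ?thesis by simp
  qed
  have 1: "prog (c ;; c') ?M (\<lambda>a. {inst_store (fst a) (?e a)}) (\<lambda>a. store_of ` ?A a (?P a))"
  proof (rule prog_conseq[OF prog_load_bound[OF c, where g = "\<lambda>a. a"]], intro conjI refl)
    fix a N
    have "(?e a)(3 := ?P a, 4 := ?P a) = (?e a)(4 := ?P a, 3 := ?P a)" "heads 0 = (\<lambda>_. 0)"
      by (auto simp: heads_def)
    then show "{inst_store (fst a) ((?e a)(3 := ?P a, 4 := ?P a))} = store_of ` ?A a (?P a)"
      by (simp add: inst_store_def inst_state_def I0[simplified])
  qed simp
  have 2: "prog (For 3 copy_bit) ?M (\<lambda>a. store_of ` ?A a (?P a)) (\<lambda>a. store_of ` ?A a 0)"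
  proof (rule prog_For[where b = 1])
    let ?k = "\<lambda>x. ?P (fst x) - Suc (snd x)"
    show "prog copy_bit (\<lambda>(a, u) N. ?M a N \<and> u < ?P a)
      (\<lambda>(a, u). store_of ` set_counter 3 u ` ?A a (Suc u)) (\<lambda>(a, u). store_of ` ?A a u)"
    proof (rule prog_conseq[OF prog_copy_bit[where M = "\<lambda>_ _. True" and I = "\<lambda>x. ?I (fst x) (?k x)" and
        k = ?k and e = "\<lambda>x. (?e (fst x))(4 := ?P (fst x), 3 := snd x)"]], intro conjI TrueI)
      fix x N assume M: "(case x of (a, u) \<Rightarrow> \<lambda>N. ?M a N \<and> u < ?P a) N"
      obtain a u where x: "x = (a, u)" by (cases x)
      have k: "?P a - u = Suc (?k x)" using M x by auto
      show "store_of ` {(data (?I (fst x) (?k x)), heads (?k x), (?e (fst x))(4 := ?P (fst x), 3 := snd x))} =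
        (case x of (a, u) \<Rightarrow> store_of ` set_counter 3 u ` ?A a (Suc u))"
        by (simp add: x set_counter_def)
      have "(?I (fst x) (?k x))\<lparr>now := if ?k x \<in> later (?I (fst x) (?k x)) then insert (?k x) (now (?I (fst x) (?k x)))
           else now (?I (fst x) (?k x)) - {?k x}, later := later (?I (fst x) (?k x)) - {?k x}\<rparr> = ?I a (Suc (?k x))"
      proof -
        have "k \<in> L \<Longrightarrow> insert k (L \<inter> {..<k} \<union> S \<inter> {k..}) = L \<inter> {..<Suc k} \<union> S \<inter> {Suc k..}"
          "k \<notin> L \<Longrightarrow> L \<inter> {..<k} \<union> S \<inter> {k..} - {k} = L \<inter> {..<Suc k} \<union> S \<inter> {Suc k..}"
          "L \<inter> {k..} - {k} = L \<inter> {Suc k..}" for k :: nat and L S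
          by (auto simp: less_Suc_eq Suc_le_eq order_less_le)
        then show ?thesis unfolding x by simp
      qed
      then show "store_of ` {(data ((?I (fst x) (?k x))\<lparr>now := if ?k x \<in> later (?I (fst x) (?k x))
           then insert (?k x) (now (?I (fst x) (?k x)))
           else now (?I (fst x) (?k x)) - {?k x}, later := later (?I (fst x) (?k x)) - {?k x}\<rparr>), heads (Suc (?k x)),
          (?e (fst x))(4 := ?P (fst x), 3 := snd x))} = (case x of (a, u) \<Rightarrow> store_of ` ?A a u)"
        by (simp only: x prod.case k[unfolded x] fst_conv snd_conv)
    qed
  qed (auto simp: counter_def size_le_def)
  let ?J = "\<lambda>a. (fst a)\<lparr>now := later (fst a), later := {}\<rparr>"
  let ?B = "\<lambda>a u. {(data (?J a), heads u, (?e a)(4 := u))}"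
  have 3: "prog (For 4 (Act 1 (\<lambda>s. {s}) Move_Left ;; Act 2 (\<lambda>s. {s}) Move_Left)) ?M
    (\<lambda>a. store_of ` ?B a (?P a)) (\<lambda>a. store_of ` ?B a 0)"
  proof (rule prog_For[where b = 1])
    let ?h = "\<lambda>x. (heads (Suc (snd x)))(1 := int (snd x))"
    have h: "(heads (Suc (snd x)))(1 := move Move_Left (heads (Suc (snd x)) 1)) = ?h x"
      "(?h x)(2 := move Move_Left (?h x 2)) = heads (snd x)" for x :: "(inst \<times> nat) \<times> nat"
      by (auto simp: heads_def)
    have "prog (Act 1 (\<lambda>s. {s}) Move_Left ;; Act 2 (\<lambda>s. {s}) Move_Left) (\<lambda>x N. True)
      (\<lambda>x. store_of ` {(data (?J (fst x)), heads (Suc (snd x)), (?e (fst x))(4 := snd x))})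
      (\<lambda>x. store_of ` {(data (?J (fst x)), (?h x)(2 := move Move_Left (?h x 2)), (?e (fst x))(4 := snd x))})"
    proof (rule prog_Seq)
      show "prog (Act 1 (\<lambda>s. {s}) Move_Left) (\<lambda>x N. True)
        (\<lambda>x. store_of ` {(data (?J (fst x)), heads (Suc (snd x)), (?e (fst x))(4 := snd x))})
        (\<lambda>x. store_of ` {(data (?J (fst x)), ?h x, (?e (fst x))(4 := snd x))})"
        unfolding h(1)[symmetric] by (rule prog_shift) (simp_all add: data_less)
    qed (rule prog_shift, simp_all add: data_less)
    then show "prog (Act 1 (\<lambda>s. {s}) Move_Left ;; Act 2 (\<lambda>s. {s}) Move_Left) (\<lambda>(a, u) N. ?M a N \<and> u < ?P a)
      (\<lambda>(a, u). store_of ` set_counter 4 u ` ?B a (Suc u)) (\<lambda>(a, u). store_of ` ?B a u)"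
      unfolding h(2) by (rule prog_conseq) (auto simp: set_counter_def)
  qed (auto simp: counter_def size_le_def)
  have e: "(?e a)(4 := u, 3 := 0) = (?e a)(4 := u)" "(?e a)(4 := 0) = ?e a" "heads 0 = (\<lambda>_. 0)" for a :: "inst \<times> nat" and u
    by (auto simp: env_of_def heads_def)
  have J: "env_of (?J a) v = env_of (fst a) v" for a :: "inst \<times> nat" and v
    by (simp add: env_of_def)
  have "prog ((c ;; c') ;; For 3 copy_bit ;; For 4 (Act 1 (\<lambda>s. {s}) Move_Left ;; Act 2 (\<lambda>s. {s}) Move_Left)) ?M
     (\<lambda>a. {inst_store (fst a) (?e a)}) (\<lambda>a. store_of ` ?B a 0)"
  proof (rule prog_Seq[OF 1 prog_Seq[OF 2 prog_conseq[OF 3]]], intro conjI refl)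
    fix a N assume "?M a N"
    then show "store_of ` ?B a (?P a) = store_of ` ?A a 0"
      using IP[of a N] by (simp add: e)
  qed auto
  then show ?thesis
    by (intro that) (rule prog_conseq, assumption, simp add: inst_store_def inst_state_def e)
qed

definition set_rel :: "(inst \<Rightarrow> bool) \<Rightarrow> bool list \<Rightarrow> nat \<Rightarrow> (nat set \<times> nat set) set" where
  "set_rel \<phi> w P = {(S, T). S \<subseteq> {..<P} \<and> T \<subseteq> {..<P} \<and> \<phi> \<lparr>word = w, bound = P, now = S, later = T\<rparr>}"

lemma env_of_simps [simp]:
  "env_of (I\<lparr>now := S\<rparr>) v = env_of I v" "env_of (I\<lparr>later := S\<rparr>) v = env_of I v"
  by (simp_all add: env_of_def)

text \<open>A successor set is guessed into \<open>later\<close>, checked, and copied to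
  \<open>now\<close>. Guesses that fail the check leave no store, so exactly the successors of the
  current set remain.\<close>

lemma set_step:
  assumes "checks 2 (\<lambda>I e. \<phi> I)"
  obtains c where "prog c (\<lambda>a N. size_le a N \<and> now (fst a) \<subseteq> {..<bound (fst a)} \<and> later (fst a) = {})
    (\<lambda>a. {inst_store (fst a) (env_of (fst a) (snd a))})
    (\<lambda>a. (\<lambda>S. inst_store ((fst a)\<lparr>now := S\<rparr>) (env_of (fst a) (snd a))) `
      {S. S \<subseteq> {..<bound (fst a)} \<and> \<phi> ((fst a)\<lparr>later := S\<rparr>)})"
proof -
  let ?M = "\<lambda>a N. size_le a N \<and> now (fst a) \<subseteq> {..<bound (fst a)} \<and> later (fst a) = {}"
  let ?e = "\<lambda>a. env_of (fst a) (snd a)"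
  let ?P = "\<lambda>a. bound (fst a)"
  obtain g where "prog g (\<lambda>a N. size_le a N \<and> later (fst a) = {}) (\<lambda>a. {inst_store (fst a) (?e a)})
    (\<lambda>a. (\<lambda>S. inst_store ((fst a)\<lparr>later := S\<rparr>) (?e a)) ` Pow {..<?P a})"
    by (rule guess_set)
  then have 1: "prog g ?M (\<lambda>a. {inst_store (fst a) (?e a)})
    (\<lambda>a. (\<lambda>S. inst_store ((fst a)\<lparr>later := S\<rparr>) (?e a)) ` Pow {..<?P a})"
    by (rule prog_conseq) auto
  obtain c where "checker 3 (\<lambda>I e. \<phi> I) c" by (rule checksD[OF assms, of 3]) auto
  then have c: "prog c (adm 3) (\<lambda>a. {inst_store (fst a) (snd a)})
    (\<lambda>a. inst_store (fst a) ` {e. e = snd a \<and> \<phi> (fst a)})"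
    unfolding checker_def transforms_def by simp
  have adm: "adm 3 ((fst a)\<lparr>later := S\<rparr>, ?e a) N" if "?M a N" for a :: "inst \<times> nat" and S N
    using adm_env_of[of "(fst a)\<lparr>later := S\<rparr>" "snd a" N] that by (simp add: size_le_def)
  have "prog c ?M (\<lambda>a. \<Union>S\<in>Pow {..<?P a}. (\<lambda>a. {inst_store (fst a) (snd a)}) ((fst a)\<lparr>later := S\<rparr>, ?e a))
     (\<lambda>a. \<Union>S\<in>Pow {..<?P a}. (\<lambda>a. inst_store (fst a) ` {e. e = snd a \<and> \<phi> (fst a)}) ((fst a)\<lparr>later := S\<rparr>, ?e a))"
    by (rule prog_UN[OF c, where b = 0]) (use adm in simp)
  then have 2: "prog c ?M (\<lambda>a. (\<lambda>S. inst_store ((fst a)\<lparr>later := S\<rparr>) (?e a)) ` Pow {..<?P a})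
     (\<lambda>a. (\<lambda>S. inst_store ((fst a)\<lparr>later := S\<rparr>) (?e a)) ` {S. S \<subseteq> {..<?P a} \<and> \<phi> ((fst a)\<lparr>later := S\<rparr>)})"
    by (rule prog_conseq) (intro conjI; auto)
  obtain k where "prog k (\<lambda>a N. size_le a N \<and> now (fst a) \<subseteq> {..<?P a} \<and> later (fst a) \<subseteq> {..<?P a})
    (\<lambda>a. {inst_store (fst a) (?e a)}) (\<lambda>a. {inst_store ((fst a)\<lparr>now := later (fst a), later := {}\<rparr>) (?e a)})"
    by (rule copy_set)
  from prog_UN[OF this, where M = ?M and J = "\<lambda>a. {S. S \<subseteq> {..<?P a} \<and> \<phi> ((fst a)\<lparr>later := S\<rparr>)}" and
      f = "\<lambda>a S. ((fst a)\<lparr>later := S\<rparr>, snd a)" and b = 0]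
  have "prog k ?M (\<lambda>a. \<Union>S\<in>{S. S \<subseteq> {..<?P a} \<and> \<phi> ((fst a)\<lparr>later := S\<rparr>)}. {inst_store ((fst a)\<lparr>later := S\<rparr>) (?e a)})
     (\<lambda>a. \<Union>S\<in>{S. S \<subseteq> {..<?P a} \<and> \<phi> ((fst a)\<lparr>later := S\<rparr>)}. {inst_store ((fst a)\<lparr>now := S, later := {}\<rparr>) (?e a)})"
    by (simp add: size_le_def)
  then have 3: "prog k ?M (\<lambda>a. (\<lambda>S. inst_store ((fst a)\<lparr>later := S\<rparr>) (?e a)) ` {S. S \<subseteq> {..<?P a} \<and> \<phi> ((fst a)\<lparr>later := S\<rparr>)})
     (\<lambda>a. (\<lambda>S. inst_store ((fst a)\<lparr>now := S\<rparr>) (?e a)) ` {S. S \<subseteq> {..<?P a} \<and> \<phi> ((fst a)\<lparr>later := S\<rparr>)})"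
  proof (rule prog_conseq)
    fix a :: "inst \<times> nat" and N assume "?M a N"
    then have eq: "(fst a)\<lparr>now := S, later := {}\<rparr> = (fst a)\<lparr>now := S\<rparr>" for S by (cases "fst a") auto
    from \<open>?M a N\<close> show "?M a N \<and> (\<Union>S\<in>{S. S \<subseteq> {..<?P a} \<and> \<phi> ((fst a)\<lparr>later := S\<rparr>)}. {inst_store ((fst a)\<lparr>later := S\<rparr>) (?e a)}) =
      (\<lambda>S. inst_store ((fst a)\<lparr>later := S\<rparr>) (?e a)) ` {S. S \<subseteq> {..<?P a} \<and> \<phi> ((fst a)\<lparr>later := S\<rparr>)} \<and>
      (\<Union>S\<in>{S. S \<subseteq> {..<?P a} \<and> \<phi> ((fst a)\<lparr>later := S\<rparr>)}. {inst_store ((fst a)\<lparr>now := S, later := {}\<rparr>) (?e a)}) =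
      (\<lambda>S. inst_store ((fst a)\<lparr>now := S\<rparr>) (?e a)) ` {S. S \<subseteq> {..<?P a} \<and> \<phi> ((fst a)\<lparr>later := S\<rparr>)}"
      by (simp only: eq UNION_singleton_eq_range simp_thms)
  qed
  show ?thesis by (rule that, rule prog_Seq[OF 1 prog_Seq[OF 2 3]])
qed

definition inst_of :: "(nat \<Rightarrow> nat) \<Rightarrow> bool list \<Rightarrow> nat set \<Rightarrow> inst" where
  "inst_of p w S = \<lparr>word = w, bound = p (length w), now = S, later = {}\<rparr>"

definition reach :: "(inst \<Rightarrow> bool) \<Rightarrow> (nat \<Rightarrow> nat) \<Rightarrow> bool list \<Rightarrow> nat \<Rightarrow> nat set set" where
  "reach \<phi> p w k = {S. \<exists>j\<le>k. ({}, S) \<in> set_rel \<phi> w (p (length w)) ^^ j}"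

text \<open>The steps of a path are counted in a unary counter, whose exponential value is part of
  the data; running times that are polynomial in \<open>N\<close> are then exponential in the
  input.\<close>

definition exp_size :: "(nat \<Rightarrow> nat) \<Rightarrow> bool list \<Rightarrow> nat \<Rightarrow> bool" where
  "exp_size p w N \<longleftrightarrow> length w \<le> N \<and> p (length w) \<le> N \<and> 4 ^ p (length w) \<le> N"

lemma reach_0: "reach \<phi> p w 0 = {{}}"
  by (auto simp: reach_def)

lemma reach_Suc: "reach \<phi> p w (Suc k) = reach \<phi> p w k \<union>
  (\<Union>S\<in>reach \<phi> p w k. {T. (S, T) \<in> set_rel \<phi> w (p (length w))})"
proof -
  let ?R = "set_rel \<phi> w (p (length w))"
  have "(\<exists>j\<le>Suc k. ({}, T) \<in> ?R ^^ j) \<longleftrightarrow> (\<exists>j\<le>k. ({}, T) \<in> ?R ^^ j) \<or>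
      (\<exists>j\<le>k. ({}, T) \<in> ?R ^^ Suc j)" for T
  proof
    assume "\<exists>j\<le>Suc k. ({}, T) \<in> ?R ^^ j"
    then obtain j where "j \<le> Suc k" "({}, T) \<in> ?R ^^ j" by blast
    then show "(\<exists>j\<le>k. ({}, T) \<in> ?R ^^ j) \<or> (\<exists>j\<le>k. ({}, T) \<in> ?R ^^ Suc j)"
      by (cases j) (blast, meson Suc_le_mono)
  qed (meson Suc_le_mono le_SucI)
  then show ?thesis by (auto simp: reach_def)
qed

lemma reach_subset: "S \<in> reach \<phi> p w k \<Longrightarrow> S \<subseteq> {..<p (length w)}"
  by (induction k) (auto simp: reach_0 reach_Suc set_rel_def)

text \<open>Counter 2 starts at the number of permitted steps, and \<open>Choice Skip\<close> lets a
  round pass without a step, so the sets obtained are those reachable in at most that many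
  steps.\<close>

lemma main_loop:
  assumes "checks 2 (\<lambda>I e. \<phi> I)"
  obtains c where "prog c (exp_size p)
    (\<lambda>w. {inst_store (inst_of p w {}) (env_of (inst_of p w {}) (4 ^ p (length w)))})
    (\<lambda>w. (\<lambda>S. inst_store (inst_of p w S) (env_of (inst_of p w {}) 0)) `
      {S \<in> reach \<phi> p w (4 ^ p (length w)). 0 \<in> S})"
proof -
  let ?M = "exp_size p"
  let ?n = "\<lambda>w :: bool list. (4 :: nat) ^ p (length w)"
  let ?st = "\<lambda>w u S. inst_state (inst_of p w S) (env_of (inst_of p w {}) u)"
  let ?A = "\<lambda>w u. ?st w u ` reach \<phi> p w (?n w - u)"
  obtain c where c: "prog c (\<lambda>a N. size_le a N \<and> now (fst a) \<subseteq> {..<bound (fst a)} \<and> later (fst a) = {})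
    (\<lambda>a. {inst_store (fst a) (env_of (fst a) (snd a))})
    (\<lambda>a. (\<lambda>S. inst_store ((fst a)\<lparr>now := S\<rparr>) (env_of (fst a) (snd a))) `
      {S. S \<subseteq> {..<bound (fst a)} \<and> \<phi> ((fst a)\<lparr>later := S\<rparr>)})"
    by (rule set_step[OF assms])
  have env: "env_of (inst_of p w S) u = (\<lambda>_. 0)(0 := length w, 1 := p (length w), 2 := u)" for w S u
    by (simp add: env_of_def inst_of_def)
  have 1: "prog (For 2 (Choice Skip c)) ?M (\<lambda>w. store_of ` ?A w (?n w)) (\<lambda>w. store_of ` ?A w 0)"
  proof (rule prog_For[where b = 1])
    let ?X = "\<lambda>x. \<Union>S\<in>reach \<phi> p (fst x) (?n (fst x) - Suc (snd x)).
      (\<lambda>a. {inst_store (fst a) (env_of (fst a) (snd a))}) (inst_of p (fst x) S, snd x)"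
    let ?Y = "\<lambda>x. \<Union>S\<in>reach \<phi> p (fst x) (?n (fst x) - Suc (snd x)).
      (\<lambda>a. (\<lambda>S. inst_store ((fst a)\<lparr>now := S\<rparr>) (env_of (fst a) (snd a))) `
      {S. S \<subseteq> {..<bound (fst a)} \<and> \<phi> ((fst a)\<lparr>later := S\<rparr>)}) (inst_of p (fst x) S, snd x)"
    have "prog c (\<lambda>x N. ?M (fst x) N \<and> snd x < ?n (fst x)) ?X ?Y"
    proof (rule prog_UN[OF c, where b = 0])
      fix x N S assume "?M (fst x) N \<and> snd x < ?n (fst x)" "S \<in> reach \<phi> p (fst x) (?n (fst x) - Suc (snd x))"
      then show "size_le (inst_of p (fst x) S, snd x) (N ^ Suc 0) \<and>
          now (fst (inst_of p (fst x) S, snd x)) \<subseteq> {..<bound (fst (inst_of p (fst x) S, snd x))} \<and>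
          later (fst (inst_of p (fst x) S, snd x)) = {}"
        using reach_subset by (fastforce simp: size_le_def exp_size_def inst_of_def)
    qed
    from prog_Choice[OF prog_Skip this]
    show "prog (Choice Skip c) (\<lambda>(w, u) N. ?M w N \<and> u < ?n w)
      (\<lambda>(w, u). store_of ` set_counter 2 u ` ?A w (Suc u)) (\<lambda>(w, u). store_of ` ?A w u)"
    proof (rule prog_conseq, intro conjI)
      fix x N assume M: "(case x of (w, u) \<Rightarrow> \<lambda>N. ?M w N \<and> u < ?n w) N"
      obtain w u where x: "x = (w, u)" by (cases x)
      show "?M (fst x) N" "snd x < ?n (fst x)" using M x by auto
      then have k: "?n w - u = Suc (?n w - Suc u)" using x by auto
      have "set_counter 2 u (?st w (Suc u) S) = ?st w u S" for S
        by (auto simp: set_counter_def inst_state_def env_of_def)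
      then have X: "store_of ` set_counter 2 u ` ?A w (Suc u) = ?X x"
        by (simp add: image_image inst_store_def x env UNION_singleton_eq_range)
      then show "?X x = (case x of (w, u) \<Rightarrow> store_of ` set_counter 2 u ` ?A w (Suc u))"
        by (simp add: x)
      have now: "(inst_of p w S)\<lparr>now := T\<rparr> = inst_of p w T"
        "(inst_of p w S)\<lparr>later := T\<rparr> = \<lparr>word = w, bound = p (length w), now = S, later = T\<rparr>" for S T
        by (simp_all add: inst_of_def)
      have "store_of ` ?A w u = (\<lambda>S. inst_store (inst_of p w S) (env_of (inst_of p w {}) u)) `
          reach \<phi> p w (?n w - u)"
        by (simp add: image_image inst_store_def)
      also have "\<dots> = ?X x \<union> ?Y x"
        unfolding k reach_Suc image_Un image_UN
      proof (rule arg_cong2[where f = union])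
        show "(\<Union>S\<in>reach \<phi> p w (?n w - Suc u). (\<lambda>S. inst_store (inst_of p w S) (env_of (inst_of p w {}) u)) `
            {T. (S, T) \<in> set_rel \<phi> w (p (length w))}) = ?Y x"
        proof (rule SUP_cong)
          fix S assume "S \<in> reach \<phi> p (fst x) (?n (fst x) - Suc (snd x))"
          then have "S \<subseteq> {..<p (length w)}" unfolding x fst_conv by (rule reach_subset)
          then have "{T. (S, T) \<in> set_rel \<phi> w (p (length w))} =
            {T. T \<subseteq> {..<bound (inst_of p w S)} \<and> \<phi> ((inst_of p w S)\<lparr>later := T\<rparr>)}"
            by (auto simp: set_rel_def inst_of_def)
          then show "(\<lambda>S. inst_store (inst_of p w S) (env_of (inst_of p w {}) u)) `
            {T. (S, T) \<in> set_rel \<phi> w (p (length w))} =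
            (\<lambda>a. (\<lambda>S. inst_store ((fst a)\<lparr>now := S\<rparr>) (env_of (fst a) (snd a))) `
            {S. S \<subseteq> {..<bound (fst a)} \<and> \<phi> ((fst a)\<lparr>later := S\<rparr>)}) (inst_of p (fst x) S, snd x)"
            by (simp add: x env now(1))
        qed (simp add: x)
      qed (simp add: x env UNION_singleton_eq_range)
      finally show "?X x \<union> ?Y x = (case x of (w, u) \<Rightarrow> store_of ` ?A w u)" by (simp add: x)
    qed
  qed (auto simp: counter_def inst_state_def env_of_def exp_size_def)
  \<comment> \<open>The head of tape 1 rests on cell 0, so the symbol read tells whether the final
    set contains the acceptance flag 0.\<close>
  have 2: "prog (Cond 1 {2} Skip Fail) ?M (\<lambda>w. store_of ` ?A w 0)
    (\<lambda>w. {\<sigma> \<in> store_of ` ?A w 0. reads \<sigma> 1 \<in> {2}} \<union> {})"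
    by (rule prog_Cond[OF prog_Skip prog_Fail])
  have "reads (store_of (?st w u S)) 1 = 2 \<longleftrightarrow> 0 \<in> S" for w u S
    by (simp add: inst_state_def reads_data data_def set_tape_def inst_of_def)
  then have 3: "{\<sigma> \<in> store_of ` ?A w 0. reads \<sigma> 1 \<in> {2}} \<union> {} =
    (\<lambda>S. inst_store (inst_of p w S) (env_of (inst_of p w {}) 0)) ` {S \<in> reach \<phi> p w (?n w). 0 \<in> S}" for w
    by (auto simp: inst_store_def)
  have 4: "store_of ` ?A w (?n w) = {inst_store (inst_of p w {}) (env_of (inst_of p w {}) (?n w))}" for w
    by (simp add: reach_0 inst_store_def)
  show ?thesis
    by (rule that) (use prog_Seq[OF 1 2] in \<open>simp only: 3 4\<close>)
qed

section \<open>Initialisation: marks of the counters, input length, polynomial bound, exponential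
  number of rounds\<close>

primrec mark :: "nat \<Rightarrow> com" where
  "mark 0 = Skip"
| "mark (Suc r) = mark r ;; Act (r + 3) (\<lambda>_. {1}) Stay"

text \<open>The machine starts with blank tapes, while a counter has a mark at its origin. The first
  \<open>r\<close> of \<open>k\<close> counters have been marked. Beyond these \<open>k\<close>
  counters the store has no tape of the machine behind it and carries the marks beforehand, so that
  at \<open>r = k\<close> it has the form \<open>store_of\<close>.\<close>

definition marked :: "(nat \<Rightarrow> int \<Rightarrow> nat) \<Rightarrow> nat \<Rightarrow> nat \<Rightarrow> store" where
  "marked D k r = (\<lambda>i. if i < 3 then (D i, 0) else if r + 3 \<le> i \<and> i < k + 3 then (\<lambda>_. 0, 0)
     else counter_tape 0)"

lemma uses_mark: "uses (mark r) \<subseteq> {..<r + 3}"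
  by (induction r) auto

lemma runs_mark: "r \<le> k \<Longrightarrow> runs (mark r) {marked D k 0} (2 * r) {marked D k r}"
proof (induction r)
  case 0
  show ?case by (simp add: runs_Skip)
next
  case (Suc r)
  have "(marked D k r)(r + 3 := act_tape (1, Stay) (marked D k r (r + 3))) = marked D k (Suc r)"
    using Suc.prems by (auto simp: fun_eq_iff counter_tape_def marked_def)
  moreover have "{s \<in> {1 :: nat}. s < 3} = {1}" by auto
  ultimately have "runs (Act (r + 3) (\<lambda>_. {1}) Stay) {marked D k r} (Suc 0) {marked D k (Suc r)}"
    using runs_Act[of "r + 3" "\<lambda>_. {1}" Stay "marked D k r"] by simp
  from runs_Seq[OF Suc.IH this] show ?case using Suc.prems by simp
qed

lemma marked_all: "marked D k k = store_of (D, \<lambda>_. 0, \<lambda>_. 0)"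
  by (auto simp: marked_def store_of.simps)

abbreviation input_inst :: "bool list \<Rightarrow> inst" where
  "input_inst w \<equiv> \<lparr>word = w, bound = 0, now = {}, later = {}\<rparr>"

lemma data_input: "data (input_inst w) 0 p = (if 0 \<le> p \<and> p < int (length w) then if w ! nat p then 2 else 1 else 0)"
  by (simp add: data_def input_tape_def)

lemma runs_shift:
  assumes i: "i < 3" and D: "D i (h i) < 3"
  shows "runs (Act i (\<lambda>s. {s}) m) {store_of (D, h, e)} (Suc 0) {store_of (D, h(i := move m (h i)), e)}"
proof -
  have "{s \<in> {D i (h i)}. s < 3} = {D i (h i)}" using D by auto
  then show ?thesis using runs_data[OF i, of "\<lambda>s. {s}" m D h e] by simp
qed

text \<open>The letters of the input are 1 and 2, so its end is the first blank. The return of the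
  head drains counter 0; the length is collected in counter 1 meanwhile and moved to counter 0 at
  the end.\<close>

lemma measure_input:
  obtains c where "prog c (\<lambda>w N. length w \<le> N) (\<lambda>w. {inst_store (input_inst w) (\<lambda>_. 0)})
    (\<lambda>w. {inst_store (input_inst w) ((\<lambda>_. 0)(0 := length w))})"
proof -
  let ?M = "\<lambda>w N. length (w :: bool list) \<le> N"
  let ?c = "Act 0 (\<lambda>s. {s}) Move_Right ;; Incr 0"
  let ?s = "\<lambda>w v. (data (input_inst w), (\<lambda>_. 0)(0 := int v), (\<lambda>_. 0)(0 := v))"
  have step: "runs ?c {store_of (?s w v)} (Suc (1 + 1)) {store_of (?s w (Suc v))}" for w v
  proof -
    have "runs (Act 0 (\<lambda>s. {s}) Move_Right) {store_of (?s w v)} 1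
      {store_of (data (input_inst w), (\<lambda>_. 0)(0 := int (Suc v)), (\<lambda>_. 0)(0 := v))}"
      using runs_shift[of 0 "data (input_inst w)" "(\<lambda>_. 0)(0 := int v)" Move_Right "(\<lambda>_. 0)(0 := v)"]
      by (simp add: data_less add.commute)
    moreover have "runs (Incr 0) {store_of (data (input_inst w), (\<lambda>_. 0)(0 := int (Suc v)), (\<lambda>_. 0)(0 := v))} 1
      {store_of (?s w (Suc v))}"
      using runs_Incr[of 0 "data (input_inst w)" "(\<lambda>_. 0)(0 := int (Suc v))" "(\<lambda>_. 0)(0 := v)"] by simp
    ultimately show ?thesis by (rule runs_Seq)
  qed
  have loop: "runs (Loop 0 {1, 2} ?c) {store_of (?s w (length w - k))} (5 * k + 1) {store_of (?s w (length w))}"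
    if "k \<le> length w" for w k
    using that
  proof (induction k)
    case 0
    have "runs (Loop 0 {1, 2} ?c) {store_of (?s w (length w))} (Suc 0) {store_of (?s w (length w))}"
      by (rule runs_Loop_exit) (auto simp: reads_data data_input)
    then show ?case unfolding diff_zero by (rule runs_mono) simp
  next
    case (Suc k)
    have "length w - k = Suc (length w - Suc k)" using Suc.prems by simp
    then have body: "runs ?c {store_of (?s w (length w - Suc k))} (Suc (1 + 1)) {store_of (?s w (length w - k))}"
      using step[of w "length w - Suc k"] by (simp only:)
    have rd: "reads \<sigma> 0 \<in> {1, 2}" if "\<sigma> \<in> {store_of (?s w (length w - Suc k))}" for \<sigma>
      using that Suc.prems by (auto simp: reads_data data_input)
    have "runs (Loop 0 {1, 2} ?c) {store_of (?s w (length w - Suc k))}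
      (Suc (Suc (Suc (1 + 1) + (5 * k + 1)))) {store_of (?s w (length w))}"
      by (rule runs_Loop_enter[OF rd body Suc.IH[OF Suc_leD[OF Suc.prems]]])
    then show ?case by (rule runs_mono) simp
  qed
  have 1: "prog (Loop 0 {1, 2} ?c) ?M (\<lambda>w. {inst_store (input_inst w) (\<lambda>_. 0)}) (\<lambda>w. {store_of (?s w (length w))})"
    unfolding prog_def
  proof (intro exI allI impI)
    fix w :: "bool list" and N assume N: "2 \<le> (N :: nat)" "length w \<le> N"
    have "8 \<le> N ^ 3" using power_mono[OF N(1), of 3] by simp
    then have "5 * length w \<le> N ^ (3 + 1)" using le_pow_mult[of 5 N 3 "length w" 1] N by simp
    then have "5 * length w + 1 \<le> N ^ (3 + 1 + 1)" using pow_Suc_le[OF N(1), of "3 + 1"] by simp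
    moreover have "runs (Loop 0 {1, 2} ?c) {inst_store (input_inst w) (\<lambda>_. 0)} (5 * length w + 1) {store_of (?s w (length w))}"
      using loop[of "length w" w] by (simp add: inst_store_def inst_state_def fun_upd_idem)
    ultimately show "runs (Loop 0 {1, 2} ?c) {inst_store (input_inst w) (\<lambda>_. 0)} (N ^ (3 + 1 + 1)) {store_of (?s w (length w))}"
      by (rule runs_mono[rotated])
  qed
  let ?A = "\<lambda>w u. {(data (input_inst w), (\<lambda>_. 0)(0 := int u), (\<lambda>_. 0)(0 := u, 1 := length w - u))}"
  have 2: "prog (For 0 (Incr 1 ;; Act 0 (\<lambda>s. {s}) Move_Left)) ?M (\<lambda>w. store_of ` ?A w (length w)) (\<lambda>w. store_of ` ?A w 0)"
  proof (rule prog_For[where b = 1])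
    show "prog (Incr 1 ;; Act 0 (\<lambda>s. {s}) Move_Left) (\<lambda>(w :: bool list, u) N. length w \<le> N \<and> u < length w)
      (\<lambda>(w, u). store_of ` set_counter 0 u ` ?A w (Suc u)) (\<lambda>(w, u). store_of ` ?A w u)"
    proof (rule progI_const)
      fix x N assume *: "(case x of (w :: bool list, u) \<Rightarrow> \<lambda>N. length w \<le> N \<and> u < length w) (N :: nat)"
      obtain w u where x: "x = (w, u)" by (cases x)
      let ?e = "(\<lambda>_. 0)(0 := u, 1 := length w - Suc u) :: nat \<Rightarrow> nat"
      have "runs (Incr 1) {store_of (data (input_inst w), (\<lambda>_. 0)(0 := int (Suc u)), ?e)} (Suc 0)
        {store_of (data (input_inst w), (\<lambda>_. 0)(0 := int (Suc u)), ?e(1 := Suc (?e 1)))}"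
        by (rule runs_Incr)
      moreover have "?e(1 := Suc (?e 1)) = (\<lambda>_. 0)(0 := u, 1 := length w - u)"
        using * x by (auto simp: Suc_diff_Suc)
      ultimately have 1: "runs (Incr 1) {store_of (data (input_inst w), (\<lambda>_. 0)(0 := int (Suc u)), ?e)} 1
        {store_of (data (input_inst w), (\<lambda>_. 0)(0 := int (Suc u)), (\<lambda>_. 0)(0 := u, 1 := length w - u))}"
        by (simp only: One_nat_def)
      have 2: "runs (Act 0 (\<lambda>s. {s}) Move_Left)
        {store_of (data (input_inst w), (\<lambda>_. 0)(0 := int (Suc u)), (\<lambda>_. 0)(0 := u, 1 := length w - u))} 1
        {store_of (data (input_inst w), (\<lambda>_. 0)(0 := int u), (\<lambda>_. 0)(0 := u, 1 := length w - u))}"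
        using runs_shift[of 0 "data (input_inst w)" "(\<lambda>_. 0)(0 := int (Suc u))" Move_Left
            "(\<lambda>_. 0)(0 := u, 1 := length w - u)"] by (simp add: data_less)
      have "(\<lambda>_. 0)(0 := Suc u, 1 := length w - Suc u, 0 := u) = ?e" by auto
      then show "runs (Incr 1 ;; Act 0 (\<lambda>s. {s}) Move_Left)
        (case x of (w, u) \<Rightarrow> store_of ` set_counter 0 u ` ?A w (Suc u)) (Suc (1 + 1))
        (case x of (w, u) \<Rightarrow> store_of ` ?A w u)"
        using runs_Seq[OF 1 2] by (simp add: x set_counter_def)
    qed
  qed (auto simp: counter_def)
  have 3: "transforms (For 1 (Incr 0)) ?M input_inst (\<lambda>w. {(\<lambda>_. 0)(1 := length w)}) (\<lambda>w. {(\<lambda>_. 0)(0 := length w)})"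
    by (rule transforms_move[where b = 1]) (auto simp: fun_eq_iff)
  have 12: "store_of ` ?A w (length w) = {store_of (?s w (length w))}"
    "store_of ` ?A w 0 = inst_store (input_inst w) ` {(\<lambda>_. 0)(1 := length w)}" for w
    by (auto simp: inst_store_def inst_state_def fun_upd_idem)
  show ?thesis
    by (rule that, rule prog_conseq[OF prog_Seq[OF 1 prog_Seq[OF 2[unfolded 12] 3[unfolded transforms_def]]]])
      auto
qed

text \<open>Horner's scheme, by induction on the list of coefficients.\<close>

lemma computes_poly: "2 \<le> d \<Longrightarrow> computes d (\<lambda>I e. poly q (length (word I)))"
proof (induction q)
  case 0
  then show ?case by (simp add: computes_zero)
next
  case (pCons a q)
  then show ?case by (simp add: computes_add computes_const computes_mult computes_length)
qed

text \<open>An adder works on a register above counters 0 and 1, so the polynomial is evaluated in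
  counter 2 and then moved to counter 1. Until then counter 1 is 0, which is why
  \<open>input_inst\<close> has bound 0.\<close>

lemma load_poly:
  obtains c where "prog c (\<lambda>w N. length w \<le> N) (\<lambda>w. {inst_store (input_inst w) ((\<lambda>_. 0)(0 := length w))})
    (\<lambda>w. {inst_store (inst_of (poly q) w {}) (env_of (inst_of (poly q) w {}) 0)})"
proof -
  let ?M = "\<lambda>w N. length (w :: bool list) \<le> N"
  have p: "computes 2 (\<lambda>I e. poly q (length (word I)))" by (rule computes_poly) simp
  obtain c where c: "adder 2 (\<lambda>I e. poly q (length (word I))) c" by (rule computes_adder[OF p order_refl])
  obtain b where b: "\<And>I e N. 2 \<le> N \<Longrightarrow> bnd I 2 e N \<Longrightarrow> poly q (length (word I)) \<le> N ^ b"
    by (rule computes_pow[OF p]) blast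
  have 1: "transforms c ?M input_inst (\<lambda>w. {(\<lambda>_. 0)(0 := length w)})
    (\<lambda>w. {(\<lambda>_. 0)(0 := length w, 2 := poly q (length w))})"
    by (rule transforms_adder[OF c, where b = 0 and d = 2]) (auto simp: below_def adm_def bnd_def)
  have 2: "transforms (For 2 (Incr 1)) ?M input_inst (\<lambda>w. {(\<lambda>_. 0)(0 := length w, 2 := poly q (length w))})
    (\<lambda>w. {env_of (inst_of (poly q) w {}) 0})"
  proof (rule transforms_move[where b = b])
    fix w :: "bool list" and N e assume "2 \<le> (N :: nat)" "length w \<le> N"
      "e \<in> {(\<lambda>_. 0)(0 := length w, 2 := poly q (length w))}"
    moreover have "bnd (input_inst w) 2 ((\<lambda>_. 0)(0 := length w)) N"
      using \<open>length w \<le> N\<close> by (auto simp: bnd_def)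
    ultimately show "e 2 \<le> N ^ b" using b by fastforce
  qed (auto simp: env_of_def inst_of_def fun_eq_iff)
  have "inst_store (input_inst w) e = inst_store (inst_of (poly q) w {}) e" for w e
  proof -
    have "data (input_inst w) = data (inst_of (poly q) w {})" by (auto simp: data_def inst_of_def fun_eq_iff)
    then show ?thesis by (simp add: inst_store_def inst_state_def)
  qed
  then show ?thesis using transforms_Seq[OF 1 2] by (intro that) (simp add: transforms_def)
qed

text \<open>The value is exponential in the bound and hence out of reach for computable terms.
  Counter 2, initially 1, is multiplied by 4 once for each unit of the bound, with counter 4
  receiving four units for each one taken from counter 2.\<close>

lemma load_fuel:
  obtains c where "prog c (exp_size p) (\<lambda>w. {inst_store (inst_of p w {}) (env_of (inst_of p w {}) 0)})
    (\<lambda>w. {inst_store (inst_of p w {}) (env_of (inst_of p w {}) (4 ^ p (length w)))})"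
proof -
  let ?M = "exp_size p"
  let ?I = "\<lambda>w. inst_of p w {}"
  let ?P = "\<lambda>w. p (length (w :: bool list))"
  let ?e = "\<lambda>w v. env_of (?I w) v"
  obtain c where c: "adder 3 (\<lambda>I e. bound I) c"
    by (rule computes_adder[OF computes_bound, of 2 3]) auto
  have 1: "transforms (Incr 2) ?M ?I (\<lambda>w. {?e w 0}) (\<lambda>w. {?e w 1})"
    by (rule transforms_Incr') (auto simp: env_of_def)
  let ?E = "\<lambda>w u. {(?e w (4 ^ (?P w - u)))(3 := u)}"
  have 2: "transforms c ?M ?I (\<lambda>w. {?e w 1}) (\<lambda>w. ?E w (?P w))"
  proof (rule transforms_adder[OF c, where b = 0 and d = 2])
    fix w N e assume "2 \<le> (N :: nat)" "?M w N" "e \<in> {?e w 1}"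
    then show "adm (Suc 3) (?I w, e) (N ^ Suc 0)"
      using adm_env_of[of "?I w" 1 N] adm_Suc[of 3] by (auto simp: size_le_def exp_size_def inst_of_def)
  qed (auto simp: below_def env_of_def inst_of_def)
  let ?Q = "Incr 4 ;; Incr 4 ;; Incr 4 ;; Incr 4"
  have 3: "transforms (For 3 (For 2 ?Q ;; For 4 (Incr 2))) ?M ?I (\<lambda>w. ?E w (?P w)) (\<lambda>w. {?e w (4 ^ ?P w)})"
  proof (rule transforms_For[where b = 1 and E = ?E and n = ?P])
    let ?N = "\<lambda>x N. ?M (fst x) N \<and> snd x < ?P (fst x)"
    let ?V = "\<lambda>x. (4::nat) ^ (?P (fst x) - Suc (snd x))"
    have V: "4 * ?V x = 4 ^ (?P (fst x) - snd x)" "4 * ?V x \<le> N" "?V x \<le> N" if "?N x N" for x N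
    proof -
      have "?P (fst x) - snd x = Suc (?P (fst x) - Suc (snd x))" using that by auto
      then show *: "4 * ?V x = 4 ^ (?P (fst x) - snd x)" by simp
      also have "\<dots> \<le> 4 ^ ?P (fst x)" by (rule power_increasing) auto
      finally show "4 * ?V x \<le> N" using that by (simp add: exp_size_def)
      then show "?V x \<le> N" by linarith
    qed
    show "transforms (For 2 ?Q ;; For 4 (Incr 2)) ?N (\<lambda>x. ?I (fst x))
      (\<lambda>x. (\<lambda>e. e(3 := snd x)) ` ?E (fst x) (Suc (snd x))) (\<lambda>x. ?E (fst x) (snd x))"
    proof (rule transforms_Seq)
      let ?F = "\<lambda>x v. {(?e (fst x) v)(3 := snd x, 4 := 4 * (?V x - v))}"
      show "transforms (For 2 ?Q) ?N (\<lambda>x. ?I (fst x)) (\<lambda>x. (\<lambda>e. e(3 := snd x)) ` ?E (fst x) (Suc (snd x)))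
        (\<lambda>x. ?F x 0)"
      proof (rule transforms_For[where b = 1 and E = ?F and n = ?V])
        have "transforms ?Q (\<lambda>y N. ?N (fst y) N \<and> snd y < ?V (fst y)) (\<lambda>y. ?I (fst (fst y)))
          (\<lambda>y. (\<lambda>e. e(2 := snd y)) ` ?F (fst y) (Suc (snd y)))
          (\<lambda>y. (\<lambda>e. e(4 := Suc (e 4))) ` (\<lambda>e. e(4 := Suc (e 4))) ` (\<lambda>e. e(4 := Suc (e 4))) `
            (\<lambda>e. e(4 := Suc (e 4))) ` (\<lambda>e. e(2 := snd y)) ` ?F (fst y) (Suc (snd y)))"
          by (rule transforms_Seq[OF transforms_Incr transforms_Seq[OF transforms_Incr
                transforms_Seq[OF transforms_Incr transforms_Incr]]])
        then show "transforms ?Q (\<lambda>y N. ?N (fst y) N \<and> snd y < ?V (fst y)) (\<lambda>y. ?I (fst (fst y)))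
          (\<lambda>y. (\<lambda>e. e(2 := snd y)) ` ?F (fst y) (Suc (snd y))) (\<lambda>y. ?F (fst y) (snd y))"
          by (rule transforms_conseq) (auto simp: env_of_def fun_eq_iff)
        show "?F x (?V x) = (\<lambda>e. e(3 := snd x)) ` ?E (fst x) (Suc (snd x))" for x
          by (auto simp: env_of_def fun_eq_iff)
      qed (use V in \<open>auto simp: env_of_def\<close>)
      show "transforms (For 4 (Incr 2)) ?N (\<lambda>x. ?I (fst x)) (\<lambda>x. ?F x 0) (\<lambda>x. ?E (fst x) (snd x))"
      proof (rule transforms_move[where b = 1])
        show "e 4 \<le> N ^ 1" if "?N x N" "e \<in> ?F x 0" for x N e
          using that V[of x N] by auto
        show "(\<lambda>e. e(2 := e 2 + e 4, 4 := 0)) ` ?F x 0 = ?E (fst x) (snd x)" if "?N x N" for x N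
          unfolding V(1)[OF that, symmetric] by (auto simp: env_of_def fun_eq_iff)
      qed auto
    qed
  qed (auto simp: env_of_def fun_eq_iff exp_size_def)
  show ?thesis
    using transforms_Seq[OF 1 transforms_Seq[OF 2 3]] by (intro that) (simp add: transforms_def)
qed

text \<open>The exponent of 2 in the total time: the size of the data is 2 to the power
  \<open>2 * poly q n + n + 1\<close>, \<open>b\<close> is the degree of the running time in that
  size, and \<open>a\<close> pays for the marks.\<close>

lemma poly_add_mult_pow: "\<exists>r :: nat poly. \<forall>n. a + b * (2 * poly q n + n + 1) = poly r n"
  by (rule exI[of _ "[:a:] + [:b:] * ([:2:] * q + [:1, 1:])"]) (auto simp: algebra_simps)

theorem NEXPTIME_reach:
  fixes q :: "nat poly"
  assumes \<phi>: "checks 2 (\<lambda>I e. \<phi> I)"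
  shows "{w. \<exists>S. ({}, S) \<in> (set_rel \<phi> w (poly q (length w)))\<^sup>* \<and> 0 \<in> S} \<in> NEXPTIME"
proof -
  let ?p = "poly q"
  let ?M = "exp_size ?p"
  obtain c1 where c1: "prog c1 (\<lambda>w N. length w \<le> N) (\<lambda>w. {inst_store (input_inst w) (\<lambda>_. 0)})
    (\<lambda>w. {inst_store (input_inst w) ((\<lambda>_. 0)(0 := length w))})"
    by (rule measure_input)
  obtain c2 where c2: "prog c2 (\<lambda>w N. length w \<le> N) (\<lambda>w. {inst_store (input_inst w) ((\<lambda>_. 0)(0 := length w))})
    (\<lambda>w. {inst_store (inst_of ?p w {}) (env_of (inst_of ?p w {}) 0)})"
    by (rule load_poly)
  obtain c3 where c3: "prog c3 ?M (\<lambda>w. {inst_store (inst_of ?p w {}) (env_of (inst_of ?p w {}) 0)})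
    (\<lambda>w. {inst_store (inst_of ?p w {}) (env_of (inst_of ?p w {}) (4 ^ ?p (length w)))})"
    by (rule load_fuel)
  let ?Y = "\<lambda>w. (\<lambda>S. inst_store (inst_of ?p w S) (env_of (inst_of ?p w {}) 0)) `
      {S \<in> reach \<phi> ?p w (4 ^ ?p (length w)). 0 \<in> S}"
  obtain c4 where c4: "prog c4 ?M
    (\<lambda>w. {inst_store (inst_of ?p w {}) (env_of (inst_of ?p w {}) (4 ^ ?p (length w)))}) ?Y"
    by (rule main_loop[OF \<phi>])
  have "prog (c1 ;; c2 ;; c3 ;; c4) ?M (\<lambda>w. {inst_store (input_inst w) (\<lambda>_. 0)}) ?Y"
    by (rule prog_Seq[OF prog_conseq[OF c1] prog_Seq[OF prog_conseq[OF c2] prog_Seq[OF c3 c4]]])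
      (auto simp: exp_size_def)
  then obtain b where b: "\<And>w N. 2 \<le> N \<Longrightarrow> ?M w N \<Longrightarrow>
      runs (c1 ;; c2 ;; c3 ;; c4) {inst_store (input_inst w) (\<lambda>_. 0)} (N ^ b) (?Y w)"
    unfolding prog_def by blast
  let ?c = "c1 ;; c2 ;; c3 ;; c4"
  define k where "k = Suc (Max (insert 0 (uses ?c)))"
  have k: "uses ?c \<subseteq> {..<k + 3}"
  proof
    fix i assume "i \<in> uses ?c"
    then have "i \<le> Max (insert 0 (uses ?c))" using finite_uses by (intro Max_ge) auto
    then show "i \<in> {..<k + 3}" by (simp add: k_def)
  qed
  obtain r :: "nat poly" where r: "\<And>n. 2 * k + 1 + b * (2 * ?p n + n + 1) = poly r n"
    using poly_add_mult_pow[of "2 * k + 1" b q] by blast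
  have time: "runs (mark k ;; ?c) {marked (data (input_inst w)) k 0} (2 ^ poly r (length w)) (?Y w)" for w
  proof -
    \<comment> \<open>This exceeds the input length, the bound and
      \<open>4 ^ p = 2 ^ (2 * p)\<close>, as \<open>exp_size\<close> demands, and is at least
      2.\<close>
    let ?N = "2 ^ (2 * ?p (length w) + length w + 1) :: nat"
    have le: "n \<le> 2 ^ m" if "n \<le> m" for n m :: nat
      using that less_exp[of m] by linarith
    have "(4 :: nat) ^ ?p (length w) = 2 ^ (2 * ?p (length w))" by (simp add: power_mult)
    also have "\<dots> \<le> ?N" by (rule power_increasing) auto
    finally have 4: "(4 :: nat) ^ ?p (length w) \<le> ?N" .
    have "?M w ?N" unfolding exp_size_def by (intro conjI 4; rule le; simp)
    moreover have "2 \<le> ?N" by simp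
    ultimately have "runs ?c {inst_store (input_inst w) (\<lambda>_. 0)} (?N ^ b) (?Y w)" by (rule b[rotated])
    moreover have "marked (data (input_inst w)) k k = inst_store (input_inst w) (\<lambda>_. 0)"
      by (simp add: marked_all inst_store_def inst_state_def)
    ultimately have "runs (mark k ;; ?c) {marked (data (input_inst w)) k 0} (Suc (2 * k + ?N ^ b)) (?Y w)"
      using runs_Seq[OF runs_mark[OF order_refl]] by simp
    moreover have "Suc (2 * k + ?N ^ b) \<le> 2 ^ poly r (length w)"
    proof -
      have "Suc (2 * k + ?N ^ b) \<le> 2 ^ (2 * k + 1) * ?N ^ b"
      proof -
        have "1 \<le> ?N ^ b" by simp
        then obtain m where m: "?N ^ b = Suc m" by (metis Suc_le_D One_nat_def)
        have "2 * k + 2 \<le> 2 ^ (2 * k + 1)"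
          using less_exp[of "2 * k + 1"] by linarith
        then have "(2 * k + 2) * Suc m \<le> 2 ^ (2 * k + 1) * Suc m" by (rule mult_le_mono1)
        then show ?thesis unfolding m by simp
      qed
      also have "\<dots> = 2 ^ poly r (length w)"
        by (simp only: r[symmetric] power_mult[of 2 _ b, symmetric] mult.commute)
          (simp only: power_add)
      finally show ?thesis .
    qed
    ultimately show ?thesis by (rule runs_mono)
  qed
  have "{w. ?Y w \<noteq> {}} \<in> NTIME (\<lambda>n. 2 ^ poly r n)"
  proof (rule NTIME_I[where k = "k + 3" and c = "mark k ;; ?c" and \<sigma> = "\<lambda>w. marked (data (input_inst w)) k 0"])
    show "uses (mark k ;; ?c) \<subseteq> {..<k + 3}" using k uses_mark[of k] by auto
    show "marked (data (input_inst w)) k 0 i = (if i = 0 then input_tape w else (\<lambda>_. 0, 0))"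
      if "i < k + 3" for w i
      using that by (auto simp: marked_def data_def input_tape_def set_tape_def fun_eq_iff)
    show "fst (marked (data (input_inst w)) k 0 i) p < 3" for w i p
      by (auto simp: marked_def data_less counter_tape_def)
    show "runs (mark k ;; ?c) {marked (data (input_inst w)) k 0} (2 ^ poly r (length w)) (?Y w)" for w
      by (rule time)
  qed simp
  moreover have "?Y w \<noteq> {} \<longleftrightarrow> (\<exists>S. ({}, S) \<in> (set_rel \<phi> w (?p (length w)))\<^sup>* \<and> 0 \<in> S)" for w
  proof -
    let ?R = "set_rel \<phi> w (?p (length w))"
    let ?n = "4 ^ ?p (length w) :: nat"
    have sub: "?R \<subseteq> Pow {..<?p (length w)} \<times> Pow {..<?p (length w)}"
      by (auto simp: set_rel_def)
    have fin: "finite (Pow {..<?p (length w)} \<times> Pow {..<?p (length w)})" by simp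
    \<comment> \<open>The closure of a finite relation is exhausted by as many steps as the relation
      has pairs, so \<open>4 ^ p\<close> rounds suffice.\<close>
    have "card ?R \<le> card (Pow {..<?p (length w)} \<times> Pow {..<?p (length w)})"
      by (rule card_mono[OF fin sub])
    also have "\<dots> = 2 ^ ?p (length w) * 2 ^ ?p (length w)" by (simp add: card_cartesian_product card_Pow)
    also have "\<dots> = ?n" by (simp add: power_mult_distrib[symmetric])
    finally have card: "card ?R \<le> ?n" .
    have "?R\<^sup>* = (\<Union>j\<in>{j. j \<le> card ?R}. ?R ^^ j)"
      by (rule rtrancl_finite_eq_relpow) (rule finite_subset[OF sub fin])
    then have "({}, S) \<in> ?R\<^sup>* \<longleftrightarrow> S \<in> reach \<phi> ?p w ?n" for S
      unfolding reach_def using card by (auto intro: relpow_imp_rtrancl order_trans)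
    then show ?thesis by auto
  qed
  ultimately show ?thesis unfolding NEXPTIME_def by auto
qed

section \<open>Systems of individual processes\<close>

text \<open>The A-process and the B-processes are treated alike: a process moves along an edge if
  another process is in the guard.\<close>

definition pstep :: "('q \<times> 'q set \<times> 'q) set \<Rightarrow> 'p set \<Rightarrow> (('p \<Rightarrow> 'q) \<times> ('p \<Rightarrow> 'q)) set" where
  "pstep \<delta> Q = {(x, x'). \<exists>p\<in>Q. \<exists>p'\<in>Q. \<exists>g j. p' \<noteq> p \<and> (x p, g, j) \<in> \<delta> \<and> x p' \<in> g \<and> x' = x(p := j)}"

definition dead :: "('q \<times> 'q set \<times> 'q) set \<Rightarrow> 'p set \<Rightarrow> ('p \<Rightarrow> 'q) \<Rightarrow> bool" where
  "dead \<delta> Q x \<longleftrightarrow> (\<forall>p\<in>Q. \<forall>p'\<in>Q. \<forall>g j. p' \<noteq> p \<longrightarrow> (x p, g, j) \<in> \<delta> \<longrightarrow> x p' \<notin> g)"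

lemma dead_iff: "dead \<delta> Q x \<longleftrightarrow> (\<forall>x'. (x, x') \<notin> pstep \<delta> Q)"
  unfolding dead_def pstep_def by blast

lemma pstepI:
  "p \<in> Q \<Longrightarrow> p' \<in> Q \<Longrightarrow> p' \<noteq> p \<Longrightarrow> (x p, g, j) \<in> \<delta> \<Longrightarrow> x p' \<in> g \<Longrightarrow> (x, x(p := j)) \<in> pstep \<delta> Q"
  unfolding pstep_def by blast

subsection \<open>Counters and processes\<close>

text \<open>Process 0 is the A-process, and \<open>Q\<close> is the set of the B-processes.\<close>

definition typed :: "'q template \<Rightarrow> 'q template \<Rightarrow> nat set \<Rightarrow> (nat \<Rightarrow> 'q) \<Rightarrow> bool" where
  "typed A B Q x \<longleftrightarrow> x 0 \<in> states A \<and> (\<forall>p\<in>Q. x p \<in> states B)"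

definition count_of :: "nat set \<Rightarrow> (nat \<Rightarrow> 'q) \<Rightarrow> 'q \<Rightarrow> nat" where
  "count_of Q x q = card {p \<in> Q. x p = q}"

definition cstate_of :: "nat set \<Rightarrow> (nat \<Rightarrow> 'q) \<Rightarrow> 'q cstate" where
  "cstate_of Q x = (x 0, count_of Q x)"

lemma count_of_pos: "finite Q \<Longrightarrow> count_of Q x q \<ge> 1 \<longleftrightarrow> (\<exists>p\<in>Q. x p = q)"
  unfolding count_of_def by (auto simp: Suc_le_eq card_gt_0_iff)

lemma count_of_ge: "finite Q \<Longrightarrow> p \<in> Q \<Longrightarrow> count_of Q x (x p) \<ge> 1"
  using count_of_pos[of Q x "x p"] by auto

text \<open>A counter of at least 2 means another process besides \<open>p\<close>: this is the case
  of a guard that contains the state of the moving process itself.\<close>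

lemma count_of_two:
  assumes "finite Q" "p \<in> Q" "x p = q"
  shows "count_of Q x q \<ge> 2 \<longleftrightarrow> (\<exists>p'\<in>Q. p' \<noteq> p \<and> x p' = q)"
proof -
  have "{p \<in> Q. x p = q} = insert p {p' \<in> Q. p' \<noteq> p \<and> x p' = q}" using assms by auto
  then have "count_of Q x q = Suc (card {p' \<in> Q. p' \<noteq> p \<and> x p' = q})"
    unfolding count_of_def using assms(1) by simp
  moreover have "card {p' \<in> Q. p' \<noteq> p \<and> x p' = q} \<ge> 1 \<longleftrightarrow> (\<exists>p'\<in>Q. p' \<noteq> p \<and> x p' = q)"
    using assms(1) by (auto simp: Suc_le_eq card_gt_0_iff)
  ultimately show ?thesis by linarith
qed

lemma count_of_move:
  assumes "finite Q" "p \<in> Q"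
  shows "count_of Q (x(p := j)) = (\<lambda>q. count_of Q x q - unit_vec (x p) q + unit_vec j q)"
proof
  fix q
  let ?R = "{r \<in> Q. r \<noteq> p \<and> x r = q}"
  have "{r \<in> Q. (x(p := j)) r = q} = (if j = q then insert p ?R else ?R)"
    "{r \<in> Q. x r = q} = (if x p = q then insert p ?R else ?R)" using assms by auto
  then show "count_of Q (x(p := j)) q = count_of Q x q - unit_vec (x p) q + unit_vec j q"
    unfolding count_of_def unit_vec_def using assms(1) by simp
qed

lemma count_of_other: "p \<notin> Q \<Longrightarrow> count_of Q (x(p := j)) = count_of Q x"
  unfolding count_of_def by (intro ext arg_cong[where f = card]) auto

context
  fixes A B :: "'q template"
  assumes templates: "disjunctive_templates A B"
begin

lemma disjoint: "states A \<inter> states B = {}"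
  using templates by (simp add: disjunctive_templates_def)

lemma deltaA: "(i, g, j) \<in> delta A \<Longrightarrow> i \<in> states A \<and> j \<in> states A \<and> g \<subseteq> states A \<union> states B"
  using templates unfolding disjunctive_templates_def disjunctive_template_def by blast

lemma deltaB: "(i, g, j) \<in> delta B \<Longrightarrow> i \<in> states B \<and> j \<in> states B \<and> g \<subseteq> states A \<union> states B"
  using templates unfolding disjunctive_templates_def disjunctive_template_def by blast

lemma init_in: "init A \<in> states A" "init B \<in> states B"
  using templates unfolding disjunctive_templates_def disjunctive_template_def by auto

lemma finite_states: "finite (states A \<union> states B)"
  using templates unfolding disjunctive_templates_def disjunctive_template_def by auto

abbreviation "edges \<equiv> delta A \<union> delta B"

lemma cstate_of_in: "typed A B Q x \<Longrightarrow> cstate_of Q x \<in> cs_states A B"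
  unfolding typed_def cstate_of_def cs_states_def count_of_def by (auto simp: card_eq_0_iff)

lemma pstep_typed:
  assumes x: "typed A B Q x" and s: "(x, x') \<in> pstep edges (insert 0 Q)" and Q: "0 \<notin> Q"
  shows "typed A B Q x'"
proof -
  obtain p j g where p: "p \<in> insert 0 Q" "(x p, g, j) \<in> edges" "x' = x(p := j)"
    using s unfolding pstep_def by auto
  show ?thesis
  proof (cases "p = 0")
    case True
    then have "(x p, g, j) \<in> delta A" using p x deltaB disjoint unfolding typed_def by blast
    then show ?thesis using p x deltaA Q True unfolding typed_def by auto
  next
    case False
    then have "(x p, g, j) \<in> delta B" using p x deltaA disjoint unfolding typed_def by blast
    then show ?thesis using p x deltaB Q False unfolding typed_def by auto
  qed
qed

text \<open>As the state sets are disjoint, the edge belongs to the template of the moving process.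
  For a B-move, the three alternatives of the guard condition correspond to a witness that is the
  A-process, a B-process in another state, or another B-process in the same state; for an A-move the
  witness is a B-process.\<close>

lemma pstep_cs_trans:
  assumes Q: "finite Q" "0 \<notin> Q" and x: "typed A B Q x" and s: "(x, x') \<in> pstep edges (insert 0 Q)"
  shows "(cstate_of Q x, cstate_of Q x') \<in> cs_trans A B"
proof -
  obtain p p' j g where p: "p \<in> insert 0 Q" "p' \<in> insert 0 Q" "p' \<noteq> p" "(x p, g, j) \<in> edges"
    "x p' \<in> g" "x' = x(p := j)"
    using s unfolding pstep_def by auto
  have st: "cstate_of Q x \<in> cs_states A B" "cstate_of Q x' \<in> cs_states A B"
    using cstate_of_in x pstep_typed[OF x s Q(2)] by auto
  show ?thesis
  proof (cases "p = 0")
    case True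
    then have A: "(x 0, g, j) \<in> delta A" using p x deltaB disjoint unfolding typed_def by blast
    have "p' \<in> Q" using p True by auto
    then have "x p' \<in> g \<inter> states B" "count_of Q x (x p') \<ge> 1"
      using p(5) x count_of_ge[OF Q(1)] unfolding typed_def by auto
    moreover have "count_of Q x' = count_of Q x" "x' 0 = j" using p(6) True count_of_other Q(2) by auto
    ultimately show ?thesis using A st unfolding cs_trans_def cstate_of_def by auto
  next
    case False
    then have pQ: "p \<in> Q" using p by auto
    have B: "(x p, g, j) \<in> delta B" using p x deltaA disjoint False unfolding typed_def by blast
    have c: "count_of Q x (x p) \<ge> 1" using count_of_ge[OF Q(1) pQ] .
    have m: "count_of Q x' = (\<lambda>q. count_of Q x q - unit_vec (x p) q + unit_vec j q)" "x' 0 = x 0"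
      using count_of_move[OF Q(1) pQ] p(6) False by auto
    have "x 0 \<in> g \<or> (\<exists>l\<in>g \<inter> states B. l \<noteq> x p \<and> count_of Q x l \<ge> 1) \<or> x p \<in> g \<and> count_of Q x (x p) \<ge> 2"
    proof (cases "p' = 0")
      case True
      then show ?thesis using p by auto
    next
      case False
      then have "p' \<in> Q" using p by auto
      then have "x p' \<in> states B" "count_of Q x (x p') \<ge> 1"
        using x count_of_ge[OF Q(1)] unfolding typed_def by auto
      then show ?thesis
        using p(3,5) count_of_two[OF Q(1) pQ, of x "x p"] \<open>p' \<in> Q\<close> by (cases "x p' = x p") auto
    qed
    then show ?thesis using B c m st unfolding cs_trans_def cstate_of_def by blast
  qed
qed

lemma cs_trans_pstep:
  assumes Q: "finite Q" "0 \<notin> Q" and x: "typed A B Q x" and s: "(cstate_of Q x, s') \<in> cs_trans A B"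
  shows "\<exists>x'. (x, x') \<in> pstep edges (insert 0 Q) \<and> cstate_of Q x' = s'"
proof -
  obtain qA' c' where s': "s' = (qA', c')" by (cases s')
  have "c' = count_of Q x \<and> (\<exists>g. (x 0, g, qA') \<in> delta A \<and> (\<exists>i\<in>g \<inter> states B. count_of Q x i \<ge> 1)) \<or>
    qA' = x 0 \<and> (\<exists>i g j. (i, g, j) \<in> delta B \<and> count_of Q x i \<ge> 1 \<and>
      c' = (\<lambda>q. count_of Q x q - unit_vec i q + unit_vec j q) \<and>
      (x 0 \<in> g \<or> (\<exists>l\<in>g \<inter> states B. l \<noteq> i \<and> count_of Q x l \<ge> 1) \<or> i \<in> g \<and> count_of Q x i \<ge> 2))"
    using s unfolding s' cs_trans_def cstate_of_def by simp
  then consider (A) g i where "c' = count_of Q x" "(x 0, g, qA') \<in> delta A" "i \<in> g \<inter> states B" "count_of Q x i \<ge> 1"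
    | (B) i g j where "qA' = x 0" "(i, g, j) \<in> delta B" "count_of Q x i \<ge> 1"
      "c' = (\<lambda>q. count_of Q x q - unit_vec i q + unit_vec j q)"
      "x 0 \<in> g \<or> (\<exists>l\<in>g \<inter> states B. l \<noteq> i \<and> count_of Q x l \<ge> 1) \<or> i \<in> g \<and> count_of Q x i \<ge> 2"
    by blast
  then show ?thesis
  proof cases
    case A
    obtain p' where p': "p' \<in> Q" "x p' = i" using A(4) count_of_pos[OF Q(1), of x i] by blast
    have "(x, x(0 := qA')) \<in> pstep edges (insert 0 Q)"
    proof (rule pstepI[of 0 _ p' _ g])
      show "p' \<noteq> 0" using p'(1) Q(2) by metis
    qed (use A p' in auto)
    moreover have "cstate_of Q (x(0 := qA')) = s'"
      unfolding s' cstate_of_def using A(1) count_of_other[OF Q(2)] by simp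
    ultimately show ?thesis by blast
  next
    case B
    obtain p where p: "p \<in> Q" "x p = i" using B(3) count_of_pos[OF Q(1), of x i] by blast
    have p0: "p \<noteq> 0" using p(1) Q(2) by metis
    have "\<exists>p'\<in>insert 0 Q. p' \<noteq> p \<and> x p' \<in> g"
      using B(5)
    proof (elim disjE)
      assume "x 0 \<in> g"
      then show ?thesis using p0 by (intro bexI[of _ 0]) auto
    next
      assume "\<exists>l\<in>g \<inter> states B. l \<noteq> i \<and> count_of Q x l \<ge> 1"
      then obtain l where l: "l \<in> g" "l \<noteq> i" "count_of Q x l \<ge> 1" by blast
      then obtain p' where "p' \<in> Q" "x p' = l" using count_of_pos[OF Q(1), of x l] by blast
      then show ?thesis using l p by (intro bexI[of _ p']) auto
    next
      assume "i \<in> g \<and> count_of Q x i \<ge> 2"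
      then show ?thesis using count_of_two[OF Q(1) p(1), of x i] p(2) by auto
    qed
    then obtain p' where p': "p' \<in> insert 0 Q" "p' \<noteq> p" "x p' \<in> g" by blast
    have "(x, x(p := j)) \<in> pstep edges (insert 0 Q)"
      by (rule pstepI[of p _ p' _ g]) (use B p p' in auto)
    moreover have "cstate_of Q (x(p := j)) = s'"
      unfolding s' cstate_of_def using B(1,4) count_of_move[OF Q(1) p(1), of x j] p Q(2) by auto
    ultimately show ?thesis by blast
  qed
qed

definition start_of :: "nat \<Rightarrow> 'q" where
  "start_of p = (if p = 0 then init A else init B)"

lemma start_of_B: "0 \<notin> Q \<Longrightarrow> p \<in> Q \<Longrightarrow> start_of p = init B"
  unfolding start_of_def by metis

lemma typed_start: "0 \<notin> Q \<Longrightarrow> typed A B Q start_of"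
  unfolding typed_def start_of_def using init_in by auto

lemma psteps_typed:
  assumes "(x, x') \<in> (pstep edges (insert 0 Q))\<^sup>*" "typed A B Q x" "0 \<notin> Q"
  shows "typed A B Q x'"
  using assms by (induction rule: rtrancl_induct) (auto intro: pstep_typed)

lemma psteps_cs_trans:
  assumes "(x, x') \<in> (pstep edges (insert 0 Q))\<^sup>*" "typed A B Q x" "0 \<notin> Q" "finite Q"
  shows "(cstate_of Q x, cstate_of Q x') \<in> (cs_trans A B)\<^sup>*"
  using assms
proof (induction rule: rtrancl_induct)
  case (step y z)
  then show ?case using pstep_cs_trans[OF _ _ psteps_typed] by (meson rtrancl.rtrancl_into_rtrancl)
qed simp

lemma cs_trans_psteps:
  assumes "(cstate_of Q x, s') \<in> (cs_trans A B)\<^sup>*" "typed A B Q x" "0 \<notin> Q" "finite Q"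
  shows "\<exists>x'. (x, x') \<in> (pstep edges (insert 0 Q))\<^sup>* \<and> cstate_of Q x' = s'"
  using assms(1)
proof (induction rule: rtrancl_induct)
  case base
  then show ?case by blast
next
  case (step s s')
  then obtain y where y: "(x, y) \<in> (pstep edges (insert 0 Q))\<^sup>*" "cstate_of Q y = s" by blast
  then obtain z where "(y, z) \<in> pstep edges (insert 0 Q)" "cstate_of Q z = s'"
    using cs_trans_pstep[OF assms(4,3) psteps_typed[OF y(1) assms(2,3)]] step.hyps(2) by blast
  then show ?case
    by (intro exI[of _ z] conjI rtrancl.rtrancl_into_rtrancl[OF y(1)])
qed

lemma dead_cstate_of:
  assumes "typed A B Q x" "0 \<notin> Q" "finite Q"
  shows "dead edges (insert 0 Q) x \<longleftrightarrow> (\<forall>s. (cstate_of Q x, s) \<notin> cs_trans A B)"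
  using assms cs_trans_pstep pstep_cs_trans unfolding dead_iff by meson

text \<open>\<open>cs_trans\<close> relates only states of the system, so a finite path is
  extendable exactly if its last state has a successor, and finite paths amount to the reflexive
  transitive closure.\<close>

lemma has_deadlocked_run_pos_iff:
  "has_deadlocked_run_pos A B \<longleftrightarrow> (\<exists>s s'. s \<in> cs_init A B \<and> snd s (init B) \<ge> 1 \<and>
     (s, s') \<in> (cs_trans A B)\<^sup>* \<and> (\<forall>s''. (s', s'') \<notin> cs_trans A B))" (is "?l \<longleftrightarrow> ?r")
proof
  assume ?l
  then obtain xs where xs: "is_path (cs_states A B) (cs_trans A B) (Finite_Path xs)"
    "\<not> extendable (cs_states A B) (cs_trans A B) (Finite_Path xs)" "hd xs \<in> cs_init A B"
    "snd (hd xs) (init B) \<ge> 1"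
    unfolding has_deadlocked_run_pos_def deadlocked_run_def is_run_def
    by (metis finite_path.elims(2) path_start.simps(1))
  have ne: "xs \<noteq> []" using xs(1) by simp
  have "(hd xs, xs ! i) \<in> (cs_trans A B)\<^sup>*" if "i < length xs" for i
    using that
  proof (induction i)
    case 0
    then show ?case using ne by (simp add: hd_conv_nth)
  next
    case (Suc i)
    then show ?case using xs(1) by (auto intro: rtrancl.rtrancl_into_rtrancl)
  qed
  then have "(hd xs, last xs) \<in> (cs_trans A B)\<^sup>*" using ne by (simp add: last_conv_nth)
  moreover have "(last xs, s) \<notin> cs_trans A B" for s
  proof
    assume s: "(last xs, s) \<in> cs_trans A B"
    then have "s \<in> cs_states A B" unfolding cs_trans_def by auto
    moreover have "((xs @ [s]) ! i, (xs @ [s]) ! Suc i) \<in> cs_trans A B" if "Suc i < length (xs @ [s])" for i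
    proof (cases "Suc i < length xs")
      case True
      then show ?thesis using xs(1) by (simp add: nth_append)
    next
      case False
      then have "i = length xs - 1" using that by simp
      then show ?thesis using s ne by (simp add: nth_append last_conv_nth)
    qed
    ultimately have "is_path (cs_states A B) (cs_trans A B) (Finite_Path (xs @ [s]))"
      using xs(1) by auto
    then show False using xs(2) unfolding extendable.simps by blast
  qed
  ultimately show ?r using xs(3,4) by blast
next
  assume ?r
  then obtain s s' where s: "s \<in> cs_init A B" "snd s (init B) \<ge> 1" "(s, s') \<in> (cs_trans A B)\<^sup>*"
    "\<And>s''. (s', s'') \<notin> cs_trans A B" by blast
  have "s \<in> cs_states A B" using s(1) unfolding cs_init_def by auto
  have "\<exists>xs. is_path (cs_states A B) (cs_trans A B) (Finite_Path xs) \<and> hd xs = s \<and> last xs = s'"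
    using s(3)
  proof (induction rule: rtrancl_induct)
    case base
    show ?case by (rule exI[of _ "[s]"]) (use \<open>s \<in> cs_states A B\<close> in auto)
  next
    case (step y z)
    then obtain xs where xs: "is_path (cs_states A B) (cs_trans A B) (Finite_Path xs)" "hd xs = s" "last xs = y"
      by blast
    have ne: "xs \<noteq> []" using xs(1) by simp
    have "z \<in> cs_states A B" using step(2) unfolding cs_trans_def by auto
    moreover have "((xs @ [z]) ! i, (xs @ [z]) ! Suc i) \<in> cs_trans A B" if "Suc i < length (xs @ [z])" for i
    proof (cases "Suc i < length xs")
      case True
      then show ?thesis using xs(1) by (simp add: nth_append)
    next
      case False
      then have "i = length xs - 1" using that by simp
      then show ?thesis using step(2) xs(3) ne by (simp add: nth_append last_conv_nth)
    qed
    ultimately show ?case using xs ne by (intro exI[of _ "xs @ [z]"]) auto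
  qed
  then obtain xs where xs: "is_path (cs_states A B) (cs_trans A B) (Finite_Path xs)" "hd xs = s" "last xs = s'"
    by blast
  have ne: "xs \<noteq> []" using xs(1) by simp
  have "\<not> extendable (cs_states A B) (cs_trans A B) (Finite_Path xs)"
  proof
    assume "extendable (cs_states A B) (cs_trans A B) (Finite_Path xs)"
    then obtain t where "is_path (cs_states A B) (cs_trans A B) (Finite_Path (xs @ [t]))"
      unfolding extendable.simps by blast
    then have "((xs @ [t]) ! i, (xs @ [t]) ! Suc i) \<in> cs_trans A B" if "Suc i < length (xs @ [t])" for i
      using that by simp
    from this[of "length xs - 1"] show False using ne xs(3) s(4) by (simp add: nth_append last_conv_nth)
  qed
  then show ?l unfolding has_deadlocked_run_pos_def deadlocked_run_def is_run_def
    using xs s(1,2) by (intro exI[of _ "Finite_Path xs"]) auto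
qed

lemma pos_processes:
  "has_deadlocked_run_pos A B \<longleftrightarrow> (\<exists>Q x. finite Q \<and> 0 \<notin> Q \<and> Q \<noteq> {} \<and>
     (start_of, x) \<in> (pstep edges (insert 0 Q))\<^sup>* \<and> dead edges (insert 0 Q) x)" (is "?l \<longleftrightarrow> ?r")
proof
  assume ?l
  then obtain s s' where s: "s \<in> cs_init A B" "snd s (init B) \<ge> 1" "(s, s') \<in> (cs_trans A B)\<^sup>*"
    "\<And>s''. (s', s'') \<notin> cs_trans A B" unfolding has_deadlocked_run_pos_iff by blast
  \<comment> \<open>One process for each unit of the counter of \<open>init B\<close>, the only
    counter that may be positive initially.\<close>
  define Q where "Q = {1..snd s (init B)}"
  have Q: "finite Q" "0 \<notin> Q" "Q \<noteq> {}" using s(2) by (auto simp: Q_def)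
  have "count_of Q start_of q = snd s q" for q
  proof -
    have "{p \<in> Q. start_of p = q} = (if q = init B then Q else {})"
      using start_of_B[OF Q(2)] by auto
    then show ?thesis using s(1) by (auto simp: count_of_def Q_def cs_init_def)
  qed
  then have "cstate_of Q start_of = s"
    using s(1) by (auto simp: cstate_of_def start_of_def cs_init_def)
  then obtain x where x: "(start_of, x) \<in> (pstep edges (insert 0 Q))\<^sup>*" "cstate_of Q x = s'"
    using cs_trans_psteps[of Q start_of s'] s(3) typed_start[OF Q(2)] Q by auto
  have "dead edges (insert 0 Q) x"
    using dead_cstate_of[OF psteps_typed[OF x(1) typed_start[OF Q(2)] Q(2)] Q(2,1)] x(2) s(4) by simp
  then show ?r using Q x by blast
next
  assume ?r
  then obtain Q x where Q: "finite Q" "0 \<notin> Q" "Q \<noteq> {}" and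
    x: "(start_of, x) \<in> (pstep edges (insert 0 Q))\<^sup>*" "dead edges (insert 0 Q) x" by blast
  have t: "typed A B Q start_of" "typed A B Q x" using typed_start psteps_typed x Q by auto
  have "cstate_of Q start_of \<in> cs_init A B"
    using cstate_of_in[OF t(1)] Q(2)
    by (auto simp: cs_init_def cstate_of_def count_of_def start_of_def[of 0] start_of_B card_eq_0_iff)
  moreover have "snd (cstate_of Q start_of) (init B) \<ge> 1"
  proof -
    obtain p where "p \<in> Q" using Q(3) by blast
    then show ?thesis using count_of_ge[OF Q(1), of p start_of] start_of_B[OF Q(2)]
      by (simp add: cstate_of_def)
  qed
  ultimately show ?l unfolding has_deadlocked_run_pos_iff
    using psteps_cs_trans[OF x(1) t(1) Q(2,1)] x(2) dead_cstate_of[OF t(2) Q(2,1)] by blast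
qed

end

subsection \<open>A bound on the number of processes\<close>

text \<open>The processes of \<open>F\<close> move one after the other. The witness \<open>w\<close>
  is outside \<open>F\<close> and keeps its state, so the guard stays enabled throughout.\<close>

lemma psteps_move:
  assumes "finite F" "F \<subseteq> Q" "\<And>z. z \<in> F \<Longrightarrow> x z = i" "w \<in> Q" "w \<notin> F" "x w \<in> g" "(i, g, j) \<in> \<delta>"
  shows "(x, \<lambda>z. if z \<in> F then j else x z) \<in> (pstep \<delta> Q)\<^sup>*"
  using assms(1-3,5)
proof (induction F)
  case empty
  then show ?case by simp
next
  case (insert z F)
  let ?y = "\<lambda>z. if z \<in> F then j else x z"
  have IH: "(x, ?y) \<in> (pstep \<delta> Q)\<^sup>*" by (rule insert.IH) (use insert.prems in auto)
  have "(?y, ?y(z := j)) \<in> pstep \<delta> Q"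
  proof (rule pstepI[of z _ w _ g])
    show "(?y z, g, j) \<in> \<delta>" using insert assms(7) by auto
  qed (use insert assms in auto)
  moreover have "?y(z := j) = (\<lambda>z'. if z' \<in> insert z F then j else x z')" by auto
  ultimately show ?case using IH by (metis rtrancl.rtrancl_into_rtrancl)
qed

text \<open>The processes ending in a state that finally holds fewer than \<open>card St\<close> processes are
  kept.  Of the others, one lingering process per state \<open>q\<close> suffices: it enters \<open>q\<close> at the first
  time \<open>q\<close> is visited by one of them and stays there until the last such time.\<close>

lemma cutoff:
  fixes xs :: "nat \<Rightarrow> 'p \<Rightarrow> 'q"
  assumes Q: "finite Q" and fin_St: "finite St" "2 \<le> card St"
    and types: "\<And>t p. t \<le> T \<Longrightarrow> p \<in> Q \<Longrightarrow> xs t p \<in> St"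
    and steps_xs: "\<And>t. t < T \<Longrightarrow> (xs t, xs (Suc t)) \<in> pstep \<delta> Q"
    and dead: "dead \<delta> Q (xs T)"
  defines "poor \<equiv> \<lambda>p. card {r \<in> Q. xs T r = xs T p} < card St"
  obtains V u yT where "V \<subseteq> St" "\<And>q. q \<in> V \<Longrightarrow> u q \<in> Q \<and> \<not> poor (u q)"
    "\<And>p. p \<in> Q \<Longrightarrow> \<not> poor p \<Longrightarrow> V \<noteq> {}"
    "card (Inl ` {p \<in> Q. poor p} \<union> Inr ` V) \<le> card St * card St"
    "(case_sum (xs 0) (\<lambda>q. xs 0 (u q)), yT) \<in> (pstep \<delta> (Inl ` {p \<in> Q. poor p} \<union> Inr ` V))\<^sup>*"
    "dead \<delta> (Inl ` {p \<in> Q. poor p} \<union> Inr ` V) yT"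
proof -
  \<comment> \<open>The times at which \<open>q\<close> is occupied by a process that will not be
    kept; \<open>V\<close> collects the states for which there is such a time.\<close>
  define W where "W q = {t. t \<le> T \<and> (\<exists>p\<in>Q. \<not> poor p \<and> xs t p = q)}" for q
  define V where "V = {q. W q \<noteq> {}}"
  define f where "f q = Min (W q)" for q
  define l where "l q = Max (W q)" for q
  have finW: "finite (W q)" for q unfolding W_def by simp
  have f: "f q \<in> W q" and l: "l q \<in> W q" if "q \<in> V" for q
    using that finW unfolding V_def f_def l_def by auto
  have fle: "f q \<le> t" and lge: "t \<le> l q" if "t \<in> W q" for q t
    using that finW unfolding f_def l_def by auto
  \<comment> \<open>The lingering process for \<open>q\<close> copies \<open>u q\<close> up to time
    \<open>f q\<close>, when \<open>u q\<close> is in \<open>q\<close>, and from time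
    \<open>l q\<close> on it copies \<open>v q\<close>, which is in \<open>q\<close> at that time.
    So the copy never jumps.\<close>
  obtain u where u: "\<And>q. q \<in> V \<Longrightarrow> u q \<in> Q \<and> \<not> poor (u q) \<and> xs (f q) (u q) = q"
    using f unfolding W_def by (auto; metis)
  obtain v where v: "\<And>q. q \<in> V \<Longrightarrow> v q \<in> Q \<and> \<not> poor (v q) \<and> xs (l q) (v q) = q"
    using l unfolding W_def by (auto; metis)
  have lT: "l q \<le> T" if "q \<in> V" for q using l[OF that] unfolding W_def by simp
  let ?Q = "Inl ` {p \<in> Q. poor p} \<union> Inr ` V"
  define y where "y t = case_sum (xs t)
    (\<lambda>q. if t \<le> f q then xs t (u q) else if t \<le> l q then q else xs t (v q))" for t
  \<comment> \<open>Processes outside \<open>?Q\<close> are frozen at their initial value, because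
    steps of the new system leave them fixed and its states are compared as total functions.\<close>
  define Y where "Y t z = (if z \<in> ?Q then y t z else y 0 z)" for t z
  have Yl: "Y t (Inl p) = xs t p" if "p \<in> Q" "poor p" for t p
    using that by (simp add: Y_def y_def)
  have Y1: "Y t (Inr q) = xs t (u q)" if "q \<in> V" "t \<le> f q" for t q
    using that by (simp add: Y_def y_def)
  have Y2: "Y t (Inr q) = q" if "q \<in> V" "f q \<le> t" "t \<le> l q" for t q
    using that u[OF that(1)] by (auto simp: Y_def y_def)
  have Y3: "Y t (Inr q) = xs t (v q)" if "q \<in> V" "l q \<le> t" for t q
    using that v[OF that(1)] fle[OF l[OF that(1)]] u[OF that(1)] by (auto simp: Y_def y_def)
  have VSt: "V \<subseteq> St"
    using types unfolding V_def W_def by auto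
  have finV: "finite V" using VSt fin_St(1) by (rule finite_subset)
  have finQ: "finite ?Q" using Q finV by simp
  have steps: "(Y t, Y (Suc t)) \<in> (pstep \<delta> ?Q)\<^sup>*" if t: "t < T" for t
  proof -
    obtain p p' g j where p: "p \<in> Q" "p' \<in> Q" "p' \<noteq> p" "(xs t p, g, j) \<in> \<delta>" "xs t p' \<in> g"
      "xs (Suc t) = (xs t)(p := j)"
      using steps_xs[OF t] unfolding pstep_def by auto
    \<comment> \<open>The copies that change at this time; there may be several, since more than one
      lingering process can follow \<open>p\<close> at present. Each of them makes the move of
      \<open>p\<close>.\<close>
    let ?F = "{z \<in> ?Q. Y t z \<noteq> Y (Suc t) z}"
    have x: "xs t r = xs (Suc t) r \<or> xs t r = xs t p \<and> xs (Suc t) r = j" for r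
      using p(6) by auto
    have F: "Y t z = xs t p \<and> Y (Suc t) z = j" if "z \<in> ?F" for z
    proof (cases z)
      case (Inl r)
      then have r: "r \<in> Q" "poor r" using that by auto
      have "Y t (Inl r) \<noteq> Y (Suc t) (Inl r)" using that unfolding Inl by blast
      then show ?thesis using x[of r] unfolding Inl Yl[OF r] by metis
    next
      case (Inr q)
      then have q: "q \<in> V" using that by blast
      have ne: "Y t (Inr q) \<noteq> Y (Suc t) (Inr q)" using that unfolding Inr by blast
      consider "Suc t \<le> f q" | "f q \<le> t" "Suc t \<le> l q" | "l q \<le> t" by linarith
      then show ?thesis
      proof cases
        case 1
        have "Y t (Inr q) = xs t (u q)" "Y (Suc t) (Inr q) = xs (Suc t) (u q)"
          by (rule Y1[OF q]; use 1 in linarith)+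
        then show ?thesis using ne x[of "u q"] unfolding Inr by metis
      next
        case 2
        have "Y t (Inr q) = q" "Y (Suc t) (Inr q) = q"
          by (rule Y2[OF q]; use 2 in linarith)+
        then show ?thesis using ne by metis
      next
        case 3
        have "Y t (Inr q) = xs t (v q)" "Y (Suc t) (Inr q) = xs (Suc t) (v q)"
          by (rule Y3[OF q]; use 3 in linarith)+
        then show ?thesis using ne x[of "v q"] unfolding Inr by metis
      qed
    qed
    \<comment> \<open>A copy that shows the state of the witness \<open>p'\<close> and does not move
      itself: the kept \<open>p'\<close>, or the process lingering in that state, which stays
      because \<open>p'\<close> occupies the state both at \<open>t\<close> and at
      \<open>Suc t\<close>.\<close>
    have "\<exists>w\<in>?Q. w \<notin> ?F \<and> Y t w \<in> g"
    proof (cases "poor p'")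
      case True
      have "xs (Suc t) p' = xs t p'" using p(3,6) by simp
      then have "Y t (Inl p') = xs t p'" "Y (Suc t) (Inl p') = xs t p'"
        using Yl[OF p(2) True] by simp_all
      moreover have "Inl p' \<in> ?Q" using p(2) True by blast
      ultimately show ?thesis using p(5) by (intro bexI[of _ "Inl p'"]) simp_all
    next
      case False
      let ?q = "xs t p'"
      have "xs (Suc t) p' = ?q" using p(3,6) by simp
      then have W: "t \<in> W ?q" "Suc t \<in> W ?q" 
        unfolding W_def using t p(2) False by (simp_all, blast+)
      then have q: "?q \<in> V" unfolding V_def by blast
      have "Y t (Inr ?q) = ?q" "Y (Suc t) (Inr ?q) = ?q"
        by (rule Y2[OF q]; use fle[OF W(1)] lge[OF W(2)] in linarith)+
      then show ?thesis using q p(5) by (intro bexI[of _ "Inr ?q"]) simp_all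
    qed
    then obtain w where w: "w \<in> ?Q" "w \<notin> ?F" "Y t w \<in> g" by blast
    have "(Y t, \<lambda>z. if z \<in> ?F then j else Y t z) \<in> (pstep \<delta> ?Q)\<^sup>*"
    proof (rule psteps_move[where i = "xs t p" and w = w and g = g])
      show "finite ?F" by (rule finite_subset[OF _ finQ]) blast
      show "Y t z = xs t p" if "z \<in> ?F" for z using F[OF that] by blast
    qed (fact | blast)+
    moreover have "(\<lambda>z. if z \<in> ?F then j else Y t z) = Y (Suc t)"
    proof
      fix z
      show "(if z \<in> ?F then j else Y t z) = Y (Suc t) z"
      proof (cases "z \<in> ?F")
        case True
        then show ?thesis using F[OF True] by presburger
      next
        case False
        then have "Y t z = Y (Suc t) z" by (cases "z \<in> ?Q") (blast, simp add: Y_def)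
        then show ?thesis using False by presburger
      qed
    qed
    ultimately show ?thesis by simp
  qed
  have "(Y 0, Y t) \<in> (pstep \<delta> ?Q)\<^sup>*" if "t \<le> T" for t
    using that by (induction t) (auto intro: rtrancl_trans[OF _ steps])
  moreover have "Y 0 = case_sum (xs 0) (\<lambda>q. xs 0 (u q))"
    by (auto simp: Y_def y_def fun_eq_iff split: sum.splits)
  ultimately have path: "(case_sum (xs 0) (\<lambda>q. xs 0 (u q)), Y T) \<in> (pstep \<delta> ?Q)\<^sup>*" by fastforce
  \<comment> \<open>The original process whose final state the copy takes over.\<close>
  define ori where "ori = case_sum (\<lambda>p. p) v"
  have ori: "Y T z = xs T (ori z)" "ori z \<in> Q" if "z \<in> ?Q" for z
    using that Yl Y3[OF _ lT] v by (auto simp: ori_def)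
  have dead': "dead \<delta> ?Q (Y T)"
    unfolding dead_def
  proof (intro ballI allI impI)
    fix z z' g j assume z: "z \<in> ?Q" "z' \<in> ?Q" "z' \<noteq> z" "(Y T z, g, j) \<in> \<delta>"
    \<comment> \<open>Two copies can have the same original. It is then not poor, so its final state
      holds at least \<open>card St \<ge> 2\<close> original processes, two of which take the places
      of the copies.\<close>
    have "\<exists>r\<in>Q. \<exists>r'\<in>Q. r' \<noteq> r \<and> xs T r = Y T z \<and> xs T r' = Y T z'"
    proof (cases "ori z = ori z'")
      case False
      then show ?thesis using ori[OF z(1)] ori[OF z(2)] by metis
    next
      case True
      have "\<not> poor (ori z)"
      proof (cases z)
        case (Inl p)
        with True z obtain q where "z' = Inr q" "q \<in> V" by (auto simp: ori_def)
        then show ?thesis using True v[of q] by (simp add: ori_def)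
      next
        case (Inr q)
        then show ?thesis using z(1) v[of q] by (auto simp: ori_def)
      qed
      then have "2 \<le> card {r \<in> Q. xs T r = xs T (ori z)}" using fin_St(2) unfolding poor_def by linarith
      then obtain r r' where "r \<in> Q" "r' \<in> Q" "r' \<noteq> r" "xs T r = xs T (ori z)" "xs T r' = xs T (ori z)"
        by (auto simp: numeral_2_eq_2 card_le_Suc_iff)
      then show ?thesis using ori(1)[OF z(1)] ori(1)[OF z(2)] True by metis
    qed
    then show "Y T z' \<notin> g" using dead z(4) unfolding dead_def by metis
  qed
  have "{p \<in> Q. poor p} \<subseteq> (\<Union>d\<in>St. {r \<in> Q. xs T r = d \<and> poor r})"
    using types by auto
  then have "card {p \<in> Q. poor p} \<le> card (\<Union>d\<in>St. {r \<in> Q. xs T r = d \<and> poor r})"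
    using Q fin_St(1) by (intro card_mono) auto
  also have "\<dots> \<le> (\<Sum>d\<in>St. card {r \<in> Q. xs T r = d \<and> poor r})"
    by (rule card_UN_le[OF fin_St(1)])
  also have "\<dots> \<le> (\<Sum>d\<in>St. card St - 1)"
  proof (rule sum_mono)
    fix d
    \<comment> \<open>If some process ending in \<open>d\<close> is poor, then \<open>d\<close>
      finally holds at most \<open>card St - 1\<close> processes at all.\<close>
    show "card {r \<in> Q. xs T r = d \<and> poor r} \<le> card St - 1"
    proof (cases "\<exists>r\<in>Q. xs T r = d \<and> poor r")
      case True
      then obtain r where r: "r \<in> Q" "xs T r = d" "poor r" by blast
      have "card {r \<in> Q. xs T r = d \<and> poor r} \<le> card {r \<in> Q. xs T r = d}"
        using Q by (intro card_mono) auto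
      then show ?thesis using r(2,3) unfolding poor_def by auto
    next
      case False
      then have none: "{r \<in> Q. xs T r = d \<and> poor r} = {}" by blast
      show ?thesis unfolding none by simp
    qed
  qed
  also have "\<dots> = card St * (card St - 1)" by simp
  finally have poor: "card {p \<in> Q. poor p} \<le> card St * (card St - 1)" .
  have "card ?Q \<le> card {p \<in> Q. poor p} + card V"
    using card_Un_le[of "Inl ` {p \<in> Q. poor p}" "Inr ` V"] by (simp add: card_image)
  also have "\<dots> \<le> card St * (card St - 1) + card St"
    using poor card_mono[OF fin_St(1) VSt] by linarith
  also have "\<dots> = card St * card St" using fin_St(2) by (cases "card St") auto
  finally have "card ?Q \<le> card St * card St" .
  moreover have "V \<noteq> {}" if "p \<in> Q" "\<not> poor p" for p
    using that unfolding V_def W_def by auto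
  ultimately show thesis using that[of V u "Y T"] VSt u path dead' by blast
qed

section \<open>Renaming of processes along a bijection, and the bound for the counter system\<close>

definition pull :: "'r set \<Rightarrow> ('r \<Rightarrow> 'p) \<Rightarrow> 'q \<Rightarrow> ('p \<Rightarrow> 'q) \<Rightarrow> 'r \<Rightarrow> 'q" where
  "pull N g c x r = (if r \<in> N then x (g r) else c)"

lemma pull_pstep:
  assumes g: "bij_betw g N Q" and s: "(x, x') \<in> pstep \<delta> Q"
  shows "(pull N g c x, pull N g c x') \<in> pstep \<delta> N"
proof -
  obtain p p' h j where p: "p \<in> Q" "p' \<in> Q" "p' \<noteq> p" "(x p, h, j) \<in> \<delta>" "x p' \<in> h" "x' = x(p := j)"
    using s unfolding pstep_def by auto
  obtain r r' where r: "r \<in> N" "g r = p" "r' \<in> N" "g r' = p'"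
    using g p(1,2) unfolding bij_betw_def by auto
  have "(pull N g c x, (pull N g c x)(r := j)) \<in> pstep \<delta> N"
    by (rule pstepI[of r _ r' _ h]) (use r p in \<open>auto simp: pull_def\<close>)
  moreover have "(pull N g c x)(r := j) = pull N g c x'"
  proof
    fix s
    have "g s = p \<longleftrightarrow> s = r" if "s \<in> N" using g r that unfolding bij_betw_def inj_on_def by auto
    then show "((pull N g c x)(r := j)) s = pull N g c x' s" using p(6) r by (auto simp: pull_def)
  qed
  ultimately show ?thesis by simp
qed

lemma pull_psteps:
  assumes g: "bij_betw g N Q" and s: "(x, x') \<in> (pstep \<delta> Q)\<^sup>*"
  shows "(pull N g c x, pull N g c x') \<in> (pstep \<delta> N)\<^sup>*"
  using s by (induction rule: rtrancl_induct) (auto intro: rtrancl.rtrancl_into_rtrancl pull_pstep[OF g])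

lemma pull_dead:
  assumes g: "bij_betw g N Q" and d: "dead \<delta> Q x"
  shows "dead \<delta> N (pull N g c x)"
  unfolding dead_def
proof (intro ballI allI impI)
  fix r r' h j assume r: "r \<in> N" "r' \<in> N" "r' \<noteq> r" "(pull N g c x r, h, j) \<in> \<delta>"
  have "g r \<in> Q" "g r' \<in> Q" "g r' \<noteq> g r"
    using g r unfolding bij_betw_def inj_on_def by auto
  then show "pull N g c x r' \<notin> h" using d r unfolding dead_def by (auto simp: pull_def)
qed

text \<open>By disjointness of the state sets the A-process is alone in its final state, and as
  \<open>H \<ge> 2\<close> it is among the processes kept by \<open>cutoff\<close>. It remains
  process 0; the other processes of the reduced system are numbered from 1.\<close>

lemma pos_bounded:
  assumes AB: "disjunctive_templates A B"
  defines "H \<equiv> card (states A \<union> states B)" and "\<delta> \<equiv> delta A \<union> delta B"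
  shows "has_deadlocked_run_pos A B \<longleftrightarrow> (\<exists>Q x. Q \<subseteq> {1..H * H} \<and> Q \<noteq> {} \<and>
     (start_of A B, x) \<in> (pstep \<delta> (insert 0 Q))\<^sup>* \<and> dead \<delta> (insert 0 Q) x)" (is "?l \<longleftrightarrow> ?r")
proof
  assume ?r
  then obtain Q x where Q: "Q \<subseteq> {1..H * H}" "Q \<noteq> {}" "(start_of A B, x) \<in> (pstep \<delta> (insert 0 Q))\<^sup>*"
    "dead \<delta> (insert 0 Q) x" by blast
  moreover have "finite Q" "0 \<notin> Q" using Q(1) finite_subset by auto
  ultimately show ?l unfolding pos_processes[OF AB] \<delta>_def by blast
next
  assume ?l
  then obtain Q x where Q: "finite Q" "0 \<notin> Q" "Q \<noteq> {}" and
    x: "(start_of A B, x) \<in> (pstep \<delta> (insert 0 Q))\<^sup>*" "dead \<delta> (insert 0 Q) x"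
    unfolding pos_processes[OF AB] \<delta>_def by blast
  let ?Q = "insert 0 Q" and ?St = "states A \<union> states B"
  obtain T where "(start_of A B, x) \<in> pstep \<delta> ?Q ^^ T" using x(1) rtrancl_imp_relpow by blast
  then obtain xs where xs: "xs 0 = start_of A B" "xs T = x" "\<And>t. t < T \<Longrightarrow> (xs t, xs (Suc t)) \<in> pstep \<delta> ?Q"
    unfolding relpow_fun_conv by blast
  have reach: "(start_of A B, xs t) \<in> (pstep \<delta> ?Q)\<^sup>*" if "t \<le> T" for t
    using that
  proof (induction t)
    case (Suc t)
    then show ?case using rtrancl.rtrancl_into_rtrancl[OF _ xs(3)[of t]] by simp
  qed (simp add: xs(1))
  have types: "typed A B Q (xs t)" if "t \<le> T" for t
    using psteps_typed[OF AB _ typed_start[OF AB Q(2)] Q(2)] reach[OF that] unfolding \<delta>_def by blast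
  have ne: "init A \<noteq> init B" using disjoint[OF AB] init_in[OF AB] by auto
  have "card {init A, init B} \<le> card ?St"
    by (rule card_mono[OF finite_states[OF AB]]) (use init_in[OF AB] in auto)
  then have H: "2 \<le> H" using ne unfolding H_def by simp
  define poor where "poor p \<longleftrightarrow> card {r \<in> ?Q. xs T r = xs T p} < H" for p
  obtain V u yT where V: "V \<subseteq> ?St" "\<And>q. q \<in> V \<Longrightarrow> u q \<in> ?Q \<and> \<not> poor (u q)"
    "\<And>p. p \<in> ?Q \<Longrightarrow> \<not> poor p \<Longrightarrow> V \<noteq> {}"
    "card (Inl ` {p \<in> ?Q. poor p} \<union> Inr ` V) \<le> H * H"
    "(case_sum (xs 0) (\<lambda>q. xs 0 (u q)), yT) \<in> (pstep \<delta> (Inl ` {p \<in> ?Q. poor p} \<union> Inr ` V))\<^sup>*"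
    "dead \<delta> (Inl ` {p \<in> ?Q. poor p} \<union> Inr ` V) yT"
  proof (rule cutoff[where Q = ?Q and St = ?St and T = T and xs = xs and \<delta> = \<delta>])
    show "xs t p \<in> ?St" if "t \<le> T" "p \<in> ?Q" for t p
      using types[OF that(1)] that(2) unfolding typed_def by auto
  qed (use Q(1) finite_states[OF AB] H x(2) xs in \<open>auto simp: H_def poor_def\<close>)
  let ?Q' = "Inl ` {p \<in> ?Q. poor p} \<union> Inr ` V"
  have "xs T r \<noteq> xs T 0" if "r \<in> Q" for r
  proof -
    have "xs T r \<in> states B" "xs T 0 \<in> states A" using types[of T] that unfolding typed_def by auto
    then show ?thesis using disjoint[OF AB] by (metis disjoint_iff)
  qed
  then have "{r \<in> ?Q. xs T r = xs T 0} = {0}" by auto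
  then have poor0: "poor 0" using H unfolding poor_def by simp
  define Q'' where "Q'' = ?Q' - {Inl 0}"
  have fin: "finite ?Q'" using Q(1) finite_subset[OF V(1) finite_states[OF AB]] by auto
  obtain h where h: "bij_betw h {1..card Q''} Q''"
    using ex_bij_betw_nat_finite_1[of Q''] fin unfolding Q''_def by auto
  define g where "g r = (if r = 0 then Inl 0 else h r)" for r
  let ?N = "insert 0 {1..card Q''}"
  have "bij_betw g {1..card Q''} Q''" using h by (rule bij_betw_cong[THEN iffD1, rotated]) (auto simp: g_def)
  moreover have "bij_betw g {0} {Inl 0}" by (simp add: g_def)
  ultimately have "bij_betw g ({0} \<union> {1..card Q''}) ({Inl 0} \<union> Q'')"
    by (intro bij_betw_combine) (auto simp: Q''_def)
  moreover have "{Inl 0} \<union> Q'' = ?Q'" using poor0 unfolding Q''_def by auto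
  ultimately have g: "bij_betw g ?N ?Q'" by simp
  \<comment> \<open>The default \<open>init B\<close> outside \<open>?N\<close> agrees with
    \<open>start_of\<close>. A lingering process starts in \<open>init B\<close> as well:
    \<open>u q\<close> is not poor, hence different from the A-process.\<close>
  have start: "pull ?N g (init B) (case_sum (xs 0) (\<lambda>q. xs 0 (u q))) = start_of A B"
  proof
    fix r
    show "pull ?N g (init B) (case_sum (xs 0) (\<lambda>q. xs 0 (u q))) r = start_of A B r"
    proof (cases "r \<in> {1..card Q''}")
      case False
      then show ?thesis by (auto simp: pull_def start_of_def[OF AB] g_def xs(1))
    next
      case True
      then have "h r \<in> Q''" using h unfolding bij_betw_def by auto
      then consider p where "h r = Inl p" "p \<in> Q" | q where "h r = Inr q" "q \<in> V"
        unfolding Q''_def by auto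
      then have "case_sum (xs 0) (\<lambda>q. xs 0 (u q)) (h r) = init B"
      proof cases
        case 1
        then show ?thesis using xs(1) start_of_B[OF AB Q(2)] by simp
      next
        case 2
        then have "u q \<in> Q" using V(2)[of q] poor0 by auto
        then show ?thesis using 2 xs(1) start_of_B[OF AB Q(2)] by simp
      qed
      then show ?thesis using True by (auto simp: pull_def start_of_def[OF AB] g_def)
    qed
  qed
  \<comment> \<open>A B-process is either kept or, not being poor, guarantees that some state has a
    lingering process.\<close>
  have "Q'' \<noteq> {}"
  proof -
    obtain p where p: "p \<in> Q" using Q(3) by blast
    then have "p \<noteq> 0" using Q(2) by metis
    then show ?thesis using p V(3)[of p] unfolding Q''_def by (cases "poor p") auto
  qed
  then have "{1..card Q''} \<noteq> {}" using fin unfolding Q''_def by (auto simp: Suc_le_eq card_gt_0_iff)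
  moreover have "{1..card Q''} \<subseteq> {1..H * H}"
  proof -
    have "card Q'' \<le> card ?Q'" unfolding Q''_def by (intro card_mono fin) auto
    then show ?thesis using V(4) by auto
  qed
  moreover have "(start_of A B, pull ?N g (init B) yT) \<in> (pstep \<delta> ?N)\<^sup>*"
    using pull_psteps[OF g V(5)] start by metis
  moreover have "dead \<delta> ?N (pull ?N g (init B) yT)"
    by (rule pull_dead[OF g V(6)])
  ultimately show ?r by blast
qed

section \<open>Reading encodings\<close>

text \<open>The end position is an argument, so that concatenation of words becomes composition of
  relations between positions.\<close>

definition occurs :: "bool list \<Rightarrow> nat \<Rightarrow> bool list \<Rightarrow> nat \<Rightarrow> bool" where
  "occurs w x u y \<longleftrightarrow> y = x + length u \<and> y \<le> length w \<and> (\<forall>i<length u. w ! (x + i) = u ! i)"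

lemma occurs_append: "occurs w x (u @ v) y \<longleftrightarrow> (\<exists>z. occurs w x u z \<and> occurs w z v y)"
proof
  assume a: "occurs w x (u @ v) y"
  then have "w ! (x + i) = (u @ v) ! i" if "i < length u + length v" for i
    using that unfolding occurs_def by simp
  from this[of "length u + _"] this have "occurs w x u (x + length u)" "occurs w (x + length u) v y"
    using a unfolding occurs_def by (auto simp: nth_append add.assoc)
  then show "\<exists>z. occurs w x u z \<and> occurs w z v y" by blast
next
  assume "\<exists>z. occurs w x u z \<and> occurs w z v y"
  then have uv: "occurs w x u (x + length u)" "occurs w (x + length u) v y" unfolding occurs_def by auto
  have "w ! (x + i) = (u @ v) ! i" if "i < length u + length v" for i
  proof (cases "i < length u")
    case False
    then have k: "i - length u < length v" "x + length u + (i - length u) = x + i" using that by auto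
    have "w ! (x + length u + (i - length u)) = v ! (i - length u)"
      using uv(2) k(1) unfolding occurs_def by blast
    then show ?thesis using False unfolding k(2) by (simp add: nth_append)
  qed (use uv(1) in \<open>simp add: occurs_def nth_append\<close>)
  then show "occurs w x (u @ v) y" using uv unfolding occurs_def by simp
qed

lemma occurs_Nil: "occurs w x [] y \<longleftrightarrow> y = x \<and> x \<le> length w"
  unfolding occurs_def by auto

lemma occurs_single: "occurs w x [b] y \<longleftrightarrow> y = Suc x \<and> x < length w \<and> w ! x = b"
  unfolding occurs_def by auto

lemma occurs_Cons: "occurs w x (b # u) y \<longleftrightarrow> x < length w \<and> w ! x = b \<and> occurs w (Suc x) u y"
  using occurs_append[of w x "[b]" u y] by (auto simp: occurs_single)

lemma occurs_whole: "occurs w 0 u (length w) \<longleftrightarrow> w = u"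
  unfolding occurs_def by (auto simp: list_eq_iff_nth_eq)

lemma occurs_le: "occurs w x u y \<Longrightarrow> x \<le> y \<and> y \<le> length w"
  unfolding occurs_def by auto

lemma occurs_nat:
  "occurs w x (enc_nat k) y \<longleftrightarrow> y = x + k + 1 \<and> y \<le> length w \<and> (\<forall>i<k. w ! (x + i)) \<and> \<not> w ! (x + k)"
  unfolding occurs_def enc_nat_def by (auto simp: nth_append less_Suc_eq)

definition bit1 :: "inst \<Rightarrow> nat \<Rightarrow> bool" where
  "bit1 I x \<longleftrightarrow> x < length (word I) \<and> word I ! x"

definition bit0 :: "inst \<Rightarrow> nat \<Rightarrow> bool" where
  "bit0 I x \<longleftrightarrow> x < length (word I) \<and> \<not> word I ! x"

definition nat_at :: "inst \<Rightarrow> nat \<Rightarrow> nat \<Rightarrow> bool" where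
  "nat_at I x k \<longleftrightarrow> (\<forall>i\<le>bound I. i < k \<longrightarrow> bit1 I (x + i)) \<and> bit0 I (x + k)"

text \<open>A list of unknown length is read as a walk over the boundaries between its elements; the
  shape is that of \<open>step_rel\<close>, so that \<open>checks_walk\<close> applies.\<close>

definition walk :: "inst \<Rightarrow> (nat \<Rightarrow> nat \<Rightarrow> bool) \<Rightarrow> nat \<Rightarrow> nat \<Rightarrow> bool" where
  "walk I R x y \<longleftrightarrow> (\<exists>j\<le>bound I. (x, y) \<in> {(m, m'). m' \<le> bound I \<and> R m m'} ^^ j)"

text \<open>In \<open>enc_list\<close> an element is announced by True and the end by False;
  \<open>R\<close> reads one element together with its announcement.\<close>

definition all_list :: "inst \<Rightarrow> (nat \<Rightarrow> nat \<Rightarrow> bool) \<Rightarrow> nat \<Rightarrow> nat \<Rightarrow> bool" where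
  "all_list I R x y \<longleftrightarrow> (\<exists>z\<le>bound I. walk I R x z \<and> bit0 I z \<and> y = Suc z)"

text \<open>The witness splits the list: a walk leads to it, \<open>S\<close> reads it, and what
  follows is read as a list again.\<close>

definition ex_list :: "inst \<Rightarrow> (nat \<Rightarrow> nat \<Rightarrow> bool) \<Rightarrow> (nat \<Rightarrow> nat \<Rightarrow> bool) \<Rightarrow> nat \<Rightarrow> nat \<Rightarrow> bool" where
  "ex_list I R S x y \<longleftrightarrow> (\<exists>m\<le>bound I. \<exists>m'\<le>bound I. walk I R x m \<and> S m m' \<and> all_list I R m' y)"

definition edge_at :: "inst \<Rightarrow> (nat \<Rightarrow> nat \<Rightarrow> bool) \<Rightarrow> nat \<Rightarrow> nat \<Rightarrow> bool" where
  "edge_at I \<chi> m m' \<longleftrightarrow> bit1 I m \<and> (\<exists>p\<le>bound I. \<exists>q\<le>bound I. nat_at I (m + 1) p \<and>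
     nat_at I (m + p + 2) q \<and> m' = m + p + q + 3 \<and> \<chi> p q)"

definition guard_at :: "inst \<Rightarrow> nat \<Rightarrow> nat \<Rightarrow> nat set" where
  "guard_at I N s = {l. l < N \<and> bit1 I (s + l)}"

definition block_at :: "inst \<Rightarrow> nat \<Rightarrow> (nat set \<Rightarrow> nat \<Rightarrow> nat \<Rightarrow> bool) \<Rightarrow> nat \<Rightarrow> nat \<Rightarrow> bool" where
  "block_at I N L m m' \<longleftrightarrow> bit1 I m \<and> m + 1 + N \<le> length (word I) \<and>
     L (guard_at I N (m + 1)) (m + 1 + N) m'"

definition all_edges :: "inst \<Rightarrow> nat \<Rightarrow> (nat set \<Rightarrow> nat \<Rightarrow> nat \<Rightarrow> bool) \<Rightarrow> nat \<Rightarrow> nat \<Rightarrow> bool" where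
  "all_edges I N \<chi> = all_list I (block_at I N (\<lambda>g. all_list I (edge_at I (\<chi> g))))"

text \<open>One edge in one block is tested, and everything around it is merely parsed. This is the
  positive counterpart of a negated \<open>all_edges\<close>.\<close>

definition ex_edge :: "inst \<Rightarrow> nat \<Rightarrow> (nat set \<Rightarrow> nat \<Rightarrow> nat \<Rightarrow> bool) \<Rightarrow> nat \<Rightarrow> nat \<Rightarrow> bool" where
  "ex_edge I N \<chi> = ex_list I (block_at I N (\<lambda>_. all_list I (edge_at I (\<lambda>_ _. True))))
     (block_at I N (\<lambda>g. ex_list I (edge_at I (\<lambda>_ _. True)) (edge_at I (\<chi> g))))"

definition enc_block :: "nat \<Rightarrow> nat set \<times> (nat \<times> nat) list \<Rightarrow> bool list" where
  "enc_block n = (\<lambda>(g, es). enc_set n g @ enc_list enc_edge es)"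

definition delta_of :: "listing \<Rightarrow> (nat \<times> nat set \<times> nat) set" where
  "delta_of bs = {(p, g, q). \<exists>es. (g, es) \<in> set bs \<and> (p, q) \<in> set es}"

definition guards_below :: "nat \<Rightarrow> listing \<Rightarrow> bool" where
  "guards_below n bs \<longleftrightarrow> (\<forall>b\<in>set bs. fst b \<subseteq> {..<n})"

definition encoding :: "nat \<Rightarrow> nat \<Rightarrow> nat \<Rightarrow> listing \<Rightarrow> nat \<Rightarrow> listing \<Rightarrow> bool list" where
  "encoding a b i bsA j bsB =
     enc_nat a @ enc_nat b @ enc_template (a + b) i bsA @ enc_template (a + b) j bsB"

lemma enc_template_block: "enc_template n i bs = enc_nat i @ enc_list (enc_block n) bs"
  unfolding enc_template_def enc_block_def by simp

lemma enc_list_simps: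
  "enc_list f [] = [False]" "enc_list f (a # as) = True # f a @ enc_list f as"
  unfolding enc_list_def by simp_all

lemma enc_list_append: "enc_list f (as @ bs) = concat (map (\<lambda>x. True # f x) as) @ enc_list f bs"
  unfolding enc_list_def by simp

lemma delta_of_all:
  "(\<forall>(p, g, q)\<in>delta_of bs. \<chi> g p q) \<longleftrightarrow> (\<forall>c\<in>set bs. \<forall>e\<in>set (snd c). \<chi> (fst c) (fst e) (snd e))"
proof -
  have "(\<forall>(p, g, q)\<in>delta_of bs. \<chi> g p q) \<longleftrightarrow> (\<forall>p g q es. (g, es) \<in> set bs \<longrightarrow> (p, q) \<in> set es \<longrightarrow> \<chi> g p q)"
    unfolding delta_of_def by blast
  then show ?thesis by (simp add: Ball_def) blast
qed

lemma delta_of_ex: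
  "(\<exists>(p, g, q)\<in>delta_of bs. \<chi> g p q) \<longleftrightarrow> (\<exists>c\<in>set bs. \<exists>e\<in>set (snd c). \<chi> (fst c) (fst e) (snd e))"
  using delta_of_all[of bs "\<lambda>g p q. \<not> \<chi> g p q"] by (auto simp: split_beta)

context
  fixes I :: inst
  assumes bound: "length (word I) \<le> bound I"
begin

abbreviation "occ \<equiv> occurs (word I)"

lemma nat_at_iff: "nat_at I x k \<longleftrightarrow> occ x (enc_nat k) (x + k + 1)"
  unfolding nat_at_def occurs_nat bit1_def bit0_def using bound by fastforce

lemma walk_iff:
  assumes R: "\<And>m m'. R m m' \<longleftrightarrow> (\<exists>a. \<phi> a \<and> occ m (True # f a) m')" and x: "x \<le> length (word I)"
  shows "walk I R x y \<longleftrightarrow> (\<exists>as. (\<forall>a\<in>set as. \<phi> a) \<and> occ x (concat (map (\<lambda>a. True # f a) as)) y)"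
proof -
  have 1: "\<exists>as. (\<forall>a\<in>set as. \<phi> a) \<and> occ x (concat (map (\<lambda>a. True # f a) as)) y"
    if "(x, y) \<in> {(m, m'). m' \<le> bound I \<and> R m m'} ^^ j" "x \<le> length (word I)" for j x
    using that
  proof (induction j arbitrary: x)
    case 0
    then show ?case by (intro exI[of _ "[]"]) (auto simp: occurs_Nil)
  next
    case (Suc j)
    obtain m where m: "R x m" "(m, y) \<in> {(m, m'). m' \<le> bound I \<and> R m m'} ^^ j"
      using relpow_Suc_D2[OF Suc.prems(1)] by blast
    obtain a where a: "\<phi> a" "occ x (True # f a) m" using m(1) R by blast
    obtain as where "\<forall>a\<in>set as. \<phi> a" "occ m (concat (map (\<lambda>a. True # f a) as)) y"
      using Suc.IH[OF m(2)] occurs_le[OF a(2)] by blast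
    then show ?case
      using a by (intro exI[of _ "a # as"]) (auto simp: occurs_Cons occurs_append)
  qed
  have 2: "(x, y) \<in> {(m, m'). m' \<le> bound I \<and> R m m'} ^^ length as"
    if "\<forall>a\<in>set as. \<phi> a" "occ x (concat (map (\<lambda>a. True # f a) as)) y" for as x
    using that
  proof (induction as arbitrary: x)
    case (Cons a as)
    then obtain m where m: "occ x (True # f a) m" "occ m (concat (map (\<lambda>a. True # f a) as)) y"
      by (auto simp: occurs_append[of _ _ "True # f a", simplified])
    then have "R x m" "m \<le> bound I" using R Cons.prems(1) occurs_le[OF m(1)] bound by auto
    then have "(x, m) \<in> {(m, m'). m' \<le> bound I \<and> R m m'}" by simp
    moreover have "(m, y) \<in> {(m, m'). m' \<le> bound I \<and> R m m'} ^^ length as"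
      using Cons.IH[OF _ m(2)] Cons.prems(1) by simp
    ultimately show ?case unfolding length_Cons by (rule relpow_Suc_I2)
  qed (auto simp: occurs_Nil)
  \<comment> \<open>Each element contributes at least its announcing bit, so a list inside the word
    has no more elements than the walk may have steps.\<close>
  have "length as \<le> bound I" if "occ x (concat (map (\<lambda>a. True # f a) as)) y" for as
  proof -
    have "length as \<le> length (concat (map (\<lambda>a. True # f a) as))" by (induction as) auto
    then show ?thesis using that bound unfolding occurs_def by linarith
  qed
  then show ?thesis unfolding walk_def using 1[OF _ x] 2 by blast
qed

lemma all_list_iff:
  assumes R: "\<And>m m'. R m m' \<longleftrightarrow> (\<exists>a. \<phi> a \<and> occ m (True # f a) m')" and x: "x \<le> length (word I)"
  shows "all_list I R x y \<longleftrightarrow> (\<exists>as. (\<forall>a\<in>set as. \<phi> a) \<and> occ x (enc_list f as) y)"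
proof -
  have "bit0 I z \<and> y = Suc z \<longleftrightarrow> occ z [False] y" for z
    by (auto simp: bit0_def occurs_single)
  moreover have "z \<le> bound I" if "occ z [False] y" for z
    using that bound by (auto simp: occurs_single)
  ultimately show ?thesis
    unfolding all_list_def walk_iff[OF R x] enc_list_def occurs_append by blast
qed

lemma ex_list_iff:
  assumes R: "\<And>m m'. R m m' \<longleftrightarrow> (\<exists>a. \<phi> a \<and> occ m (True # f a) m')" and x: "x \<le> length (word I)"
    and S: "\<And>m m'. S m m' \<longleftrightarrow> (\<exists>a. \<phi> a \<and> \<psi> a \<and> occ m (True # f a) m')"
  shows "ex_list I R S x y \<longleftrightarrow> (\<exists>as. (\<forall>a\<in>set as. \<phi> a) \<and> (\<exists>a\<in>set as. \<psi> a) \<and> occ x (enc_list f as) y)"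
    (is "?l \<longleftrightarrow> ?r")
proof
  assume ?l
  then obtain m m' where m: "walk I R x m" "S m m'" "all_list I R m' y" unfolding ex_list_def by blast
  obtain as where as: "\<forall>a\<in>set as. \<phi> a" "occ x (concat (map (\<lambda>a. True # f a) as)) m"
    using m(1) walk_iff[OF R x] by blast
  obtain a where a: "\<phi> a" "\<psi> a" "occ m (True # f a) m'" using m(2) S by blast
  have "m' \<le> length (word I)" using occurs_le[OF a(3)] by simp
  then obtain bs where bs: "\<forall>a\<in>set bs. \<phi> a" "occ m' (enc_list f bs) y"
    using m(3) all_list_iff[OF R] by blast
  have "occ x (enc_list f (as @ a # bs)) y"
    unfolding enc_list_append enc_list_simps using as(2) a(3) bs(2) by (auto simp: occurs_append occurs_Cons)
  then show ?r using as(1) bs(1) a(1,2) by (intro exI[of _ "as @ a # bs"]) auto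
next
  assume ?r
  then obtain cs a where cs: "\<forall>a\<in>set cs. \<phi> a" "a \<in> set cs" "\<psi> a" "occ x (enc_list f cs) y" by blast
  then obtain as bs where ab: "cs = as @ a # bs" by (meson split_list)
  have "occ x (concat (map (\<lambda>a. True # f a) as) @ (True # f a) @ enc_list f bs) y"
    using cs(4) unfolding ab enc_list_append enc_list_simps by simp
  then obtain m m' where m: "occ x (concat (map (\<lambda>a. True # f a) as)) m" "occ m (True # f a) m'"
    "occ m' (enc_list f bs) y"
    unfolding occurs_append by blast
  have le: "m \<le> length (word I)" "m' \<le> length (word I)" using occurs_le[OF m(1)] occurs_le[OF m(2)] by auto
  have "walk I R x m" using walk_iff[OF R x] m(1) cs(1) unfolding ab by (metis UnCI set_append)
  moreover have "S m m'" using S m(2) cs unfolding ab by auto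
  moreover have "all_list I R m' y" using all_list_iff[OF R le(2)] m(3) cs(1) unfolding ab by fastforce
  ultimately show ?l unfolding ex_list_def using le bound by (meson order_trans)
qed

lemma edge_at_iff:
  "edge_at I \<chi> m m' \<longleftrightarrow> (\<exists>e. \<chi> (fst e) (snd e) \<and> occ m (True # enc_edge e) m')"
proof -
  have "occ m (True # enc_edge (p, q)) m' \<longleftrightarrow> bit1 I m \<and> nat_at I (m + 1) p \<and>
     nat_at I (m + p + 2) q \<and> m' = m + p + q + 3" for p q
    unfolding nat_at_iff occurs_Cons enc_edge_def bit1_def by (auto simp: occurs_append occurs_nat)
  then have eq: "(\<exists>e. \<chi> (fst e) (snd e) \<and> occ m (True # enc_edge e) m') \<longleftrightarrow> (\<exists>p q. \<chi> p q \<and> bit1 I m \<and>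
     nat_at I (m + 1) p \<and> nat_at I (m + p + 2) q \<and> m' = m + p + q + 3)" by simp
  have "k \<le> bound I" if "nat_at I x k" for x k
    using occurs_le[OF that[unfolded nat_at_iff]] bound by linarith
  then show ?thesis unfolding edge_at_def eq by blast
qed

text \<open>A characteristic vector determines a guard only among the subsets of
  \<open>{..<N}\<close>; with this restriction the guard is a function of its position in the
  word.\<close>

lemma block_at_iff:
  assumes L: "\<And>g x. x \<le> length (word I) \<Longrightarrow> L g x y \<longleftrightarrow> (\<exists>es. P g es \<and> occ x (enc_list enc_edge es) y)"
  shows "block_at I N L m y \<longleftrightarrow> (\<exists>c. (fst c \<subseteq> {..<N} \<and> P (fst c) (snd c)) \<and> occ m (True # enc_block N c) y)"
proof -
  have g: "occ x (enc_set N g) z \<and> g \<subseteq> {..<N} \<longleftrightarrow> z = x + N \<and> z \<le> length (word I) \<and> g = guard_at I N x" for x z g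
    unfolding occurs_def enc_set_def guard_at_def bit1_def by auto
  have "(\<exists>c. (fst c \<subseteq> {..<N} \<and> P (fst c) (snd c)) \<and> occ m (True # enc_block N c) y) \<longleftrightarrow>
    bit1 I m \<and> (\<exists>g es z. (occ (m + 1) (enc_set N g) z \<and> g \<subseteq> {..<N}) \<and> P g es \<and> occ z (enc_list enc_edge es) y)"
    unfolding enc_block_def occurs_Cons bit1_def by (auto simp: occurs_append)
  also have "\<dots> \<longleftrightarrow> block_at I N L m y"
    unfolding g block_at_def using L by auto
  finally show ?thesis by simp
qed

lemma all_edges_iff:
  assumes x: "x \<le> length (word I)"
  shows "all_edges I N \<chi> x y \<longleftrightarrow> (\<exists>bs. guards_below N bs \<and> (\<forall>(p, g, q)\<in>delta_of bs. \<chi> g p q) \<and>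
    occ x (enc_list (enc_block N) bs) y)"
proof -
  have "block_at I N (\<lambda>g. all_list I (edge_at I (\<chi> g))) m m' \<longleftrightarrow>
    (\<exists>c. (fst c \<subseteq> {..<N} \<and> (\<forall>e\<in>set (snd c). \<chi> (fst c) (fst e) (snd e))) \<and> occ m (True # enc_block N c) m')" for m m'
    by (rule block_at_iff) (rule all_list_iff[OF edge_at_iff])
  from all_list_iff[OF this x] show ?thesis
    unfolding all_edges_def guards_below_def delta_of_all by (simp only: ball_conj_distrib conj_assoc)
qed

lemma ex_edge_iff:
  assumes x: "x \<le> length (word I)"
  shows "ex_edge I N \<chi> x y \<longleftrightarrow> (\<exists>bs. guards_below N bs \<and> (\<exists>(p, g, q)\<in>delta_of bs. \<chi> g p q) \<and>
    occ x (enc_list (enc_block N) bs) y)"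
proof -
  have R: "block_at I N (\<lambda>_. all_list I (edge_at I (\<lambda>_ _. True))) m m' \<longleftrightarrow>
    (\<exists>c. fst c \<subseteq> {..<N} \<and> occ m (True # enc_block N c) m')" for m m'
    using block_at_iff[of "\<lambda>_. all_list I (edge_at I (\<lambda>_ _. True))" m' "\<lambda>_ _. True" N m]
      all_list_iff[OF edge_at_iff[of "\<lambda>_ _. True"]] by simp
  have "block_at I N (\<lambda>g. ex_list I (edge_at I (\<lambda>_ _. True)) (edge_at I (\<chi> g))) m m' \<longleftrightarrow>
    (\<exists>c. (fst c \<subseteq> {..<N} \<and> (\<exists>e\<in>set (snd c). \<chi> (fst c) (fst e) (snd e))) \<and> occ m (True # enc_block N c) m')" for m m'
  proof (rule block_at_iff)
    show "ex_list I (edge_at I (\<lambda>_ _. True)) (edge_at I (\<chi> g)) z m' \<longleftrightarrow>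
      (\<exists>es. (\<exists>e\<in>set es. \<chi> g (fst e) (snd e)) \<and> occ z (enc_list enc_edge es) m')" if "z \<le> length (word I)" for g z
    proof -
      have "edge_at I (\<chi> g) m m' \<longleftrightarrow> (\<exists>e. True \<and> \<chi> g (fst e) (snd e) \<and> occ m (True # enc_edge e) m')" for m m'
        by (simp only: edge_at_iff simp_thms)
      from ex_list_iff[OF edge_at_iff[of "\<lambda>_ _. True"] that this] show ?thesis by simp
    qed
  qed
  then have "block_at I N (\<lambda>g. ex_list I (edge_at I (\<lambda>_ _. True)) (edge_at I (\<chi> g))) m m' \<longleftrightarrow>
    (\<exists>c. fst c \<subseteq> {..<N} \<and> (\<exists>e\<in>set (snd c). \<chi> (fst c) (fst e) (snd e)) \<and> occ m (True # enc_block N c) m')" for m m'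
    by auto
  from ex_list_iff[OF R x this] show ?thesis
    unfolding ex_edge_def guards_below_def delta_of_ex .
qed

end

section \<open>Unique readability of encodings\<close>

lemma enc_nat_inject: "enc_nat k @ u = enc_nat k' @ v \<longleftrightarrow> k = k' \<and> u = v"
proof (induction k arbitrary: k')
  case 0
  then show ?case by (cases k') (auto simp: enc_nat_def)
next
  case (Suc k)
  then show ?case by (cases k') (auto simp: enc_nat_def)
qed

text \<open>Cancellation in front of arbitrary suffixes expresses that a code is prefix-free, which
  is what passes from elements to lists. The set \<open>D\<close> is there for the guards, which are
  determined by their vectors only below the number of states.\<close>

lemma enc_list_inject:
  assumes "\<And>a b u v. a \<in> D \<Longrightarrow> b \<in> D \<Longrightarrow> f a @ u = f b @ v \<Longrightarrow> a = b \<and> u = v"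
    and "set as \<subseteq> D" "set bs \<subseteq> D" "enc_list f as @ u = enc_list f bs @ v"
  shows "as = bs \<and> u = v"
  using assms(2-)
proof (induction as arbitrary: bs)
  case Nil
  then show ?case by (cases bs) (auto simp: enc_list_simps)
next
  case (Cons a as)
  then obtain b cs where bs: "bs = b # cs" by (cases bs) (auto simp: enc_list_simps)
  then have "f a @ (enc_list f as @ u) = f b @ (enc_list f cs @ v)"
    using Cons.prems by (simp add: enc_list_simps)
  then show ?case using assms(1)[of a b] Cons bs by auto
qed

lemma enc_block_inject:
  assumes "fst c \<subseteq> {..<n}" "fst d \<subseteq> {..<n}" "enc_block n c @ u = enc_block n d @ v"
  shows "c = d \<and> u = v"
proof -
  obtain g es h fs where cd: "c = (g, es)" "d = (h, fs)" by (cases c, cases d)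
  have "enc_set n g = enc_set n h" and l: "enc_list enc_edge es @ u = enc_list enc_edge fs @ v"
    using assms(3) unfolding cd enc_block_def by (auto simp: enc_set_def)
  then have "g = h" using assms(1,2) unfolding cd enc_set_def by (auto simp: list_eq_iff_nth_eq)
  moreover have "es = fs \<and> u = v"
  proof (rule enc_list_inject[where D = UNIV and f = enc_edge])
    show "a = b \<and> u = v" if "enc_edge a @ u = enc_edge b @ v" for a b u v
      using that unfolding enc_edge_def by (cases a, cases b) (auto simp: enc_nat_inject)
  qed (use l in auto)
  ultimately show ?thesis unfolding cd by simp
qed

text \<open>The numbers in front are decoded first, because the length of the guard vectors depends
  on \<open>a + b\<close>.\<close>

lemma encoding_inject:
  assumes e: "encoding a b i bsA j bsB = encoding a' b' i' bsA' j' bsB'"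
    and g: "guards_below (a + b) bsA" "guards_below (a + b) bsB" "guards_below (a' + b') bsA'" "guards_below (a' + b') bsB'"
  shows "a = a' \<and> b = b' \<and> i = i' \<and> bsA = bsA' \<and> j = j' \<and> bsB = bsB'"
proof -
  have 1: "a = a'" "b = b'" "i = i'" and
    2: "enc_list (enc_block (a + b)) bsA @ enc_nat j @ enc_list (enc_block (a + b)) bsB =
      enc_list (enc_block (a + b)) bsA' @ enc_nat j' @ enc_list (enc_block (a + b)) bsB'"
  proof -
    have *: "a = a' \<and> b = b' \<and> i = i' \<and>
      enc_list (enc_block (a + b)) bsA @ enc_nat j @ enc_list (enc_block (a + b)) bsB =
      enc_list (enc_block (a' + b')) bsA' @ enc_nat j' @ enc_list (enc_block (a' + b')) bsB'"
      using e unfolding encoding_def enc_template_block append_assoc enc_nat_inject .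
    then show "a = a'" "b = b'" "i = i'" by blast+
    with * show "enc_list (enc_block (a + b)) bsA @ enc_nat j @ enc_list (enc_block (a + b)) bsB =
      enc_list (enc_block (a + b)) bsA' @ enc_nat j' @ enc_list (enc_block (a + b)) bsB'" by auto
  qed
  have l: "cs = ds \<and> u = v" if "guards_below (a + b) cs" "guards_below (a + b) ds"
    "enc_list (enc_block (a + b)) cs @ u = enc_list (enc_block (a + b)) ds @ v" for cs ds u v
  proof (rule enc_list_inject[where D = "{c. fst c \<subseteq> {..<a + b}}", OF _ _ _ that(3)])
    show "c = d \<and> u = v" if "c \<in> {c. fst c \<subseteq> {..<a + b}}" "d \<in> {c. fst c \<subseteq> {..<a + b}}"
      "enc_block (a + b) c @ u = enc_block (a + b) d @ v" for c d u v
      using that by (intro enc_block_inject) simp_all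
  qed (use that(1,2) in \<open>simp_all add: guards_below_def subset_iff\<close>)
  have 3: "bsA = bsA'" "j = j'" "enc_list (enc_block (a + b)) bsB = enc_list (enc_block (a + b)) bsB'"
  proof -
    have *: "bsA = bsA' \<and> enc_nat j @ enc_list (enc_block (a + b)) bsB =
        enc_nat j' @ enc_list (enc_block (a + b)) bsB'"
      by (rule l[OF _ _ 2]) (use g 1 in simp_all)
    then show "bsA = bsA'" by simp
    show "j = j'" "enc_list (enc_block (a + b)) bsB = enc_list (enc_block (a + b)) bsB'"
      using conjunct2[OF *] unfolding enc_nat_inject by simp_all
  qed
  have "bsB = bsB' \<and> ([] :: bool list) = []"
    by (rule l) (use g 1 3 in simp_all)
  then show ?thesis using 1 3 by simp
qed

text \<open>Every formula about the input guesses a parse of its own. Encodings are uniquely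
  readable, so all these formulas speak of the same pair of templates.\<close>

definition doc :: "inst \<Rightarrow> (nat \<Rightarrow> nat \<Rightarrow> nat \<Rightarrow> nat \<Rightarrow> bool) \<Rightarrow> (nat \<Rightarrow> nat \<Rightarrow> nat \<Rightarrow> nat \<Rightarrow> bool) \<Rightarrow>
    (nat \<Rightarrow> nat \<Rightarrow> nat \<Rightarrow> nat \<Rightarrow> bool) \<Rightarrow> bool" where
  "doc I LA LB \<kappa> \<longleftrightarrow> (\<exists>a\<le>bound I. \<exists>b\<le>bound I. \<exists>i\<le>bound I. \<exists>j\<le>bound I. \<exists>y\<le>bound I.
     nat_at I 0 a \<and> nat_at I (a + 1) b \<and> nat_at I (a + b + 2) i \<and> LA a b (a + b + i + 3) y \<and>
     nat_at I y j \<and> LB a b (y + j + 1) (length (word I)) \<and> \<kappa> a b i j)"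

definition all_deltas :: "inst \<Rightarrow> (nat \<Rightarrow> nat \<Rightarrow> nat set \<Rightarrow> nat \<Rightarrow> nat \<Rightarrow> bool) \<Rightarrow>
    (nat \<Rightarrow> nat \<Rightarrow> nat set \<Rightarrow> nat \<Rightarrow> nat \<Rightarrow> bool) \<Rightarrow> (nat \<Rightarrow> nat \<Rightarrow> nat \<Rightarrow> nat \<Rightarrow> bool) \<Rightarrow> bool" where
  "all_deltas I \<chi>A \<chi>B \<kappa> \<longleftrightarrow> doc I (\<lambda>a b. all_edges I (a + b) (\<chi>A a b)) (\<lambda>a b. all_edges I (a + b) (\<chi>B a b)) \<kappa>"

text \<open>The disjuncts tell which template has the edge; the list of the other one is parsed with
  a trivial condition.\<close>

definition some_delta :: "inst \<Rightarrow> (nat set \<Rightarrow> nat \<Rightarrow> nat \<Rightarrow> bool) \<Rightarrow> bool" where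
  "some_delta I \<chi> \<longleftrightarrow>
     doc I (\<lambda>a b. ex_edge I (a + b) \<chi>) (\<lambda>a b. all_edges I (a + b) (\<lambda>_ _ _. True)) (\<lambda>_ _ _ _. True) \<or>
     doc I (\<lambda>a b. all_edges I (a + b) (\<lambda>_ _ _. True)) (\<lambda>a b. ex_edge I (a + b) \<chi>) (\<lambda>_ _ _ _. True)"

lemma doc_iff:
  assumes bound: "length (word I) \<le> bound I"
    and LA: "\<And>a b x y. x \<le> length (word I) \<Longrightarrow> LA a b x y \<longleftrightarrow> (\<exists>bs. guards_below (a + b) bs \<and> PA a b bs \<and>
      occurs (word I) x (enc_list (enc_block (a + b)) bs) y)"
    and LB: "\<And>a b x y. x \<le> length (word I) \<Longrightarrow> LB a b x y \<longleftrightarrow> (\<exists>bs. guards_below (a + b) bs \<and> PB a b bs \<and>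
      occurs (word I) x (enc_list (enc_block (a + b)) bs) y)"
    and w: "word I = encoding a b i bsA j bsB" "guards_below (a + b) bsA" "guards_below (a + b) bsB"
  shows "doc I LA LB \<kappa> \<longleftrightarrow> PA a b bsA \<and> PB a b bsB \<and> \<kappa> a b i j"
proof
  let ?occ = "occurs (word I)"
  assume "doc I LA LB \<kappa>"
  then obtain a' b' i' j' y where *: "nat_at I 0 a'" "nat_at I (a' + 1) b'" "nat_at I (a' + b' + 2) i'"
    "LA a' b' (a' + b' + i' + 3) y" "nat_at I y j'" "LB a' b' (y + j' + 1) (length (word I))" "\<kappa> a' b' i' j'"
    unfolding doc_def by blast
  note n = nat_at_iff[OF bound]
  have o: "?occ 0 (enc_nat a') (a' + 1)" "?occ (a' + 1) (enc_nat b') (a' + b' + 2)"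
    "?occ (a' + b' + 2) (enc_nat i') (a' + b' + i' + 3)" "?occ y (enc_nat j') (y + j' + 1)"
    using *(1,2,3,5) unfolding n by (simp_all add: eval_nat_numeral)
  obtain cA where cA: "guards_below (a' + b') cA" "PA a' b' cA"
    "?occ (a' + b' + i' + 3) (enc_list (enc_block (a' + b')) cA) y"
    using *(4) LA occurs_le[OF o(3)] by blast
  obtain cB where cB: "guards_below (a' + b') cB" "PB a' b' cB"
    "?occ (y + j' + 1) (enc_list (enc_block (a' + b')) cB) (length (word I))"
    using *(6) LB occurs_le[OF o(4)] by blast
  have "?occ 0 (encoding a' b' i' cA j' cB) (length (word I))"
    unfolding encoding_def enc_template_block append_assoc occurs_append using o cA(3) cB(3) by blast
  then have "encoding a b i bsA j bsB = encoding a' b' i' cA j' cB"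
    unfolding occurs_whole using w(1) by simp
  then have "a = a' \<and> b = b' \<and> i = i' \<and> bsA = cA \<and> j = j' \<and> bsB = cB"
    by (rule encoding_inject) (use w cA cB in auto)
  then show "PA a b bsA \<and> PB a b bsB \<and> \<kappa> a b i j" using cA cB *(7) by simp
next
  let ?occ = "occurs (word I)"
  assume k: "PA a b bsA \<and> PB a b bsB \<and> \<kappa> a b i j"
  have "?occ 0 (encoding a b i bsA j bsB) (length (word I))" unfolding occurs_whole by (rule w(1))
  then obtain x1 x2 x3 y z where o: "?occ 0 (enc_nat a) x1" "?occ x1 (enc_nat b) x2" "?occ x2 (enc_nat i) x3"
    "?occ x3 (enc_list (enc_block (a + b)) bsA) y" "?occ y (enc_nat j) z"
    "?occ z (enc_list (enc_block (a + b)) bsB) (length (word I))"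
    unfolding encoding_def enc_template_block append_assoc occurs_append by blast
  have x: "x1 = a + 1" "x2 = a + b + 2" "x3 = a + b + i + 3" "z = y + j + 1"
    using o unfolding occurs_nat by auto
  have "nat_at I 0 a" "nat_at I (a + 1) b" "nat_at I (a + b + 2) i" "nat_at I y j"
    using o(1,2,3,5) unfolding nat_at_iff[OF bound] x by (simp_all add: eval_nat_numeral)
  moreover have "LA a b (a + b + i + 3) y" "LB a b (y + j + 1) (length (word I))"
    using LA LB o(4,6) occurs_le[OF o(3)] occurs_le[OF o(5)] w(2,3) k unfolding x by blast+
  moreover have "a \<le> bound I" "b \<le> bound I" "i \<le> bound I" "j \<le> bound I" "y \<le> bound I"
    using occurs_le[OF o(3)] occurs_le[OF o(5)] bound unfolding x by linarith+
  ultimately show "doc I LA LB \<kappa>" unfolding doc_def using k by blast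
qed

lemma all_deltas_decode:
  assumes bound: "length (word I) \<le> bound I" and d: "all_deltas I \<chi>A \<chi>B \<kappa>"
  obtains a b i bsA j bsB where "word I = encoding a b i bsA j bsB"
    "guards_below (a + b) bsA" "guards_below (a + b) bsB"
proof -
  let ?occ = "occurs (word I)"
  obtain a b i j y where *: "nat_at I 0 a" "nat_at I (a + 1) b" "nat_at I (a + b + 2) i"
    "all_edges I (a + b) (\<chi>A a b) (a + b + i + 3) y" "nat_at I y j"
    "all_edges I (a + b) (\<chi>B a b) (y + j + 1) (length (word I))"
    using d unfolding all_deltas_def doc_def by blast
  have o: "?occ 0 (enc_nat a) (a + 1)" "?occ (a + 1) (enc_nat b) (a + b + 2)"
    "?occ (a + b + 2) (enc_nat i) (a + b + i + 3)" "?occ y (enc_nat j) (y + j + 1)"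
    using *(1,2,3,5) unfolding nat_at_iff[OF bound] by (simp_all add: eval_nat_numeral)
  obtain bsA where A: "guards_below (a + b) bsA" "?occ (a + b + i + 3) (enc_list (enc_block (a + b)) bsA) y"
    using *(4) all_edges_iff[OF bound] occurs_le[OF o(3)] by blast
  obtain bsB where B: "guards_below (a + b) bsB" "?occ (y + j + 1) (enc_list (enc_block (a + b)) bsB) (length (word I))"
    using *(6) all_edges_iff[OF bound] occurs_le[OF o(4)] by blast
  have "?occ 0 (encoding a b i bsA j bsB) (length (word I))"
    unfolding encoding_def enc_template_block append_assoc occurs_append using o A(2) B(2) by blast
  then have "word I = encoding a b i bsA j bsB" unfolding occurs_whole .
  then show thesis using A(1) B(1) by (rule that)
qed

lemma all_deltas_iff:
  assumes "length (word I) \<le> bound I"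
    and "word I = encoding a b i bsA j bsB" "guards_below (a + b) bsA" "guards_below (a + b) bsB"
  shows "all_deltas I \<chi>A \<chi>B \<kappa> \<longleftrightarrow> (\<forall>(p, g, q)\<in>delta_of bsA. \<chi>A a b g p q) \<and>
    (\<forall>(p, g, q)\<in>delta_of bsB. \<chi>B a b g p q) \<and> \<kappa> a b i j"
  unfolding all_deltas_def
  by (rule doc_iff[OF assms(1) all_edges_iff[OF assms(1)] all_edges_iff[OF assms(1)] assms(2-4)])

lemma some_delta_iff:
  assumes "length (word I) \<le> bound I"
    and "word I = encoding a b i bsA j bsB" "guards_below (a + b) bsA" "guards_below (a + b) bsB"
  shows "some_delta I \<chi> \<longleftrightarrow> (\<exists>(p, g, q)\<in>delta_of bsA \<union> delta_of bsB. \<chi> g p q)"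
proof -
  have "doc I (\<lambda>a b. ex_edge I (a + b) \<chi>) (\<lambda>a b. all_edges I (a + b) (\<lambda>_ _ _. True)) (\<lambda>_ _ _ _. True) \<longleftrightarrow>
    (\<exists>(p, g, q)\<in>delta_of bsA. \<chi> g p q) \<and> (\<forall>(p, g, q)\<in>delta_of bsB. True) \<and> True"
    by (rule doc_iff[OF assms(1) ex_edge_iff[OF assms(1)] all_edges_iff[OF assms(1)] assms(2-4)])
  moreover have "doc I (\<lambda>a b. all_edges I (a + b) (\<lambda>_ _ _. True)) (\<lambda>a b. ex_edge I (a + b) \<chi>) (\<lambda>_ _ _ _. True) \<longleftrightarrow>
    (\<forall>(p, g, q)\<in>delta_of bsA. True) \<and> (\<exists>(p, g, q)\<in>delta_of bsB. \<chi> g p q) \<and> True"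
    by (rule doc_iff[OF assms(1) all_edges_iff[OF assms(1)] ex_edge_iff[OF assms(1)] assms(2-4)])
  ultimately show ?thesis unfolding some_delta_def by (simp add: bex_Un split_beta)
qed

section \<open>Checking deadlock reachability\<close>

lemma data_word: "bit1 I x \<longleftrightarrow> data I 0 (int x) \<in> {2}" "bit0 I x \<longleftrightarrow> data I 0 (int x) \<in> {1}"
  "\<not> bit1 I x \<longleftrightarrow> data I 0 (int x) \<in> {0, 1}"
  by (auto simp: data_def input_tape_def bit1_def bit0_def)

lemma data_sets: "x \<in> now I \<longleftrightarrow> data I 1 (int x) \<in> {2}" "x \<notin> now I \<longleftrightarrow> data I 1 (int x) \<in> {0}"
  "x \<in> later I \<longleftrightarrow> data I 2 (int x) \<in> {2}" "x \<notin> later I \<longleftrightarrow> data I 2 (int x) \<in> {0}"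
  by (auto simp: data_def set_tape_def)

section \<open>Checkability of the atoms and of the parsing formulas\<close>

lemma checks_bit1: "computes d x \<Longrightarrow> checks d (\<lambda>I e. bit1 I (x I e))"
  unfolding data_word by (rule checks_data) auto

lemma checks_not_bit1: "computes d x \<Longrightarrow> checks d (\<lambda>I e. \<not> bit1 I (x I e))"
  unfolding data_word(3) by (rule checks_data) auto

lemma checks_bit0: "computes d x \<Longrightarrow> checks d (\<lambda>I e. bit0 I (x I e))"
  unfolding data_word by (rule checks_data) auto

lemma checks_now: "computes d x \<Longrightarrow> checks d (\<lambda>I e. x I e \<in> now I)"
  unfolding data_sets by (rule checks_data) auto

lemma checks_not_now: "computes d x \<Longrightarrow> checks d (\<lambda>I e. x I e \<notin> now I)"
  unfolding data_sets(2) by (rule checks_data) auto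

lemma checks_later: "computes d x \<Longrightarrow> checks d (\<lambda>I e. x I e \<in> later I)"
  unfolding data_sets by (rule checks_data) auto

lemma checks_not_later: "computes d x \<Longrightarrow> checks d (\<lambda>I e. x I e \<notin> later I)"
  unfolding data_sets(4) by (rule checks_data) auto

text \<open>The negated premise is again a comparison, so the implication is a disjunction of
  checkable predicates.\<close>

lemma checks_less_imp:
  "computes d f \<Longrightarrow> computes d g \<Longrightarrow> checks d \<phi> \<Longrightarrow> checks d (\<lambda>I e. f I e < g I e \<longrightarrow> \<phi> I e)"
  unfolding imp_conv_disj not_less by (intro checks_disj checks_le)

lemma checks_in_guard:
  "computes d N \<Longrightarrow> computes d s \<Longrightarrow> computes d l \<Longrightarrow> checks d (\<lambda>I e. l I e \<in> guard_at I (N I e) (s I e))"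
  unfolding guard_at_def mem_Collect_eq by (intro checks_conj checks_less checks_bit1 computes_add)

lemma checks_not_in_guard:
  "computes d N \<Longrightarrow> computes d s \<Longrightarrow> computes d l \<Longrightarrow> checks d (\<lambda>I e. l I e \<notin> guard_at I (N I e) (s I e))"
  unfolding guard_at_def mem_Collect_eq de_Morgan_conj not_less
  by (intro checks_disj checks_le checks_not_bit1 computes_add)

lemmas checks_basic = checks_conj checks_disj checks_le checks_less checks_eq checks_neq checks_bit1 checks_bit0
  checks_now checks_not_now checks_later checks_not_later checks_less_imp checks_ex checks_all
  checks_in_guard checks_not_in_guard
  computes_add computes_mult computes_Suc computes_length computes_bound computes_const

lemma checks_nat_at:
  assumes x: "computes d x" and k: "computes d k"
  shows "checks d (\<lambda>I e. nat_at I (x I e) (k I e))"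
  unfolding nat_at_def
  by (intro checks_basic computes_mono[OF x] computes_mono[OF k])
    (use computes_two[OF x] in auto)

lemma checks_walk_of:
  assumes "computes d x" "computes d y"
    and "\<And>d' t u. d \<le> d' \<Longrightarrow> computes d' t \<Longrightarrow> computes d' u \<Longrightarrow> checks d' (\<lambda>I e. R I e (t I e) (u I e))"
  shows "checks d (\<lambda>I e. walk I (R I e) (x I e) (y I e))"
  using checks_walk[OF assms] unfolding walk_def step_rel_def .

lemma checks_all_list:
  assumes x: "computes d x" and y: "computes d y"
    and R: "\<And>d' t u. d \<le> d' \<Longrightarrow> computes d' t \<Longrightarrow> computes d' u \<Longrightarrow> checks d' (\<lambda>I e. R I e (t I e) (u I e))"
  shows "checks d (\<lambda>I e. all_list I (R I e) (x I e) (y I e))"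
  unfolding all_list_def
  by (intro checks_basic checks_walk_of R computes_mono[OF x] computes_mono[OF y])
    (use computes_two[OF x] in auto)

lemma checks_ex_list:
  assumes x: "computes d x" and y: "computes d y"
    and R: "\<And>d' t u. d \<le> d' \<Longrightarrow> computes d' t \<Longrightarrow> computes d' u \<Longrightarrow> checks d' (\<lambda>I e. R I e (t I e) (u I e))"
    and S: "\<And>d' t u. d \<le> d' \<Longrightarrow> computes d' t \<Longrightarrow> computes d' u \<Longrightarrow> checks d' (\<lambda>I e. S I e (t I e) (u I e))"
  shows "checks d (\<lambda>I e. ex_list I (R I e) (S I e) (x I e) (y I e))"
  unfolding ex_list_def
  by (intro checks_basic checks_walk_of checks_all_list R S computes_mono[OF x] computes_mono[OF y])
    (use computes_two[OF x] in \<open>auto elim: computes_mono\<close>)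

lemma checks_edge_at:
  assumes m: "computes d m" and m': "computes d m'"
    and \<chi>: "\<And>d' p q. d \<le> d' \<Longrightarrow> computes d' p \<Longrightarrow> computes d' q \<Longrightarrow> checks d' (\<lambda>I e. \<chi> I e (p I e) (q I e))"
  shows "checks d (\<lambda>I e. edge_at I (\<chi> I e) (m I e) (m' I e))"
  unfolding edge_at_def
  by (intro checks_basic checks_nat_at \<chi> computes_mono[OF m] computes_mono[OF m'])
    (use computes_two[OF m] in \<open>auto elim: computes_mono\<close>)

lemma checks_block_at:
  assumes m: "computes d m" and m': "computes d m'" and N: "computes d N"
    and L: "\<And>s t. computes d s \<Longrightarrow> computes d t \<Longrightarrow>
      checks d (\<lambda>I e. L I e (guard_at I (N I e) (s I e)) (t I e) (m' I e))"
  shows "checks d (\<lambda>I e. block_at I (N I e) (L I e) (m I e) (m' I e))"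
  unfolding block_at_def
  by (intro checks_basic L m m' N) (use computes_two[OF m] in auto)

lemma checks_all_edges:
  assumes x: "computes d x" and y: "computes d y" and N: "computes d N"
    and \<chi>: "\<And>d' s p q. d \<le> d' \<Longrightarrow> computes d' s \<Longrightarrow> computes d' p \<Longrightarrow> computes d' q \<Longrightarrow>
      checks d' (\<lambda>I e. \<chi> I e (guard_at I (N I e) (s I e)) (p I e) (q I e))"
  shows "checks d (\<lambda>I e. all_edges I (N I e) (\<chi> I e) (x I e) (y I e))"
  unfolding all_edges_def
proof (rule checks_all_list[OF x y])
  fix d' t u assume d': "d \<le> d'" "computes d' t" "computes d' u"
  show "checks d' (\<lambda>I e. block_at I (N I e) (\<lambda>g. all_list I (edge_at I (\<chi> I e g))) (t I e) (u I e))"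
  proof (rule checks_block_at[OF d'(2,3) computes_mono[OF N d'(1)]])
    fix s t assume s: "computes d' s" "computes d' t"
    show "checks d' (\<lambda>I e. all_list I (edge_at I (\<chi> I e (guard_at I (N I e) (s I e)))) (t I e) (u I e))"
      by (intro checks_all_list checks_edge_at \<chi> s d' computes_mono[OF s(1)]) (use d' in auto)
  qed
qed

lemma checks_ex_edge:
  assumes x: "computes d x" and y: "computes d y" and N: "computes d N"
    and \<chi>: "\<And>d' s p q. d \<le> d' \<Longrightarrow> computes d' s \<Longrightarrow> computes d' p \<Longrightarrow> computes d' q \<Longrightarrow>
      checks d' (\<lambda>I e. \<chi> I e (guard_at I (N I e) (s I e)) (p I e) (q I e))"
  shows "checks d (\<lambda>I e. ex_edge I (N I e) (\<chi> I e) (x I e) (y I e))"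
  unfolding ex_edge_def
proof (rule checks_ex_list[OF x y])
  fix d' t u assume d': "d \<le> d'" "computes d' t" "computes d' u"
  show "checks d' (\<lambda>I e. block_at I (N I e) (\<lambda>_. all_list I (edge_at I (\<lambda>_ _. True))) (t I e) (u I e))"
  proof (rule checks_block_at[OF d'(2,3) computes_mono[OF N d'(1)]])
    fix s t assume s: "computes d' s" "computes d' t"
    show "checks d' (\<lambda>I e. all_list I (edge_at I (\<lambda>_ _. True)) (t I e) (u I e))"
      by (intro checks_all_list checks_edge_at checks_const s d') (auto dest: computes_two)
  qed
  show "checks d' (\<lambda>I e. block_at I (N I e) (\<lambda>g. ex_list I (edge_at I (\<lambda>_ _. True)) (edge_at I (\<chi> I e g))) (t I e) (u I e))"
  proof (rule checks_block_at[OF d'(2,3) computes_mono[OF N d'(1)]])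
    fix s t assume s: "computes d' s" "computes d' t"
    show "checks d' (\<lambda>I e. ex_list I (edge_at I (\<lambda>_ _. True)) (edge_at I (\<chi> I e (guard_at I (N I e) (s I e)))) (t I e) (u I e))"
      by (intro checks_ex_list checks_edge_at checks_const \<chi> s d' computes_mono[OF s(1)])
        (use d' in \<open>auto dest: computes_two\<close>)
  qed
qed

lemma checks_doc:
  assumes d: "2 \<le> d"
    and LA: "\<And>d' a b x y. d \<le> d' \<Longrightarrow> computes d' a \<Longrightarrow> computes d' b \<Longrightarrow> computes d' x \<Longrightarrow> computes d' y \<Longrightarrow>
      checks d' (\<lambda>I e. LA I e (a I e) (b I e) (x I e) (y I e))"
    and LB: "\<And>d' a b x y. d \<le> d' \<Longrightarrow> computes d' a \<Longrightarrow> computes d' b \<Longrightarrow> computes d' x \<Longrightarrow> computes d' y \<Longrightarrow>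
      checks d' (\<lambda>I e. LB I e (a I e) (b I e) (x I e) (y I e))"
    and \<kappa>: "\<And>d' a b i j. d \<le> d' \<Longrightarrow> computes d' a \<Longrightarrow> computes d' b \<Longrightarrow> computes d' i \<Longrightarrow> computes d' j \<Longrightarrow>
      checks d' (\<lambda>I e. \<kappa> I e (a I e) (b I e) (i I e) (j I e))"
  shows "checks d (\<lambda>I e. doc I (LA I e) (LB I e) (\<kappa> I e))"
  unfolding doc_def
  by (intro checks_basic checks_nat_at LA LB \<kappa>) (use d in \<open>auto elim: computes_mono\<close>)

lemma checks_all_deltas:
  assumes d: "2 \<le> d"
    and \<chi>A: "\<And>d' a b s p q. d \<le> d' \<Longrightarrow> computes d' a \<Longrightarrow> computes d' b \<Longrightarrow> computes d' s \<Longrightarrow> computes d' p \<Longrightarrow> computes d' q \<Longrightarrow>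
      checks d' (\<lambda>I e. \<chi>A I e (a I e) (b I e) (guard_at I (a I e + b I e) (s I e)) (p I e) (q I e))"
    and \<chi>B: "\<And>d' a b s p q. d \<le> d' \<Longrightarrow> computes d' a \<Longrightarrow> computes d' b \<Longrightarrow> computes d' s \<Longrightarrow> computes d' p \<Longrightarrow> computes d' q \<Longrightarrow>
      checks d' (\<lambda>I e. \<chi>B I e (a I e) (b I e) (guard_at I (a I e + b I e) (s I e)) (p I e) (q I e))"
    and \<kappa>: "\<And>d' a b i j. d \<le> d' \<Longrightarrow> computes d' a \<Longrightarrow> computes d' b \<Longrightarrow> computes d' i \<Longrightarrow> computes d' j \<Longrightarrow>
      checks d' (\<lambda>I e. \<kappa> I e (a I e) (b I e) (i I e) (j I e))"
  shows "checks d (\<lambda>I e. all_deltas I (\<chi>A I e) (\<chi>B I e) (\<kappa> I e))"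
  unfolding all_deltas_def
  by (intro checks_doc d \<kappa> checks_all_edges \<chi>A \<chi>B computes_add) (auto elim: computes_mono)

lemma checks_some_delta:
  assumes d: "2 \<le> d"
    and \<chi>: "\<And>d' N s p q. d \<le> d' \<Longrightarrow> computes d' N \<Longrightarrow> computes d' s \<Longrightarrow> computes d' p \<Longrightarrow> computes d' q \<Longrightarrow>
      checks d' (\<lambda>I e. \<chi> I e (guard_at I (N I e) (s I e)) (p I e) (q I e))"
  shows "checks d (\<lambda>I e. some_delta I (\<chi> I e))"
  unfolding some_delta_def
  by (intro checks_disj checks_doc d checks_const checks_all_edges checks_ex_edge
      \<chi>[where N = "\<lambda>I e. _ I e + _ I e"] computes_add)
    (auto elim: computes_mono dest: computes_two)

text \<open>A configuration is the set of the codes of the pairs of a process and its state.  The code 0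
  is the flag for acceptance, and the empty set is the state before the start.\<close>

abbreviation code :: "inst \<Rightarrow> nat \<Rightarrow> nat \<Rightarrow> nat" where
  "code I p q \<equiv> Suc (p * length (word I) + q)"

text \<open>The last conjunct is totality of the transition relations: a number up to the bound is
  no state, where the trivial \<open>all_deltas\<close> serves only to read off
  \<open>a + b\<close>, or it is the source of an edge.\<close>

definition valid :: "inst \<Rightarrow> bool" where
  "valid I \<longleftrightarrow> all_deltas I (\<lambda>a b g p q. p < a \<and> q < a)
      (\<lambda>a b g p q. a \<le> p \<and> p < a + b \<and> a \<le> q \<and> q < a + b) (\<lambda>a b i j. i < a \<and> a \<le> j \<and> j < a + b) \<and>
     (\<forall>p\<le>bound I. all_deltas I (\<lambda>_ _ _ _ _. True) (\<lambda>_ _ _ _ _. True) (\<lambda>a b i j. a + b \<le> p) \<or>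
       some_delta I (\<lambda>g i j. i = p))"

text \<open>Process 0 is the A-process. The last clause keeps everything else out of
  \<open>later\<close>, in particular the flag 0, which is not a code.\<close>

definition starts :: "inst \<Rightarrow> bool" where
  "starts I \<longleftrightarrow> all_deltas I (\<lambda>_ _ _ _ _. True) (\<lambda>_ _ _ _ _. True) (\<lambda>a b i j.
     code I 0 i \<in> later I \<and> (\<exists>p\<le>bound I. 0 < p \<and> code I p j \<in> later I) \<and>
     (\<forall>z\<le>bound I. z \<notin> later I \<or> z = code I 0 i \<or> (\<exists>p\<le>bound I. 0 < p \<and> z = code I p j)))"

text \<open>The clause on \<open>z\<close> says that \<open>later\<close> is \<open>now\<close>
  without the old code and with the new one. Membership and non-membership are spelled out, each
  being a checkable atom.\<close>

definition moves :: "inst \<Rightarrow> bool" where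
  "moves I \<longleftrightarrow> some_delta I (\<lambda>g i j. \<exists>p\<le>bound I. \<exists>p'\<le>bound I. \<exists>l\<le>bound I. p' \<noteq> p \<and>
     code I p i \<in> now I \<and> code I p' l \<in> now I \<and> l \<in> g \<and> code I p j \<in> later I \<and>
     (\<forall>z\<le>bound I. z \<in> later I \<and> (z \<in> now I \<and> z \<noteq> code I p i \<or> z = code I p j) \<or>
        z \<notin> later I \<and> (z \<notin> now I \<or> z = code I p i) \<and> z \<noteq> code I p j))"

definition stuck :: "inst \<Rightarrow> bool" where
  "stuck I \<longleftrightarrow> all_deltas I
     (\<lambda>_ _ g i j. \<forall>p\<le>bound I. \<forall>p'\<le>bound I. \<forall>l\<le>bound I. p' = p \<or> code I p i \<notin> now I \<or> code I p' l \<notin> now I \<or> l \<notin> g)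
     (\<lambda>_ _ g i j. \<forall>p\<le>bound I. \<forall>p'\<le>bound I. \<forall>l\<le>bound I. p' = p \<or> code I p i \<notin> now I \<or> code I p' l \<notin> now I \<or> l \<notin> g)
     (\<lambda>_ _ _ _. True)"

text \<open>For the empty set, \<open>stuck\<close> would hold for lack of processes. Moves and
  acceptance therefore require a code of process 0 in \<open>now\<close>, so that the empty set can
  only be left by the check of the input and the choice of the initial configuration.\<close>

definition deadlock_step :: "inst \<Rightarrow> bool" where
  "deadlock_step I \<longleftrightarrow> (\<forall>z\<le>bound I. z \<notin> now I) \<and> valid I \<and> starts I \<or>
     (\<exists>q\<le>bound I. code I 0 q \<in> now I) \<and> (moves I \<or> stuck I \<and> 0 \<in> later I)"

definition valid_step :: "inst \<Rightarrow> bool" where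
  "valid_step I \<longleftrightarrow> valid I \<and> 0 \<in> later I"

lemma checks_valid: "2 \<le> d \<Longrightarrow> checks d (\<lambda>I e. valid I)"
  unfolding valid_def
  by (intro checks_basic checks_all_deltas checks_some_delta checks_const)
    (auto elim: computes_mono dest: computes_two)

lemma checks_starts: "2 \<le> d \<Longrightarrow> checks d (\<lambda>I e. starts I)"
  unfolding starts_def
  by (intro checks_basic checks_all_deltas checks_const) (auto elim: computes_mono dest: computes_two)

lemma checks_moves: "2 \<le> d \<Longrightarrow> checks d (\<lambda>I e. moves I)"
  unfolding moves_def
  by (intro checks_basic checks_some_delta) (auto elim: computes_mono dest: computes_two)

lemma checks_stuck: "2 \<le> d \<Longrightarrow> checks d (\<lambda>I e. stuck I)"
  unfolding stuck_def
  by (intro checks_basic checks_all_deltas checks_const) (auto elim: computes_mono dest: computes_two)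

lemma checks_deadlock_step: "checks 2 (\<lambda>I e. deadlock_step I)"
  unfolding deadlock_step_def
  by (intro checks_basic checks_valid checks_starts checks_moves checks_stuck) (auto dest: computes_two)

lemma checks_valid_step: "checks 2 (\<lambda>I e. valid_step I)"
  unfolding valid_step_def by (intro checks_basic checks_valid) auto

section \<open>Well-formed words and the first problem\<close>

definition template_of :: "nat \<Rightarrow> nat \<Rightarrow> nat \<Rightarrow> listing \<Rightarrow> nat template" where
  "template_of n m i bs = \<lparr>states = {n..<m}, init = i, guards = fst ` set bs, delta = delta_of bs\<rparr>"

definition proper :: "nat \<Rightarrow> nat \<Rightarrow> nat \<Rightarrow> listing \<Rightarrow> nat \<Rightarrow> listing \<Rightarrow> bool" where
  "proper a b i bsA j bsB \<longleftrightarrow> guards_below (a + b) bsA \<and> guards_below (a + b) bsB \<and>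
     (\<forall>(p, g, q)\<in>delta_of bsA. p < a \<and> q < a) \<and>
     (\<forall>(p, g, q)\<in>delta_of bsB. a \<le> p \<and> p < a + b \<and> a \<le> q \<and> q < a + b) \<and>
     (i < a \<and> a \<le> j \<and> j < a + b) \<and>
     (\<forall>p<a + b. \<exists>(i, g, j)\<in>delta_of bsA \<union> delta_of bsB. i = p)"

lemma disjunctive_template_of:
  assumes Q: "Q = {..<N}"
  shows "disjunctive_template Q (template_of n m i bs) \<longleftrightarrow> i \<in> {n..<m} \<and> guards_below N bs \<and>
     (\<forall>(p, g, q)\<in>delta_of bs. p \<in> {n..<m} \<and> q \<in> {n..<m}) \<and> (\<forall>p\<in>{n..<m}. \<exists>(i, g, j)\<in>delta_of bs. i = p)"
proof -
  have "guards (template_of n m i bs) \<subseteq> Pow Q \<longleftrightarrow> guards_below N bs"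
    unfolding template_of_def guards_below_def Q by auto
  moreover have "delta_of bs \<subseteq> {n..<m} \<times> fst ` set bs \<times> {n..<m} \<longleftrightarrow>
    (\<forall>(p, g, q)\<in>delta_of bs. p \<in> {n..<m} \<and> q \<in> {n..<m})"
    unfolding delta_of_def by force
  moreover have "(\<forall>p\<in>{n..<m}. \<exists>g q'. (p, g, q') \<in> delta_of bs) \<longleftrightarrow> (\<forall>p\<in>{n..<m}. \<exists>(i, g, j)\<in>delta_of bs. i = p)"
    by fastforce
  ultimately show ?thesis unfolding disjunctive_template_def template_of_def by auto
qed

lemma source_iff: "(\<exists>(i, g, j)\<in>D. i = p) \<longleftrightarrow> p \<in> fst ` D"
  by (auto simp: split_beta image_iff)

text \<open>In \<open>proper\<close> the totality of both templates is a single condition on all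
  states. It splits because edges of A start below \<open>a\<close> and edges of B start from
  \<open>a\<close> on.\<close>

lemma proper_iff:
  "disjunctive_templates (template_of 0 a i bsA) (template_of a (a + b) j bsB) \<longleftrightarrow> proper a b i bsA j bsB"
proof -
  have Q: "states (template_of 0 a i bsA) \<union> states (template_of a (a + b) j bsB) = {..<a + b}"
    and D: "states (template_of 0 a i bsA) \<inter> states (template_of a (a + b) j bsB) = {}"
    unfolding template_of_def by auto
  have tot: "(\<forall>p<a + b. \<exists>(i, g, j)\<in>delta_of bsA \<union> delta_of bsB. i = p) \<longleftrightarrow>
    (\<forall>p\<in>{0..<a}. \<exists>(i, g, j)\<in>delta_of bsA. i = p) \<and> (\<forall>p\<in>{a..<a + b}. \<exists>(i, g, j)\<in>delta_of bsB. i = p)"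
    if A: "\<forall>(p, g, q)\<in>delta_of bsA. p \<in> {0..<a} \<and> q \<in> {0..<a}"
    and B: "\<forall>(p, g, q)\<in>delta_of bsB. p \<in> {a..<a + b} \<and> q \<in> {a..<a + b}"
  proof -
    have fA: "p < a" if "p \<in> fst ` delta_of bsA" for p using that A by (auto simp: split_beta)
    have fB: "a \<le> p" if "p \<in> fst ` delta_of bsB" for p using that B by (auto simp: split_beta)
    show ?thesis unfolding source_iff image_Un
    proof (intro iffI conjI ballI allI impI)
      fix p assume *: "\<forall>p<a + b. p \<in> fst ` delta_of bsA \<union> fst ` delta_of bsB"
      {
        assume "p \<in> {0..<a}"
        then have "p \<in> fst ` delta_of bsA \<union> fst ` delta_of bsB" "\<not> a \<le> p" using * by auto
        then show "p \<in> fst ` delta_of bsA" using fB by blast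
      next
        assume "p \<in> {a..<a + b}"
        then have "p \<in> fst ` delta_of bsA \<union> fst ` delta_of bsB" "\<not> p < a" using * by auto
        then show "p \<in> fst ` delta_of bsB" using fA by blast
      }
    next
      fix p assume *: "(\<forall>p\<in>{0..<a}. p \<in> fst ` delta_of bsA) \<and> (\<forall>p\<in>{a..<a + b}. p \<in> fst ` delta_of bsB)"
        and "p < a + b"
      then have "p \<in> {0..<a} \<or> p \<in> {a..<a + b}" by auto
      with * show "p \<in> fst ` delta_of bsA \<union> fst ` delta_of bsB" by blast
    qed
  qed
  have proper_sets: "proper a b i bsA j bsB \<longleftrightarrow> guards_below (a + b) bsA \<and> guards_below (a + b) bsB \<and>
     (\<forall>(p, g, q)\<in>delta_of bsA. p \<in> {0..<a} \<and> q \<in> {0..<a}) \<and>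
     (\<forall>(p, g, q)\<in>delta_of bsB. p \<in> {a..<a + b} \<and> q \<in> {a..<a + b}) \<and>
     (i \<in> {0..<a} \<and> j \<in> {a..<a + b}) \<and>
     (\<forall>p<a + b. \<exists>(i, g, j)\<in>delta_of bsA \<union> delta_of bsB. i = p)"
    unfolding proper_def atLeastLessThan_iff by (simp only: le0 simp_thms conj_assoc)
  define EA where "EA \<longleftrightarrow> (\<forall>(p, g, q)\<in>delta_of bsA. p \<in> {0..<a} \<and> q \<in> {0..<a})"
  define EB where "EB \<longleftrightarrow> (\<forall>(p, g, q)\<in>delta_of bsB. p \<in> {a..<a + b} \<and> q \<in> {a..<a + b})"
  define TA where "TA \<longleftrightarrow> (\<forall>p\<in>{0..<a}. \<exists>(i, g, j)\<in>delta_of bsA. i = p)"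
  define TB where "TB \<longleftrightarrow> (\<forall>p\<in>{a..<a + b}. \<exists>(i, g, j)\<in>delta_of bsB. i = p)"
  define T where "T \<longleftrightarrow> (\<forall>p<a + b. \<exists>(i, g, j)\<in>delta_of bsA \<union> delta_of bsB. i = p)"
  have "EA \<Longrightarrow> EB \<Longrightarrow> T \<longleftrightarrow> TA \<and> TB"
    unfolding EA_def EB_def T_def TA_def TB_def by (rule tot)
  then show ?thesis
    unfolding disjunctive_templates_def Q disjunctive_template_of[OF refl] proper_sets
      EA_def[symmetric] EB_def[symmetric] T_def[symmetric] TA_def[symmetric] TB_def[symmetric]
    using D by argo
qed

text \<open>A listing fixes guards and edges, so an encoded template is determined by its states,
  its initial state and its listing.\<close>

lemma template_problem_iff:
  "w \<in> template_problem R \<longleftrightarrow> (\<exists>a b i bsA j bsB. w = encoding a b i bsA j bsB \<and> proper a b i bsA j bsB \<and>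
     R (template_of 0 a i bsA) (template_of a (a + b) j bsB))" (is "?l \<longleftrightarrow> ?r")
proof
  assume ?l
  then obtain A B a b bsA bsB where *: "disjunctive_templates A B" "R A B"
    "states A = {0..<a}" "states B = {a..<a + b}" "lists_template bsA A" "lists_template bsB B"
    "w = enc_nat a @ enc_nat b @ enc_template (a + b) (init A) bsA @ enc_template (a + b) (init B) bsB"
    unfolding template_problem_def encodes_def by blast
  have "A = template_of 0 a (init A) bsA" "B = template_of a (a + b) (init B) bsB"
    using *(3-6) unfolding lists_template_def template_of_def delta_of_def by (cases A, simp, cases B, simp)
  then show ?r using * proper_iff unfolding encoding_def by metis
next
  assume ?r
  then obtain a b i bsA j bsB where *: "w = encoding a b i bsA j bsB" "proper a b i bsA j bsB"
    "R (template_of 0 a i bsA) (template_of a (a + b) j bsB)" by blast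
  have "encodes w (template_of 0 a i bsA) (template_of a (a + b) j bsB)"
    unfolding encodes_def *(1) encoding_def
    by (intro exI[of _ a] exI[of _ b] exI[of _ bsA] exI[of _ bsB])
      (simp add: template_of_def lists_template_def delta_of_def)
  then show ?l unfolding template_problem_def using * proper_iff by blast
qed

text \<open>Every transition needs some positive counter, so the state with all counters 0 has no
  successor and forms a run by itself.\<close>

lemma has_deadlocked_run_always:
  assumes "disjunctive_templates A B"
  shows "has_deadlocked_run A B"
proof -
  have "(init A, \<lambda>_. 0) \<in> cs_init A B" "(init A, \<lambda>_. 0) \<in> cs_states A B"
    using init_in[OF assms] by (auto simp: cs_init_def cs_states_def)
  moreover have "((init A, \<lambda>_. 0), s) \<notin> cs_trans A B" for s by (auto simp: cs_trans_def)
  ultimately show ?thesis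
    unfolding has_deadlocked_run_def deadlocked_run_def is_run_def
    by (intro exI[of _ "Finite_Path [(init A, \<lambda>_. 0)]"]) auto
qed

text \<open>With at most n states, n * n B-processes suffice. A code \<open>Suc (p * n + q)\<close>
  with \<open>p \<le> n * n\<close> and \<open>q < n\<close> is at most n * n * n + n and thus lies
  below this value.\<close>

definition size_poly :: "nat poly" where "size_poly = [:2, 1, 0, 1:]"

lemma size_poly: "poly size_poly n = n * n * n + n + 2"
  unfolding size_poly_def by (simp add: algebra_simps)

lemma size_poly_ge: "n \<le> poly size_poly n"
  unfolding size_poly by simp

lemma valid_iff:
  assumes bound: "length (word I) \<le> bound I"
    and w: "word I = encoding a b i bsA j bsB" "guards_below (a + b) bsA" "guards_below (a + b) bsB"
  shows "valid I \<longleftrightarrow> proper a b i bsA j bsB"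
proof -
  \<comment> \<open>Both numbers of states are written in unary in the word, so the bounded
    quantifier in \<open>valid\<close> ranges over all states.\<close>
  have "a + b \<le> bound I" using bound unfolding w(1) encoding_def enc_nat_def by simp
  then have "(\<forall>p\<le>bound I. a + b \<le> p \<or> (\<exists>(i, g, j)\<in>delta_of bsA \<union> delta_of bsB. i = p)) \<longleftrightarrow>
    (\<forall>p<a + b. \<exists>(i, g, j)\<in>delta_of bsA \<union> delta_of bsB. i = p)"
    by (meson le_trans linorder_not_le nat_less_le)
  then show ?thesis
    unfolding valid_def proper_def all_deltas_iff[OF bound w] some_delta_iff[OF bound w]
    using w(2,3) by (simp add: split_beta conj_assoc)
qed

lemma valid_decode:
  assumes bound: "length (word I) \<le> bound I" and v: "valid I"
  shows "\<exists>a b i bsA j bsB. word I = encoding a b i bsA j bsB \<and> proper a b i bsA j bsB"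
proof -
  have "all_deltas I (\<lambda>a b g p q. p < a \<and> q < a)
      (\<lambda>a b g p q. a \<le> p \<and> p < a + b \<and> a \<le> q \<and> q < a + b) (\<lambda>a b i j. i < a \<and> a \<le> j \<and> j < a + b)"
    using v unfolding valid_def by (rule conjunct1)
  then obtain a b i bsA j bsB where w: "word I = encoding a b i bsA j bsB"
    "guards_below (a + b) bsA" "guards_below (a + b) bsB"
    by (rule all_deltas_decode[OF bound])
  have "proper a b i bsA j bsB" using v unfolding valid_iff[OF bound w] .
  with w(1) show ?thesis by (intro exI conjI)
qed

lemma all_problem:
  "template_problem has_deadlocked_run =
    {w. \<exists>S. ({}, S) \<in> (set_rel valid_step w (poly size_poly (length w)))\<^sup>* \<and> 0 \<in> S}"
proof (intro set_eqI)
  fix w :: "bool list"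
  let ?P = "poly size_poly (length w)"
  let ?R = "set_rel valid_step w ?P"
  have "w \<in> template_problem has_deadlocked_run \<longleftrightarrow> (\<exists>a b i bsA j bsB. w = encoding a b i bsA j bsB \<and> proper a b i bsA j bsB)"
    unfolding template_problem_iff using has_deadlocked_run_always proper_iff by blast
  also have "\<dots> \<longleftrightarrow> (\<exists>S. ({}, S) \<in> ?R\<^sup>* \<and> 0 \<in> S)"
  proof
    assume "\<exists>a b i bsA j bsB. w = encoding a b i bsA j bsB \<and> proper a b i bsA j bsB"
    then obtain a b i bsA j bsB where w: "w = encoding a b i bsA j bsB" "proper a b i bsA j bsB" by blast
    let ?I = "\<lparr>word = w, bound = ?P, now = {}, later = {0}\<rparr>"
    have "valid ?I"
      using valid_iff[of ?I a b i bsA j bsB] w size_poly_ge by (simp add: proper_def)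
    then have "({}, {0}) \<in> ?R" unfolding set_rel_def valid_step_def by (simp add: size_poly)
    then show "\<exists>S. ({}, S) \<in> ?R\<^sup>* \<and> 0 \<in> S" by blast
  next
    assume "\<exists>S. ({}, S) \<in> ?R\<^sup>* \<and> 0 \<in> S"
    then obtain S where S: "({}, S) \<in> ?R\<^sup>*" "0 \<in> S" by blast
    \<comment> \<open>Since \<open>0 \<in> S\<close>, the path has a last step; \<open>valid\<close>
      reads only the input, so any step certifies it.\<close>
    then obtain S' where "(S', S) \<in> ?R" by (metis empty_iff rtranclE)
    then have "valid \<lparr>word = w, bound = ?P, now = S', later = S\<rparr>"
      unfolding set_rel_def valid_step_def by simp
    from valid_decode[OF _ this] show "\<exists>a b i bsA j bsB. w = encoding a b i bsA j bsB \<and> proper a b i bsA j bsB"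
      by (simp add: size_poly_ge)
  qed
  finally show "w \<in> template_problem has_deadlocked_run \<longleftrightarrow> w \<in> {w. \<exists>S. ({}, S) \<in> (set_rel valid_step w (poly size_poly (length w)))\<^sup>* \<and> 0 \<in> S}"
    by simp
qed

section \<open>Configurations as sets of codes, and the second problem\<close>

definition config :: "nat \<Rightarrow> nat set \<Rightarrow> (nat \<Rightarrow> nat) \<Rightarrow> nat set" where
  "config n Q x = (\<lambda>p. Suc (p * n + x p)) ` Q"

text \<open>\<open>p\<close> and \<open>q\<close> are quotient and remainder of a division by
  \<open>n\<close>.\<close>

lemma code_inject:
  assumes "q < n" "q' < (n :: nat)" "Suc (p * n + q) = Suc (p' * n + q')"
  shows "p = p' \<and> q = q'"
proof -
  have "(p * n + q) div n = p" "(p' * n + q') div n = p'" using assms(1,2) by simp_all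
  then show ?thesis using assms(3) by auto
qed

lemma config_mem:
  assumes "\<And>p. p \<in> Q \<Longrightarrow> x p < n" "q < n"
  shows "Suc (p * n + q) \<in> config n Q x \<longleftrightarrow> p \<in> Q \<and> x p = q"
  unfolding config_def using code_inject[of q n] assms by blast

text \<open>Codes of different processes differ, so deleting the old code of \<open>p\<close>
  deletes no other process.\<close>

lemma config_upd:
  assumes x: "\<forall>p\<in>Q. x p < n" and p: "p \<in> Q"
  shows "config n Q (x(p := j)) = (config n Q x - {Suc (p * n + x p)}) \<union> {Suc (p * n + j)}"
proof -
  define f where "f = (\<lambda>r. Suc (r * n + x r))"
  define g where "g = (\<lambda>r. Suc (r * n + (x(p := j)) r))"
  have Q: "insert p (Q - {p}) = Q" using p by (rule insert_Diff)
  have fresh: "f p \<notin> f ` (Q - {p})"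
  proof
    assume "f p \<in> f ` (Q - {p})"
    then obtain r where r: "r \<in> Q" "r \<noteq> p" "f p = f r" by (elim imageE DiffE) simp
    have "p = r \<and> x p = x r"
      by (rule code_inject[OF bspec[OF x p] bspec[OF x r(1)] r(3)[unfolded f_def]])
    with r(2) show False by simp
  qed
  have image_f: "f ` Q = insert (f p) (f ` (Q - {p}))" by (simp only: image_insert[symmetric] Q)
  have "f ` Q - {f p} = f ` (Q - {p})" unfolding image_f by (rule Diff_insert_absorb[OF fresh])
  moreover have "g ` (Q - {p}) = f ` (Q - {p})"
    unfolding f_def g_def by (rule image_cong[OF refl]) simp
  moreover have "g ` Q = insert (g p) (g ` (Q - {p}))" by (simp only: image_insert[symmetric] Q)
  moreover have "f p = Suc (p * n + x p)" "g p = Suc (p * n + j)" unfolding f_def g_def by simp_all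
  moreover have "config n Q x = f ` Q" "config n Q (x(p := j)) = g ` Q" unfolding config_def f_def g_def by (rule refl)+
  ultimately show ?thesis by simp
qed

context
  fixes a b i j :: nat and bsA bsB :: listing and w :: "bool list" and n P :: nat
    and A B :: "nat template" and D :: "(nat \<times> nat set \<times> nat) set"
  assumes w: "w = encoding a b i bsA j bsB" and proper: "proper a b i bsA j bsB"
    and n: "n = length w" and P: "P = poly size_poly n"
    and A: "A = template_of 0 a i bsA" and B: "B = template_of a (a + b) j bsB"
    and D: "D = delta_of bsA \<union> delta_of bsB"
begin

abbreviation step_inst :: "nat set \<Rightarrow> nat set \<Rightarrow> inst" where
  "step_inst S T \<equiv> \<lparr>word = w, bound = P, now = S, later = T\<rparr>"

lemma ab_le: "a + b \<le> n" "0 < a" "0 < n" "P = n * n * n + n + 2"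
proof -
  show "a + b \<le> n" unfolding n w encoding_def enc_nat_def by simp
  show "0 < a" using proper unfolding proper_def by auto
  with \<open>a + b \<le> n\<close> show "0 < n" by simp
  show "P = n * n * n + n + 2" unfolding P size_poly ..
qed

lemma guards_ok: "guards_below (a + b) bsA" "guards_below (a + b) bsB"
  using proper unfolding proper_def by auto

lemma bound_ok: "length (word (step_inst S T)) \<le> bound (step_inst S T)"
  unfolding P n using size_poly_ge by simp

lemma word_ok: "word (step_inst S T) = encoding a b i bsA j bsB"
  by (simp add: w)

lemma templates_ok: "disjunctive_templates A B"
  unfolding A B using proper proper_iff by blast

lemma delta_eq: "delta A \<union> delta B = D"
  unfolding A B D template_of_def by simp

lemma states_eq: "states A \<union> states B = {..<a + b}"
  unfolding A B template_of_def by auto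

lemma D_bounds:
  assumes "(p, g, q) \<in> D"
  shows "p < n" "q < n" "l \<in> g \<Longrightarrow> l < n"
proof -
  have "p \<in> states A \<union> states B \<and> q \<in> states A \<union> states B \<and> g \<subseteq> states A \<union> states B"
    using assms deltaA[OF templates_ok] deltaB[OF templates_ok] unfolding delta_eq[symmetric] by blast
  then show "p < n" "q < n" "l \<in> g \<Longrightarrow> l < n" unfolding states_eq using ab_le(1) by auto
qed

lemma start_eq: "start_of A B p = (if p = 0 then i else j)"
  unfolding start_of_def[OF templates_ok] by (simp add: A B template_of_def)

lemma reached_below:
  assumes "(start_of A B, x) \<in> (pstep D (insert 0 Q))\<^sup>*" "0 \<notin> Q" "p \<in> insert 0 Q"
  shows "x p < a + b"
proof -
  have "typed A B Q x"
    using psteps_typed[OF templates_ok] assms(1,2) typed_start[OF templates_ok] unfolding delta_eq by blast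
  then have "x p \<in> states A \<union> states B" using assms(3) unfolding typed_def by auto
  then show ?thesis unfolding states_eq by simp
qed

lemma moves_iff: "moves (step_inst S T) \<longleftrightarrow> (\<exists>(k, g, m)\<in>D. \<exists>p\<le>P. \<exists>p'\<le>P. \<exists>l\<le>P. p' \<noteq> p \<and>
     Suc (p * n + k) \<in> S \<and> Suc (p' * n + l) \<in> S \<and> l \<in> g \<and> Suc (p * n + m) \<in> T \<and>
     (\<forall>z\<le>P. z \<in> T \<and> (z \<in> S \<and> z \<noteq> Suc (p * n + k) \<or> z = Suc (p * n + m)) \<or>
        z \<notin> T \<and> (z \<notin> S \<or> z = Suc (p * n + k)) \<and> z \<noteq> Suc (p * n + m)))"
  unfolding moves_def some_delta_iff[OF bound_ok word_ok guards_ok] D n by simp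

lemma stuck_iff: "stuck (step_inst S T) \<longleftrightarrow> (\<forall>(k, g, m)\<in>D. \<forall>p\<le>P. \<forall>p'\<le>P. \<forall>l\<le>P. p' = p \<or>
     Suc (p * n + k) \<notin> S \<or> Suc (p' * n + l) \<notin> S \<or> l \<notin> g)"
  unfolding stuck_def all_deltas_iff[OF bound_ok word_ok guards_ok] D n ball_Un by simp

lemma starts_iff: "starts (step_inst S T) \<longleftrightarrow> Suc (0 * n + i) \<in> T \<and> (\<exists>p\<le>P. 0 < p \<and> Suc (p * n + j) \<in> T) \<and>
     (\<forall>z\<le>P. z \<notin> T \<or> z = Suc (0 * n + i) \<or> (\<exists>p\<le>P. 0 < p \<and> z = Suc (p * n + j)))"
  unfolding starts_def all_deltas_iff[OF bound_ok word_ok guards_ok] n by (simp add: split_beta)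

lemma code_bound:
  assumes "p \<le> (a + b) * (a + b)" "q < a + b"
  shows "Suc (p * n + q) < P"
proof -
  have "p \<le> n * n" using assms(1) mult_le_mono[OF ab_le(1) ab_le(1)] by linarith
  then have "p * n \<le> n * n * n" by simp
  then show ?thesis using assms(2) ab_le(1,4) by linarith
qed

text \<open>As \<open>n\<close> is positive, a process number does not exceed its code, so
  quantifiers bounded by \<open>P\<close> reach every process of a configuration.\<close>

lemma process_bound:
  assumes "Suc (p * n + q) < P"
  shows "p \<le> P"
proof -
  have "p * 1 \<le> p * n" using ab_le(3) by (intro mult_le_mono2) simp
  then show ?thesis using assms by linarith
qed

lemma moves_sound:
  assumes x: "\<And>p. p \<in> Q \<Longrightarrow> x p < a + b" and S: "config n Q x \<subseteq> {..<P}" and T: "T \<subseteq> {..<P}"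
    and m: "moves (step_inst (config n Q x) T)"
  shows "\<exists>x'. (x, x') \<in> pstep D Q \<and> T = config n Q x'"
proof -
  have xn: "\<And>p. p \<in> Q \<Longrightarrow> x p < n" using x ab_le(1) by (meson less_le_trans)
  then have xs: "\<forall>p\<in>Q. x p < n" by blast
  obtain k g m p p' l where kgm: "(k, g, m) \<in> D" and p: "p' \<noteq> p"
    "Suc (p * n + k) \<in> config n Q x" "Suc (p' * n + l) \<in> config n Q x" "l \<in> g" "Suc (p * n + m) \<in> T"
    and z: "\<And>z. z \<le> P \<Longrightarrow> z \<in> T \<and> (z \<in> config n Q x \<and> z \<noteq> Suc (p * n + k) \<or> z = Suc (p * n + m)) \<or>
        z \<notin> T \<and> (z \<notin> config n Q x \<or> z = Suc (p * n + k)) \<and> z \<noteq> Suc (p * n + m)"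
    using m unfolding moves_iff by blast
  have p1: "p \<in> Q" "x p = k" using p(2) config_mem[OF xn] D_bounds(1)[OF kgm] by auto
  have p2: "p' \<in> Q" "x p' = l" using p(3) config_mem[OF xn] D_bounds(3)[OF kgm p(4)] by auto
  have "T = config n Q (x(p := m))"
    unfolding config_upd[OF xs p1(1)] p1(2)
  proof (intro set_eqI)
    fix y show "y \<in> T \<longleftrightarrow> y \<in> config n Q x - {Suc (p * n + k)} \<union> {Suc (p * n + m)}"
    \<comment> \<open>The formula describes \<open>T\<close> only up to \<open>P\<close>; from
      \<open>P\<close> on neither side has elements, because the new code belongs to
      \<open>T\<close>.\<close>
    proof (cases "y < P")
      case True
      then show ?thesis using z[of y] by auto
    next
      case False
      then show ?thesis using S T p(5) by blast
    qed
  qed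
  moreover have "(x, x(p := m)) \<in> pstep D Q"
    using p1 p2 p kgm by (intro pstepI[of p Q p' x g]) auto
  ultimately show ?thesis by blast
qed

lemma moves_complete:
  assumes x: "\<And>p. p \<in> Q \<Longrightarrow> x p < a + b" and Q: "Q \<subseteq> {..(a + b) * (a + b)}"
    and s: "(x, x') \<in> pstep D Q"
  shows "moves (step_inst (config n Q x) (config n Q x'))"
proof -
  have xn: "\<And>p. p \<in> Q \<Longrightarrow> x p < n" using x ab_le(1) by (meson less_le_trans)
  then have xs: "\<forall>p\<in>Q. x p < n" by blast
  have bd: "\<And>p. p \<in> Q \<Longrightarrow> p \<le> P" using code_bound process_bound x Q by blast
  obtain p p' g m where p: "p \<in> Q" "p' \<in> Q" "p' \<noteq> p" "(x p, g, m) \<in> D" "x p' \<in> g" and x': "x' = x(p := m)"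
    using s unfolding pstep_def by blast
  have le: "p \<le> P" "p' \<le> P" "x p' \<le> P" using bd p(1,2) xn[OF p(2)] ab_le(4) by (blast, blast, linarith)
  have mem: "Suc (r * n + x r) \<in> config n Q x" if "r \<in> Q" for r
    using that unfolding config_def by blast
  have new: "Suc (p * n + m) \<in> config n Q x'"
    unfolding x' config_upd[OF xs p(1)] by blast
  have z: "z \<in> config n Q x' \<and> (z \<in> config n Q x \<and> z \<noteq> Suc (p * n + x p) \<or> z = Suc (p * n + m)) \<or>
        z \<notin> config n Q x' \<and> (z \<notin> config n Q x \<or> z = Suc (p * n + x p)) \<and> z \<noteq> Suc (p * n + m)" for z
    unfolding x' config_upd[OF xs p(1)] by blast
  show ?thesis
    unfolding moves_iff
    by (rule bexI[OF _ p(4)], unfold prod.case, rule exI[of _ p], rule conjI[OF le(1)], rule exI[of _ p'],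
        rule conjI[OF le(2)], rule exI[of _ "x p'"], rule conjI[OF le(3)])
      (intro conjI allI impI p(3,5) mem[OF p(1)] mem[OF p(2)] new z)
qed

lemma stuck_config:
  assumes x: "\<And>p. p \<in> Q \<Longrightarrow> x p < a + b" and S: "config n Q x \<subseteq> {..<P}"
  shows "stuck (step_inst (config n Q x) T) \<longleftrightarrow> dead D Q x"
proof
  have xn: "\<And>p. p \<in> Q \<Longrightarrow> x p < n" using x ab_le(1) by (meson less_le_trans)
  have c: "Suc (r * n + x r) \<in> config n Q x" if "r \<in> Q" for r
    using that unfolding config_def by blast
  have bd: "r \<le> P" "x r \<le> P" if "r \<in> Q" for r
    using process_bound c[OF that] S xn[OF that] ab_le(4) by (blast, linarith)
  {
    assume "stuck (step_inst (config n Q x) T)"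
    then have *: "\<And>k g m p p' l. (k, g, m) \<in> D \<Longrightarrow> p \<le> P \<Longrightarrow> p' \<le> P \<Longrightarrow> l \<le> P \<Longrightarrow> p' = p \<or>
     Suc (p * n + k) \<notin> config n Q x \<or> Suc (p' * n + l) \<notin> config n Q x \<or> l \<notin> g"
      unfolding stuck_iff by blast
    show "dead D Q x" unfolding dead_def
    proof (intro ballI allI impI)
      fix p p' g m assume "p \<in> Q" "p' \<in> Q" "p' \<noteq> p" "(x p, g, m) \<in> D"
      then show "x p' \<notin> g" using *[of "x p" g m p p' "x p'"] bd c by blast
    qed
  next
    assume d: "dead D Q x"
    have "p' = p \<or> Suc (p * n + k) \<notin> config n Q x \<or> Suc (p' * n + l) \<notin> config n Q x \<or> l \<notin> g"
      if "(k, g, m) \<in> D" for k g m p p' l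
    proof (rule ccontr)
      assume "\<not> ?thesis"
      then have *: "p' \<noteq> p" "Suc (p * n + k) \<in> config n Q x" "Suc (p' * n + l) \<in> config n Q x" "l \<in> g" by auto
      then have "p \<in> Q" "x p = k" "p' \<in> Q" "x p' = l"
        using config_mem[OF xn] D_bounds(1)[OF that] D_bounds(3)[OF that *(4)] by auto
      then show False using d * that unfolding dead_def by blast
    qed
    then show "stuck (step_inst (config n Q x) T)" unfolding stuck_iff by blast
  }
qed

lemma config_start:
  assumes "0 \<notin> Q"
  shows "config n (insert 0 Q) (start_of A B) = insert (Suc (0 * n + i)) ((\<lambda>p. Suc (p * n + j)) ` Q)"
proof -
  have "(\<lambda>p. Suc (p * n + start_of A B p)) ` Q = (\<lambda>p. Suc (p * n + j)) ` Q"
    using assms by (intro image_cong refl) (metis start_eq)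
  then show ?thesis unfolding config_def image_insert start_eq[of 0] by simp
qed

text \<open>The processes are read off from \<open>T\<close>. They are finitely many because all
  codes lie below \<open>P\<close>, although their numbers may exceed the bound of
  \<open>pos_bounded\<close>.\<close>

lemma starts_sound:
  assumes T: "T \<subseteq> {..<P}" and s: "starts (step_inst S T)"
  shows "\<exists>Q. finite Q \<and> 0 \<notin> Q \<and> Q \<noteq> {} \<and> T = config n (insert 0 Q) (start_of A B)"
proof -
  let ?Q = "{p. 0 < p \<and> Suc (p * n + j) \<in> T}"
  have "?Q \<subseteq> {..P}" using process_bound T by blast
  then have "finite ?Q" by (rule finite_subset) simp
  moreover have Q: "0 \<notin> ?Q" "?Q \<noteq> {}" using s unfolding starts_iff by auto
  moreover have "T = config n (insert 0 ?Q) (start_of A B)"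
    unfolding config_start[OF Q(1)]
  proof (intro equalityI subsetI)
    fix z assume z: "z \<in> T"
    then have "z \<le> P" using T by auto
    then have "z = Suc (0 * n + i) \<or> (\<exists>p\<le>P. 0 < p \<and> z = Suc (p * n + j))"
      using s z unfolding starts_iff by blast
    then show "z \<in> insert (Suc (0 * n + i)) ((\<lambda>p. Suc (p * n + j)) ` ?Q)" using z by blast
  next
    fix z assume "z \<in> insert (Suc (0 * n + i)) ((\<lambda>p. Suc (p * n + j)) ` ?Q)"
    then show "z \<in> T" using s unfolding starts_iff by blast
  qed
  ultimately show ?thesis by blast
qed

lemma starts_complete:
  assumes Q: "Q \<subseteq> {1..(a + b) * (a + b)}" "Q \<noteq> {}"
  shows "starts (step_inst S (config n (insert 0 Q) (start_of A B)))"
proof -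
  have Q0: "0 \<notin> Q" using Q(1) by auto
  have j: "j < a + b" using proper unfolding proper_def by auto
  have bd: "p \<le> P \<and> 0 < p" if "p \<in> Q" for p
  proof -
    have "p \<le> (a + b) * (a + b)" "0 < p" using that Q(1) by auto
    then show ?thesis using process_bound code_bound j by blast
  qed
  show ?thesis unfolding starts_iff config_start[OF Q0] using bd Q(2) by blast
qed

text \<open>From left to right, \<open>pos_bounded\<close> limits the process numbers, so that all
  codes lie below \<open>P\<close>. From right to left the path may use any finite set of processes,
  and \<open>pos_processes\<close> applies.\<close>

lemma has_deadlock_iff:
  defines "R \<equiv> set_rel deadlock_step w P"
  shows "has_deadlocked_run_pos A B \<longleftrightarrow> (\<exists>S. ({}, S) \<in> R\<^sup>* \<and> 0 \<in> S)"
proof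
  assume "has_deadlocked_run_pos A B"
  then obtain Q x where Q: "Q \<subseteq> {1..(a + b) * (a + b)}" "Q \<noteq> {}"
    and x: "(start_of A B, x) \<in> (pstep D (insert 0 Q))\<^sup>*" and d: "dead D (insert 0 Q) x"
    unfolding pos_bounded[OF templates_ok] delta_eq states_eq card_lessThan by blast
  let ?Q = "insert 0 Q"
  have Q0: "0 \<notin> Q" and Q': "?Q \<subseteq> {..(a + b) * (a + b)}" using Q(1) by auto
  have below: "config n ?Q y \<subseteq> {..<P}" if "(start_of A B, y) \<in> (pstep D ?Q)\<^sup>*" for y
    using code_bound reached_below[OF that Q0] Q' unfolding config_def by blast
  have zero: "\<exists>q\<le>P. Suc (0 * n + q) \<in> config n ?Q y" if "(start_of A B, y) \<in> (pstep D ?Q)\<^sup>*" for y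
  proof -
    have "y 0 \<le> P" using reached_below[OF that Q0, of 0] ab_le(1,4) by auto
    then show ?thesis unfolding config_def by blast
  qed
  have valid: "valid (step_inst S T)" for S T
    using valid_iff[OF bound_ok word_ok guards_ok] proper by blast
  have "({}, config n ?Q (start_of A B)) \<in> R"
    using below[of "start_of A B"] starts_complete[OF Q, of "{}"] valid
    unfolding R_def set_rel_def deadlock_step_def by simp
  moreover have "(config n ?Q (start_of A B), config n ?Q x) \<in> R\<^sup>*" using x
  proof (induction rule: rtrancl_induct)
    case (step y z)
    have yz: "(start_of A B, z) \<in> (pstep D ?Q)\<^sup>*" using step(1,2) by (rule rtrancl_into_rtrancl)
    have "moves (step_inst (config n ?Q y) (config n ?Q z))"
      using moves_complete[OF reached_below[OF step(1) Q0] Q' step(2)] .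
    then have "(config n ?Q y, config n ?Q z) \<in> R"
      using below[OF step(1)] below[OF yz] zero[OF step(1)]
      unfolding R_def set_rel_def deadlock_step_def n by simp
    with step(3) show ?case by (rule rtrancl_into_rtrancl)
  qed simp
  moreover have "(config n ?Q x, {0}) \<in> R"
  proof -
    have "stuck (step_inst (config n ?Q x) {0})"
      using stuck_config[OF reached_below[OF x Q0] below[OF x]] d by blast
    then show ?thesis
      using below[OF x] zero[OF x] ab_le(4) unfolding R_def set_rel_def deadlock_step_def n by simp
  qed
  ultimately have "({}, {0}) \<in> R\<^sup>*"
    by (meson converse_rtrancl_into_rtrancl rtrancl_into_rtrancl)
  then show "\<exists>S. ({}, S) \<in> R\<^sup>* \<and> 0 \<in> S" by blast
next
  assume "\<exists>S. ({}, S) \<in> R\<^sup>* \<and> 0 \<in> S"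
  then obtain S where S: "({}, S) \<in> R\<^sup>*" "0 \<in> S" by blast
  let ?good = "\<lambda>S. \<exists>Q x. finite Q \<and> 0 \<notin> Q \<and> Q \<noteq> {} \<and> S = config n (insert 0 Q) x \<and>
    (start_of A B, x) \<in> (pstep D (insert 0 Q))\<^sup>*"
  \<comment> \<open>A step by \<open>stuck\<close> demands of \<open>later\<close> only the flag 0
    and leaves the rest of it open, so from then on the invariant records the deadlocked run
    itself.\<close>
  have inv: "has_deadlocked_run_pos A B \<or> S = {} \<or> ?good S" using S(1)
  proof (induction rule: rtrancl_induct)
    case (step S T)
    have ST: "S \<subseteq> {..<P}" "T \<subseteq> {..<P}" "deadlock_step (step_inst S T)"
      using step(2) unfolding R_def set_rel_def by auto
    consider "has_deadlocked_run_pos A B" | "S = {}" | "?good S" using step(3) by blast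
    then show ?case
    proof cases
      case 2
      then have "starts (step_inst S T)" using ST(3) unfolding deadlock_step_def by simp
      with starts_sound[OF ST(2)] have "?good T" by blast
      then show ?thesis by blast
    next
      case 3
      then obtain Q x where Q: "finite Q" "0 \<notin> Q" "Q \<noteq> {}" "S = config n (insert 0 Q) x"
        and x: "(start_of A B, x) \<in> (pstep D (insert 0 Q))\<^sup>*" by blast
      have "Suc (0 * n + x 0) \<in> S" unfolding Q(4) config_def by blast
      then have "\<not> (\<forall>z\<le>P. z \<notin> S)" using ST(1) by fastforce
      then have "moves (step_inst S T) \<or> stuck (step_inst S T)"
        using ST(3) unfolding deadlock_step_def by auto
      moreover have below: "\<And>p. p \<in> insert 0 Q \<Longrightarrow> x p < a + b" by (rule reached_below[OF x Q(2)])
      ultimately show ?thesis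
      proof (elim disjE)
        assume m: "moves (step_inst S T)"
        have "\<exists>x'. (x, x') \<in> pstep D (insert 0 Q) \<and> T = config n (insert 0 Q) x'"
          by (rule moves_sound[OF _ ST(1)[unfolded Q(4)] ST(2) m[unfolded Q(4)]]) (erule below)
        then obtain x' where x': "(x, x') \<in> pstep D (insert 0 Q)" "T = config n (insert 0 Q) x'" by blast
        have "(start_of A B, x') \<in> (pstep D (insert 0 Q))\<^sup>*"
          using x x'(1) by (rule rtrancl_into_rtrancl)
        with Q(1-3) x'(2) have "?good T" by (intro exI[of _ Q] exI[of _ x'] conjI)
        then show ?thesis by (intro disjI2)
      next
        assume m: "stuck (step_inst S T)"
        have "stuck (step_inst (config n (insert 0 Q) x) T) \<longleftrightarrow> dead D (insert 0 Q) x"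
          by (rule stuck_config[OF _ ST(1)[unfolded Q(4)]]) (erule below)
        with m have "dead D (insert 0 Q) x" unfolding Q(4) by (rule iffD1[rotated])
        with Q(1-3) x have "has_deadlocked_run_pos A B"
          unfolding pos_processes[OF templates_ok] delta_eq by (intro exI[of _ Q] exI[of _ x] conjI)
        then show ?thesis by (rule disjI1)
      qed
    qed blast
  qed blast
  \<comment> \<open>Codes are successors, so no configuration contains the flag 0.\<close>
  have not_good: "\<not> ?good S"
  proof
    assume "?good S"
    then obtain Q x where "S = config n (insert 0 Q) x" by (elim exE conjE)
    with S(2) show False unfolding config_def by auto
  qed
  have nonempty: "S \<noteq> {}" using S(2) by auto
  show "has_deadlocked_run_pos A B"
    using inv by ((simp only: nonempty not_good simp_thms; fail) | (elim disjE; (assumption | (erule notE[OF nonempty]) | (erule notE[OF not_good]))))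
qed

end

lemma pos_problem:
  "template_problem has_deadlocked_run_pos =
    {w. \<exists>S. ({}, S) \<in> (set_rel deadlock_step w (poly size_poly (length w)))\<^sup>* \<and> 0 \<in> S}"
proof (intro set_eqI)
  fix w :: "bool list"
  let ?P = "poly size_poly (length w)"
  let ?R = "set_rel deadlock_step w ?P"
  have ok: "has_deadlocked_run_pos (template_of 0 a i bsA) (template_of a (a + b) j bsB) \<longleftrightarrow>
    (\<exists>S. ({}, S) \<in> ?R\<^sup>* \<and> 0 \<in> S)" if "w = encoding a b i bsA j bsB" "proper a b i bsA j bsB" for a b i bsA j bsB
    by (rule has_deadlock_iff[OF that refl refl refl refl refl])
  show "w \<in> template_problem has_deadlocked_run_pos \<longleftrightarrow>
    w \<in> {w. \<exists>S. ({}, S) \<in> (set_rel deadlock_step w (poly size_poly (length w)))\<^sup>* \<and> 0 \<in> S}"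
  proof
    assume "w \<in> template_problem has_deadlocked_run_pos"
    then obtain a b i bsA j bsB where "w = encoding a b i bsA j bsB" "proper a b i bsA j bsB"
      "has_deadlocked_run_pos (template_of 0 a i bsA) (template_of a (a + b) j bsB)"
      unfolding template_problem_iff by (elim exE conjE)
    then have "\<exists>S. ({}, S) \<in> ?R\<^sup>* \<and> 0 \<in> S" by (intro iffD1[OF ok])
    then show "w \<in> {w. \<exists>S. ({}, S) \<in> (set_rel deadlock_step w (poly size_poly (length w)))\<^sup>* \<and> 0 \<in> S}"
      by (rule CollectI)
  next
    assume "w \<in> {w. \<exists>S. ({}, S) \<in> (set_rel deadlock_step w (poly size_poly (length w)))\<^sup>* \<and> 0 \<in> S}"
    then have ex: "\<exists>S. ({}, S) \<in> ?R\<^sup>* \<and> 0 \<in> S" by (rule CollectD)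
    then obtain S where S: "({}, S) \<in> ?R\<^sup>*" "0 \<in> S" by (elim exE conjE)
    then have "S \<noteq> {}" by auto
    \<comment> \<open>The empty set has no code of process 0, so the first step of the path is the
      one that checks \<open>valid\<close>.\<close>
    with S(1) obtain T where "({}, T) \<in> ?R" by (cases rule: converse_rtranclE) auto
    then have "valid \<lparr>word = w, bound = ?P, now = {}, later = T\<rparr>"
      unfolding set_rel_def deadlock_step_def by simp
    from valid_decode[OF _ this] have "\<exists>a b i bsA j bsB. w = encoding a b i bsA j bsB \<and> proper a b i bsA j bsB"
      by (simp add: size_poly_ge)
    then obtain a b i bsA j bsB where wp: "w = encoding a b i bsA j bsB" "proper a b i bsA j bsB"
      by (elim exE conjE)
    have "has_deadlocked_run_pos (template_of 0 a i bsA) (template_of a (a + b) j bsB)"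
      by (rule iffD2[OF ok[OF wp] ex])
    with wp show "w \<in> template_problem has_deadlocked_run_pos"
      unfolding template_problem_iff by (intro exI conjI)
  qed
qed

theorem theorem1:
  "template_problem has_deadlocked_run \<in> NEXPTIME \<and> template_problem has_deadlocked_run_pos \<in> NEXPTIME"
  unfolding all_problem pos_problem
  by (rule conjI[OF NEXPTIME_reach[OF checks_valid_step] NEXPTIME_reach[OF checks_deadlock_step]])

end
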